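(* Let $p,q\in[1,\infty]$, $x_0\in\mathbb{R}^d$ and let $\sigma=(\sigma_j)_j$ be an admissible sequence such that either $-d/p<\overline{s}(\sigma)<0$, or $0\le\lfloor\overline{s}(\sigma)\rfloor<\underline{s}(\sigma)$. Let a wavelet basis in the Schwartz class be given. If $f\in L^p(\mathbb{R}^d)$ belongs to $T^{\sigma}_{p,q}(x_0)$, then \[ (\sigma_j\,d^p_j(x_0))_j\in\ell^q . \]
   Context: $\mathbb{N}_0=\{0,1,2,\dots\}$. If $p=\infty$, then $d/p=0$ and $\ell^p$-type sums are replaced by suprema. Admissible sequences. A sequence $\sigma=(\sigma_j)_{j\in\mathbb{N}_0}$ of positive reals is admissible if there is $C>0$ with $C^{-1}\sigma_j\le\sigma_{j+1}\le C\sigma_j$ for all $j$. Put $\underline{\sigma}_j=\inf_{k\in\mathbb{N}_0}\sigma_{j+k}/\sigma_k$, $\overline{\sigma}_j=\sup_{k\in\mathbb{N}_0}\sigma_{j+k}/\sigma_k$; the lower and upper Boyd indices are $\underline{s}(\sigma)=\lim_j \frac{\log_2\underline{\sigma}_j}{j}$ and $\overline{s}(\sigma)=\lim_j\frac{\log_2\overline{\sigma}_j}{j}$. The space $T^{\sigma}_{p,q}(x_0)$. Let $m=\lfloor\overline{s}(\sigma)\rfloor+1$, $\Delta_h^1f(x)=f(x+h)-f(x)$, $\Delta_h^{k+1}f=\Delta_h^1\Delta_h^kf$, $B(x_0,r)$ the open ball, $B_h(x_0,r)=\{x:[x,x+mh]\subset B(x_0,r)\}$; if $m\le 0$, one puts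 $\Delta_h^mf=f$ and $B_h(x_0,r)=B(x_0,r)$. Then $f\in L^p_{\mathrm{loc}}(\mathbb{R}^d)$ belongs to $T^{\sigma}_{p,q}(x_0)$ if $(\sigma_j2^{jd/p}\sup_{|h|\le2^{-j}}\|\Delta_h^{m}f\|_{L^p(B_h(x_0,2^{-j}))})_{j\in\mathbb{N}_0}\in\ell^q$. Wavelets. $\varphi$ and $\psi^{(i)}$ ($1\le i<2^d$) are functions in the Schwartz class such that $\{\varphi(x-k):k\in\mathbb{Z}^d\}\cup\{\psi^{(i)}(2^jx-k):1\le i<2^d,k\in\mathbb{Z}^d,j\in\mathbb{N}_0\}$ is an orthogonal basis of $L^2(\mathbb{R}^d)$ (as usual, all moments of the $\psi^{(i)}$ vanish). The wavelet coefficients of $f$ are $c^{(i)}_{j,k}=2^{dj}\int f(x)\psi^{(i)}(2^jx-k)\,dx$. Leaders. Identify $i\in\{1,\dots,2^d-1\}$ with an element of $\{0,1\}^d\setminus\{0\}$ and set $\lambda^{(i)}_{j,k}=\frac{i}{2^{j+1}}+\frac{k}{2^j}+[0,\frac1{2^{j+1}})^d$. For a dyadic cube $\lambda$ of side length $2^{-j}$ put \[d^p_\lambda=\sup_{j'\ge j}\Big(\sum_{(i,k'):\ \lambda^{(i)}_{j',k'}\subset\lambda}(2^{(j-j')d/p}|c^{(i)}_{j',k'}|)^p\Big)^{1/p}.\] $\lambda_j(x_0)$ is the dyadic cube of side $2^{-j}$ containing $x_0$, $3\lambda_j(x_0)$ is the set of the $3^d$ dyadic cubes of side $2^{-j}$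 at distance $0$ from it (itself included), and $d^p_j(x_0)=\sup_{\lambda\in3\lambda_j(x_0)}d^p_\lambda$. *)

theory Defs
  imports "HOL-Analysis.Analysis" "HOL-Probability.Essential_Supremum"
begin

section \<open>Lebesgue and sequence spaces with exponents in $[1,\infty]$\<close>

text \<open>\<open>recip p\<close> is $1/p$, with $1/\infty = 0$.\<close>

definition recip :: "ennreal \<Rightarrow> real" where
  "recip p = enn2real (inverse p)"

text \<open>Powers with a positive real exponent on $[0,\infty]$.\<close>

definition epowr :: "ennreal \<Rightarrow> real \<Rightarrow> ennreal" where
  "epowr x a = (if x = \<infinity> then \<infinity> else ennreal (enn2real x powr a))"

definition Lp_norm :: "ennreal \<Rightarrow> 'a measure \<Rightarrow> ('a \<Rightarrow> complex) \<Rightarrow> ennreal" where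
  "Lp_norm p M f =
     (if p = \<infinity> then esssup M (\<lambda>x. ennreal (norm (f x)))
      else epowr (\<integral>\<^sup>+ x. ennreal (norm (f x) powr enn2real p) \<partial>M) (recip p))"

definition Lp_space :: "ennreal \<Rightarrow> (real^'n \<Rightarrow> complex) set" where
  "Lp_space p = {f \<in> borel_measurable lebesgue. Lp_norm p lebesgue f < \<infinity>}"

definition Lp_loc :: "ennreal \<Rightarrow> (real^'n \<Rightarrow> complex) set" where
  "Lp_loc p =
     {f \<in> borel_measurable lebesgue. \<forall>K. compact K \<longrightarrow> Lp_norm p (lebesgue_on K) f < \<infinity>}"

definition lp_norm :: "ennreal \<Rightarrow> 'i set \<Rightarrow> ('i \<Rightarrow> ennreal) \<Rightarrow> ennreal" where
  "lp_norm p I a =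
     (if p = \<infinity> then (SUP i\<in>I. a i)
      else epowr (\<Sum>\<^sub>\<infinity>i\<in>I. epowr (a i) (enn2real p)) (recip p))"

text \<open>The sequences considered are a priori only $[0,\infty]$-valued; a sequence in
  \<open>lq_space q\<close> takes finite values.\<close>

definition lq_space :: "ennreal \<Rightarrow> (nat \<Rightarrow> ennreal) set" where
  "lq_space q = {a. lp_norm q UNIV a < \<infinity>}"

section \<open>Admissible sequences and Boyd indices\<close>

definition admissible :: "(nat \<Rightarrow> real) \<Rightarrow> bool" where
  "admissible \<sigma> \<longleftrightarrow> (\<forall>j. 0 < \<sigma> j) \<and>
     (\<exists>C>0. \<forall>j. inverse C * \<sigma> j \<le> \<sigma> (Suc j) \<and> \<sigma> (Suc j) \<le> C * \<sigma> j)"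

definition lower_seq :: "(nat \<Rightarrow> real) \<Rightarrow> nat \<Rightarrow> real" where
  "lower_seq \<sigma> j = (INF k. \<sigma> (j + k) / \<sigma> k)"

definition upper_seq :: "(nat \<Rightarrow> real) \<Rightarrow> nat \<Rightarrow> real" where
  "upper_seq \<sigma> j = (SUP k. \<sigma> (j + k) / \<sigma> k)"

definition lower_boyd :: "(nat \<Rightarrow> real) \<Rightarrow> real" where
  "lower_boyd \<sigma> = lim (\<lambda>j. log 2 (lower_seq \<sigma> j) / real j)"

definition upper_boyd :: "(nat \<Rightarrow> real) \<Rightarrow> real" where
  "upper_boyd \<sigma> = lim (\<lambda>j. log 2 (upper_seq \<sigma> j) / real j)"

section \<open>The pointwise spaces $T^\sigma_{p,q}(x_0)$\<close>

primrec fin_diff :: "nat \<Rightarrow> real^'n \<Rightarrow> (real^'n \<Rightarrow> complex) \<Rightarrow> real^'n \<Rightarrow> complex" where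
  "fin_diff 0 h f = f"
| "fin_diff (Suc k) h f = (\<lambda>x. fin_diff k h f (x + h) - fin_diff k h f x)"

text \<open>The order $m = \lfloor \overline{s}(\sigma) \rfloor + 1$ is cut off at $0$: for $m = 0$ one has
  \<open>fin_diff m h f = f\<close> and \<open>diff_ball m h x0 r = ball x0 r\<close>, which is the convention
  for $m \le 0$.\<close>

definition diff_order :: "(nat \<Rightarrow> real) \<Rightarrow> nat" where
  "diff_order \<sigma> = nat (\<lfloor>upper_boyd \<sigma>\<rfloor> + 1)"

definition diff_ball :: "nat \<Rightarrow> real^'n \<Rightarrow> real^'n \<Rightarrow> real \<Rightarrow> (real^'n) set" where
  "diff_ball m h x0 r = {x. closed_segment x (x + real m *\<^sub>R h) \<subseteq> ball x0 r}"

definition T_space ::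
    "(nat \<Rightarrow> real) \<Rightarrow> ennreal \<Rightarrow> ennreal \<Rightarrow> real^'n \<Rightarrow> (real^'n \<Rightarrow> complex) set" where
  "T_space \<sigma> p q x0 =
     {f \<in> Lp_loc p.
        (\<lambda>j. ennreal (\<sigma> j * 2 powr (real j * real CARD('n) * recip p)) *
             (SUP h\<in>cball 0 (1 / 2 ^ j).
                Lp_norm p (lebesgue_on (diff_ball (diff_order \<sigma>) h x0 (1 / 2 ^ j)))
                  (fin_diff (diff_order \<sigma>) h f)))
        \<in> lq_space q}"

section \<open>Wavelet bases in the Schwartz class\<close>

definition partial_deriv :: "'n \<Rightarrow> (real^'n \<Rightarrow> complex) \<Rightarrow> real^'n \<Rightarrow> complex" where
  "partial_deriv l f x = frechet_derivative f (at x) (axis l 1)"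

text \<open>A multi-index is represented by the list of the directions of differentiation.\<close>

definition schwartz :: "(real^'n \<Rightarrow> complex) \<Rightarrow> bool" where
  "schwartz f \<longleftrightarrow> (\<forall>ls. let g = foldr partial_deriv ls f in
     (\<forall>x. g differentiable (at x)) \<and>
     (\<forall>N::nat. \<exists>C. \<forall>x. (1 + norm x) ^ N * norm (g x) \<le> C))"

definition L2_inner :: "(real^'n \<Rightarrow> complex) \<Rightarrow> (real^'n \<Rightarrow> complex) \<Rightarrow> complex" where
  "L2_inner f g = (\<integral>x. f x * cnj (g x) \<partial>lebesgue)"

definition orthogonal_basis_L2 :: "('i \<Rightarrow> real^'n \<Rightarrow> complex) \<Rightarrow> 'i set \<Rightarrow> bool" where
  "orthogonal_basis_L2 e I \<longleftrightarrow>
     (\<forall>a\<in>I. e a \<in> Lp_space 2 \<and> \<not> (AE x in lebesgue. e a x = 0)) \<and>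
     (\<forall>a\<in>I. \<forall>b\<in>I. a \<noteq> b \<longrightarrow> L2_inner (e a) (e b) = 0) \<and>
     (\<forall>g\<in>Lp_space 2. \<forall>\<epsilon>>0. \<exists>F c. finite F \<and> F \<subseteq> I \<and>
        Lp_norm 2 lebesgue (\<lambda>x. g x - (\<Sum>a\<in>F. c a * e a x)) < ennreal \<epsilon>)"

definition real_vec :: "int^'n \<Rightarrow> real^'n" where
  "real_vec k = (\<chi> l. real_of_int (k $ l))"

text \<open>The indices $1 \le i < 2^d$ are taken in $\{0,1\}^d \setminus \{0\}$ from the start.\<close>

definition wavelet_types :: "(int^'n) set" where
  "wavelet_types = {i. (\<forall>l. i $ l \<in> {0, 1}) \<and> i \<noteq> 0}"

fun wavelet_family ::
    "(real^'n \<Rightarrow> complex) \<Rightarrow> (int^'n \<Rightarrow> real^'n \<Rightarrow> complex) \<Rightarrow>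
     (int^'n) + ((int^'n) \<times> nat \<times> (int^'n)) \<Rightarrow> real^'n \<Rightarrow> complex" where
  "wavelet_family \<phi> \<psi> (Inl k) = (\<lambda>x. \<phi> (x - real_vec k))"
| "wavelet_family \<phi> \<psi> (Inr (i, j, k)) = (\<lambda>x. \<psi> i (2 ^ j *\<^sub>R x - real_vec k))"

definition vanishing_moments :: "(real^'n \<Rightarrow> complex) \<Rightarrow> bool" where
  "vanishing_moments g \<longleftrightarrow>
     (\<forall>\<alpha>::'n \<Rightarrow> nat. (\<integral>x. of_real (\<Prod>l\<in>UNIV. (x $ l) ^ \<alpha> l) * g x \<partial>lebesgue) = 0)"

definition schwartz_wavelet_basis ::
    "(real^'n \<Rightarrow> complex) \<Rightarrow> (int^'n \<Rightarrow> real^'n \<Rightarrow> complex) \<Rightarrow> bool" where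
  "schwartz_wavelet_basis \<phi> \<psi> \<longleftrightarrow>
     schwartz \<phi> \<and>
     (\<forall>i\<in>wavelet_types. schwartz (\<psi> i) \<and> vanishing_moments (\<psi> i)) \<and>
     orthogonal_basis_L2 (wavelet_family \<phi> \<psi>)
       (range Inl \<union> Inr ` (wavelet_types \<times> UNIV \<times> UNIV))"

definition wavelet_coeff ::
    "(int^'n \<Rightarrow> real^'n \<Rightarrow> complex) \<Rightarrow> (real^'n \<Rightarrow> complex) \<Rightarrow>
     int^'n \<Rightarrow> nat \<Rightarrow> int^'n \<Rightarrow> complex" where
  "wavelet_coeff \<psi> f i j k =
     2 ^ (CARD('n) * j) * (\<integral>x. f x * \<psi> i (2 ^ j *\<^sub>R x - real_vec k) \<partial>lebesgue)"

section \<open>Wavelet leaders\<close>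

text \<open>\<open>half_open_cube a r\<close> is $a + [0,r)^d$.\<close>

definition half_open_cube :: "real^'n \<Rightarrow> real \<Rightarrow> (real^'n) set" where
  "half_open_cube a r = {x. \<forall>l. a $ l \<le> x $ l \<and> x $ l < a $ l + r}"

definition dyadic_cubes :: "nat \<Rightarrow> (real^'n) set set" where
  "dyadic_cubes j = range (\<lambda>k. half_open_cube ((1 / 2 ^ j) *\<^sub>R real_vec k) (1 / 2 ^ j))"

definition wavelet_cube :: "int^'n \<Rightarrow> nat \<Rightarrow> int^'n \<Rightarrow> (real^'n) set" where
  "wavelet_cube i j k =
     half_open_cube ((1 / 2 ^ (j + 1)) *\<^sub>R real_vec i + (1 / 2 ^ j) *\<^sub>R real_vec k)
       (1 / 2 ^ (j + 1))"

text \<open>\<open>p_leader p \<psi> f j L\<close> is $d^p_L$ for a dyadic cube \<open>L\<close> of side length $2^{-j}$.\<close>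

definition p_leader ::
    "ennreal \<Rightarrow> (int^'n \<Rightarrow> real^'n \<Rightarrow> complex) \<Rightarrow> (real^'n \<Rightarrow> complex) \<Rightarrow>
     nat \<Rightarrow> (real^'n) set \<Rightarrow> ennreal" where
  "p_leader p \<psi> f j L =
     (SUP j'\<in>{j..}.
        lp_norm p {(i, k'). i \<in> wavelet_types \<and> wavelet_cube i j' k' \<subseteq> L}
          (\<lambda>(i, k'). ennreal (2 powr ((real j - real j') * real CARD('n) * recip p)
                              * norm (wavelet_coeff \<psi> f i j' k'))))"

definition dyadic_cube_at :: "nat \<Rightarrow> real^'n \<Rightarrow> (real^'n) set" where
  "dyadic_cube_at j x0 = (THE L. L \<in> dyadic_cubes j \<and> x0 \<in> L)"

definition neighbour_cubes :: "nat \<Rightarrow> real^'n \<Rightarrow> (real^'n) set set" where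
  "neighbour_cubes j x0 = {L \<in> dyadic_cubes j. setdist L (dyadic_cube_at j x0) = 0}"

definition p_leader_at ::
    "ennreal \<Rightarrow> (int^'n \<Rightarrow> real^'n \<Rightarrow> complex) \<Rightarrow> (real^'n \<Rightarrow> complex) \<Rightarrow>
     real^'n \<Rightarrow> nat \<Rightarrow> ennreal" where
  "p_leader_at p \<psi> f x0 j = (SUP L\<in>neighbour_cubes j x0. p_leader p \<psi> f j L)"

end

theory Submission
  imports Defs
begin

text \<open>Write \<open>\<langle>f, K\<rangle>\<close> for the integral of \<open>f K\<close>. The coefficients of \<open>f\<close> at scale
\<open>2\<^sup>-\<^sup>j\<^sup>'\<close>, \<open>j' \<ge> j\<close>, over cubes near \<open>x0\<close> are pairings with dilated wavelets \<open>K\<close>, and they have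
to be estimated by the moduli
\<open>\<omega>\<^sub>k = sup {norm (\<Delta>\<^sub>h\<^sup>m f) in L\<^sup>p(B\<^sub>h(x0, 2\<^sup>-\<^sup>k)) | norm h \<le> 2\<^sup>-\<^sup>k}\<close>. One could subtract a polynomial
of degree less than \<open>m\<close> provided by an inequality of Whitney type; the proof below smooths the
wavelets instead, which involves nothing but the finite differences themselves.

Let \<open>w\<close> be a bump supported in the unit ball with integral \<open>1\<close>. By the binomial formula for
\<open>\<Delta>\<^sub>h\<^sup>m\<close>, averaging \<open>\<plusminus>\<langle>\<Delta>\<^sub>S\<^sub>h\<^sup>m f, K\<rangle>\<close> over \<open>h\<close> with the weight \<open>w\<close> gives \<open>\<langle>f, K - A\<^sub>S K\<rangle>\<close>, where
\<open>A\<^sub>S\<close> is a combination of convolutions with dilates of \<open>w\<close> at scales \<open>S, \<dots>, m S\<close>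
(\<open>integral_fin_diff\<close>). Hence \<open>\<langle>f, K - A\<^sub>S K\<rangle>\<close> is controlled by differences of \<open>f\<close> with steps at
most \<open>S\<close>. The operators \<open>A\<^sub>S\<close> commute, so that for the functions \<open>u\<^sub>l = A\<^bsub>S l\<^esub> K\<close> one has
\<open>u\<^sub>l - u\<^bsub>l+1\<^esub> = (1 - A\<^bsub>S (l+1)\<^esub>) u\<^sub>l - (1 - A\<^bsub>S l\<^esub>) u\<^bsub>l+1\<^esub>\<close>. With \<open>S l\<close> comparable to
\<open>2\<^bsup>l-j\<^esup>\<close> and \<open>l = 0, \<dots>, j\<close>, the pairing \<open>\<langle>f, K\<rangle>\<close> therefore telescopes into pairings of
differences of \<open>f\<close> with \<open>K\<close> and the \<open>u\<^sub>l\<close>, and the single remainder \<open>\<langle>f, u\<^sub>j\<rangle>\<close> at scale \<open>1\<close>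
(\<open>norm_pairing_le_telescope\<close>).

All moments of \<open>K\<close> vanish. Therefore smoothing \<open>K\<close> at a scale larger than its own makes it small to
every order (\<open>smooth_decay\<close>): if \<open>K\<close> has scale \<open>2\<^sup>-\<^sup>j\<^sup>'\<close> and sits near \<open>x0\<close>, then \<open>u\<^sub>l(x)\<close> is at
most a constant times \<open>(2\<^sup>l + 2\<^sup>j norm (x - x0))\<^sup>-\<^sup>n\<close> times a kernel that decays away from the position
of \<open>K\<close>. On the shell of radius \<open>2\<^bsup>i-j\<^esup>\<close> around \<open>x0\<close> the first factor is about \<open>2\<^sup>-\<^sup>i\<^sup>n\<close>, and there
the differences of \<open>f\<close> are measured by \<open>\<omega>\<^bsub>j-i\<^esub>\<close>; outside of a fixed ball it is about \<open>2\<^sup>-\<^sup>j\<^sup>n\<close>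
and the norm of \<open>f\<close> in \<open>L\<^sup>p\<close> is enough. The second factor makes the Schur test applicable, which turns
\<open>L\<^sup>p\<close> norms into \<open>\<ell>\<^sup>p\<close> norms over the positions (\<open>schur_bound_exists\<close>, \<open>lp_norm_mean_diff_le\<close>). Summing over
\<open>l\<close> gives, with a constant independent of \<open>j\<close>,
\<open>d\<^sup>p\<^sub>j(x0) \<le> C 2\<^bsup>jd/p\<^esup> (\<Sum>i\<le>j. 2\<^sup>-\<^sup>i\<^sup>n \<omega>\<^bsub>j-i\<^esub> + 2\<^sup>-\<^sup>j\<^sup>n norm f)\<close> (\<open>p_leader_at_le\<close>).

Here \<open>n\<close> is arbitrary. An admissible sequence satisfies \<open>\<sigma>\<^sub>j \<le> D\<^sup>i \<sigma>\<^bsub>j-i\<^esub>\<close>, so for large \<open>n\<close> the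
right-hand side multiplied by \<open>\<sigma>\<^sub>j\<close> is a convolution with \<open>2\<^sup>-\<^sup>i\<close> of the sequence that is in
\<open>\<ell>\<^sup>q\<close> by assumption, changed at \<open>0\<close> by a multiple of the norm of \<open>f\<close>. Such a convolution preserves
\<open>\<ell>\<^sup>q\<close> (\<open>lp_norm_geometric_convolution_le\<close>).\<close>

section \<open>The Minkowski inequality in sequence spaces\<close>

lemma epowr_ennreal: "0 \<le> x \<Longrightarrow> epowr (ennreal x) a = ennreal (x powr a)"
  by (simp add: epowr_def)

lemma epowr_top: "epowr top a = top"
  by (simp add: epowr_def)

lemma epowr_0: "epowr 0 a = 0"
  by (simp add: epowr_def)

lemma epowr_mono:
  assumes "x \<le> y" "0 \<le> a"
  shows "epowr x a \<le> epowr y a"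
proof (cases y)
  case (real s)
  with assms obtain t where "x = ennreal t" "0 \<le> t" "t \<le> s"
    by (cases x) (auto simp: top_unique)
  with real assms show ?thesis by (simp add: epowr_ennreal powr_mono2)
qed (simp add: epowr_top)

lemma epowr_epowr_inverse:
  assumes "0 < a"
  shows "epowr (epowr x a) (1 / a) = x"
proof (cases x)
  case (real s)
  with assms show ?thesis by (simp add: epowr_ennreal powr_powr)
qed (simp add: epowr_top)

lemma epowr_inverse_epowr:
  assumes "0 < a"
  shows "epowr (epowr x (1 / a)) a = x"
proof (cases x)
  case (real s)
  with assms show ?thesis by (simp add: epowr_ennreal powr_powr)
qed (simp add: epowr_top)

lemma epowr_inverse_le_iff:
  assumes "0 < a"
  shows "epowr x (1 / a) \<le> y \<longleftrightarrow> x \<le> epowr y a"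
proof
  assume "epowr x (1 / a) \<le> y"
  from epowr_mono[OF this, of a] assms show "x \<le> epowr y a" by (simp add: epowr_inverse_epowr)
next
  assume "x \<le> epowr y a"
  from epowr_mono[OF this, of "1/a"] assms show "epowr x (1 / a) \<le> y"
    by (simp add: epowr_epowr_inverse)
qed

lemma epowr_mult:
  assumes "0 < c"
  shows "epowr (ennreal c * x) a = ennreal (c powr a) * epowr x a"
proof (cases x)
  case (real s)
  with assms show ?thesis
    by (simp add: epowr_ennreal powr_mult flip: ennreal_mult)
next
  case top
  with assms show ?thesis by (simp add: epowr_top ennreal_mult_top)
qed

lemma epowr_measurable [measurable (raw)]:
  assumes [measurable]: "f \<in> borel_measurable M"
  shows "(\<lambda>x. epowr (f x) a) \<in> borel_measurable M"
  unfolding epowr_def by measurable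

lemma recip_top [simp]: "recip top = 0"
  by (simp add: recip_def)

lemma enn2real_exponent:
  assumes "1 \<le> p" "p \<noteq> \<infinity>"
  shows "1 \<le> enn2real p" "recip p = 1 / enn2real p" "p = ennreal (enn2real p)"
proof -
  obtain r where r: "p = ennreal r" "0 \<le> r" using assms by (cases p) auto
  with assms have "1 \<le> r" by (simp add: ennreal_le_iff flip: ennreal_1)
  with r show "1 \<le> enn2real p" "recip p = 1 / enn2real p" "p = ennreal (enn2real p)"
    by (simp_all add: recip_def inverse_ennreal divide_inverse)
qed

lemma recip_bounds:
  assumes "1 \<le> p"
  shows "0 \<le> recip p" "recip p \<le> 1"
proof -
  show "0 \<le> recip p" by (simp add: recip_def)
  show "recip p \<le> 1"
    using enn2real_exponent[OF assms] by (cases "p = \<infinity>") auto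
qed

lemma lp_norm_finite:
  assumes "1 \<le> p" "p \<noteq> \<infinity>" "finite F"
  shows "lp_norm p F a = epowr (\<Sum>i\<in>F. epowr (a i) (enn2real p)) (1 / enn2real p)"
  using assms by (simp add: lp_norm_def enn2real_exponent)

text \<open>A norm over an arbitrary index set is the supremum of the norms over the finite subsets. All
estimates of \<open>lp_norm\<close> below are proved for finite sums and passed on by this rule.\<close>

lemma lp_norm_leI:
  assumes p: "1 \<le> p"
    and F: "\<And>F. finite F \<Longrightarrow> F \<subseteq> I \<Longrightarrow> lp_norm p F a \<le> B"
  shows "lp_norm p I a \<le> B"
proof (cases "p = \<infinity>")
  case True
  have "a i \<le> B" if "i \<in> I" for i
    using F[of "{i}"] that True by (simp add: lp_norm_def)
  then show ?thesis using True by (auto simp: lp_norm_def intro: SUP_least)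
next
  case False
  note r = enn2real_exponent[OF p False]
  have "(\<Sum>\<^sub>\<infinity>i\<in>I. epowr (a i) (enn2real p)) \<le> epowr B (enn2real p)"
  proof (subst nonneg_infsum_complete, simp, rule SUP_least, clarsimp)
    fix F assume "finite F" "F \<subseteq> I"
    with F[of F] show "(\<Sum>i\<in>F. epowr (a i) (enn2real p)) \<le> epowr B (enn2real p)"
      using r by (simp add: lp_norm_finite[OF p False] epowr_inverse_le_iff)
  qed
  then show ?thesis
    using False r by (simp add: lp_norm_def epowr_inverse_le_iff)
qed

lemma lp_norm_mono:
  assumes p: "1 \<le> p" and le: "\<And>i. i \<in> I \<Longrightarrow> a i \<le> b i" and "I \<subseteq> J"
  shows "lp_norm p I a \<le> lp_norm p J b"
proof (cases "p = \<infinity>")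
  case True
  then show ?thesis using assms by (auto simp: lp_norm_def intro!: SUP_subset_mono)
next
  case False
  note r = enn2real_exponent[OF p False]
  have "(\<Sum>\<^sub>\<infinity>i\<in>I. epowr (a i) (enn2real p)) \<le> (\<Sum>\<^sub>\<infinity>i\<in>J. epowr (b i) (enn2real p))"
    unfolding nonneg_infsum_complete[OF zero_le]
  proof (rule SUP_mono, safe)
    fix F assume F: "finite F" "F \<subseteq> I"
    then have "(\<Sum>i\<in>F. epowr (a i) (enn2real p)) \<le> (\<Sum>i\<in>F. epowr (b i) (enn2real p))"
      by (intro sum_mono epowr_mono le) auto
    with F \<open>I \<subseteq> J\<close> show "\<exists>G\<in>{G. finite G \<and> G \<subseteq> J}. (\<Sum>i\<in>F. epowr (a i) (enn2real p))
        \<le> (\<Sum>i\<in>G. epowr (b i) (enn2real p))"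
      by (intro bexI[of _ F]) auto
  qed
  then show ?thesis using False r by (simp add: lp_norm_def epowr_mono)
qed

lemma lp_norm_ge:
  assumes p: "1 \<le> p" and "i \<in> I"
  shows "a i \<le> lp_norm p I a"
proof -
  have "a i = lp_norm p {i} a"
  proof (cases "p = \<infinity>")
    case False
    then show ?thesis
      using enn2real_exponent[OF p False]
          by (simp add: lp_norm_finite[OF p False] epowr_epowr_inverse)
  qed (simp add: lp_norm_def)
  also have "\<dots> \<le> lp_norm p I a" using assms by (intro lp_norm_mono) auto
  finally show ?thesis .
qed

lemma lp_norm_cmult:
  assumes p: "1 \<le> p" and c: "0 \<le> c"
  shows "lp_norm p I (\<lambda>i. ennreal c * a i) \<le> ennreal c * lp_norm p I a"
proof (cases "c = 0")
  case True
  have "(SUP i\<in>I. 0::ennreal) = 0" by (intro antisym SUP_least zero_le order_refl)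
  with True show ?thesis by (simp add: lp_norm_def epowr_0)
next
  case False
  with c have c: "0 < c" by simp
  show ?thesis
  proof (cases "p = \<infinity>")
    case True
    then show ?thesis by (simp add: lp_norm_def SUP_mult_left_ennreal)
  next
    case False
    note r = enn2real_exponent[OF p False]
    show ?thesis
    proof (rule lp_norm_leI[OF p])
      fix F assume F: "finite F" "F \<subseteq> I"
      have "lp_norm p F (\<lambda>i. ennreal c * a i) = ennreal c * lp_norm p F a"
        using F c r by (simp add: lp_norm_finite[OF p False] epowr_mult powr_powr
            flip: sum_distrib_left)
      also have "\<dots> \<le> ennreal c * lp_norm p I a"
        using F by (intro mult_left_mono lp_norm_mono p) auto
      finally show "lp_norm p F (\<lambda>i. ennreal c * a i) \<le> ennreal c * lp_norm p I a" .
    qed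
  qed
qed

text \<open>The form of the Young inequality that integrates: the exponent \<open>r = 1\<close> is included, so
that no conjugate exponent has to be mentioned.\<close>

lemma Youngs_inequality_powr:
  fixes u v r :: real
  assumes "0 \<le> u" "0 \<le> v" "1 \<le> r"
  shows "u powr (r - 1) * v \<le> (1 - 1 / r) * u powr r + v powr r / r"
proof (cases "u = 0 \<or> v = 0")
  case True
  with assms show ?thesis by auto
next
  case False
  with assms have uv: "0 < u" "0 < v" by auto
  from assms have "(u powr r) powr (1 - 1/r) * (v powr r) powr (1/r)
      \<le> (1 - 1/r) * u powr r + (1/r) * v powr r"
    using uv by (intro Youngs_inequality_0) auto
  moreover have "r * (1 - 1/r) = r - 1" using assms by (simp add: field_simps)
  ultimately show ?thesis using assms uv by (simp add: powr_powr)
qed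

lemma Hoelder_sum_powr:
  fixes \<beta> b :: "'i \<Rightarrow> real"
  assumes r: "1 \<le> r" and F: "finite F" and nn: "\<And>k. 0 \<le> \<beta> k" "\<And>k. 0 \<le> b k"
  shows "(\<Sum>k\<in>F. \<beta> k powr (r - 1) * b k)
    \<le> ((\<Sum>k\<in>F. \<beta> k powr r) powr (1/r)) powr (r - 1) * (\<Sum>k\<in>F. b k powr r) powr (1/r)"
proof -
  define S where "S = (\<Sum>k\<in>F. \<beta> k powr r)"
  define T where "T = (\<Sum>k\<in>F. b k powr r)"
  define B where "B = S powr (1/r)"
  define \<nu> where "\<nu> = T powr (1/r)"
  have S0: "0 \<le> S" and T0: "0 \<le> T" by (auto simp: S_def T_def intro: sum_nonneg)
  show ?thesis
  proof (cases "S = 0 \<or> T = 0")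
    case True
    then have "(\<forall>k\<in>F. \<beta> k = 0) \<or> (\<forall>k\<in>F. b k = 0)"
      unfolding S_def T_def using F by (simp add: sum_nonneg_eq_0_iff)
    then have "(\<Sum>k\<in>F. \<beta> k powr (r - 1) * b k) = 0" by (auto intro: sum.neutral)
    then show ?thesis by (simp add: S_def T_def)
  next
    case False
    with S0 T0 have pos: "0 < S" "0 < T" "0 < B" "0 < \<nu>" by (auto simp: B_def \<nu>_def)
    have Br: "B powr r = S" "\<nu> powr r = T" using r pos by (auto simp: B_def \<nu>_def powr_powr)
    have "(\<Sum>k\<in>F. (\<beta> k / B) powr (r - 1) * (b k / \<nu>))
        \<le> (\<Sum>k\<in>F. (1 - 1 / r) * (\<beta> k / B) powr r + (b k / \<nu>) powr r / r)"
      using nn pos r by (intro sum_mono Youngs_inequality_powr) auto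
    also have "\<dots> = (1 - 1/r) * (\<Sum>k\<in>F. \<beta> k powr r) / S + (\<Sum>k\<in>F. b k powr r) / T / r"
      using nn pos by (simp add: powr_divide Br sum.distrib sum_distrib_left sum_divide_distrib)
    also have "\<dots> = 1" using pos r by (simp add: S_def[symmetric] T_def[symmetric] field_simps)
    finally have "(\<Sum>k\<in>F. \<beta> k powr (r - 1) * b k) / (B powr (r - 1) * \<nu>) \<le> 1"
      using nn pos by (simp add: powr_divide sum_divide_distrib)
    then have "(\<Sum>k\<in>F. \<beta> k powr (r - 1) * b k) \<le> B powr (r - 1) * \<nu>"
      using pos by (simp add: pos_divide_le_eq)
    then show ?thesis unfolding B_def \<nu>_def S_def T_def .
  qed
qed

text \<open>The integral form of the Minkowski inequality. Dualise: the sum of \<open>B k powr r\<close> over the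
integrals \<open>B k\<close> is the integral over \<open>y\<close> of the sum of \<open>B k powr (r - 1) * b k y\<close>, which the
Hoelder inequality bounds pointwise by the norm at \<open>y\<close>; one power of the norm of \<open>B\<close> then cancels.
The measure is arbitrary; integrals against the bump as well as finite and infinite sums
are instances.\<close>

lemma lp_norm_nn_integral_le:
  fixes b :: "'i \<Rightarrow> 'y \<Rightarrow> ennreal"
  assumes p: "1 \<le> p" and b [measurable]: "\<And>k. k \<in> I \<Longrightarrow> b k \<in> borel_measurable \<mu>"
    and n [measurable]: "n \<in> borel_measurable \<mu>"
    and le: "\<And>y. y \<in> space \<mu> \<Longrightarrow> lp_norm p I (\<lambda>k. b k y) \<le> n y"
  shows "lp_norm p I (\<lambda>k. \<integral>\<^sup>+ y. b k y \<partial>\<mu>) \<le> (\<integral>\<^sup>+ y. n y \<partial>\<mu>)"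
proof (rule lp_norm_leI[OF p])
  fix F assume F: "finite F" "F \<subseteq> I"
  define A where "A = (\<integral>\<^sup>+ y. n y \<partial>\<mu>)"
  define B where "B k = (\<integral>\<^sup>+ y. b k y \<partial>\<mu>)" for k
  have BA: "B k \<le> A" if "k \<in> I" for k
    unfolding A_def B_def using lp_norm_ge[OF p that] le
    by (intro nn_integral_mono) (meson order_trans)
  have "lp_norm p F B \<le> A"
  proof (cases "p = \<infinity>")
    case True
    with BA F show ?thesis by (auto simp: lp_norm_def intro!: SUP_least)
  next
    case False
    note r = enn2real_exponent[OF p False]
    define r where "r = enn2real p"
    have r1: "1 \<le> r" using r by (simp add: r_def)
    show ?thesis
    proof (cases "A = \<infinity>")
      case False
      define \<beta> where "\<beta> k = (if k \<in> F then enn2real (B k) else 0)" for k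
      have B\<beta>: "B k = ennreal (\<beta> k)" if "k \<in> F" for k
        using BA[of k] F that False by (auto simp: \<beta>_def top_unique less_top intro!:
            ennreal_enn2real[symmetric])
      have \<beta>0: "0 \<le> \<beta> k" for k by (simp add: \<beta>_def)
      define S where "S = (\<Sum>k\<in>F. \<beta> k powr r)"
      define N where "N = S powr (1/r)"
      have S0: "0 \<le> S" unfolding S_def by (intro sum_nonneg) auto
      have lpN: "lp_norm p F B = ennreal N"
        using F B\<beta> \<beta>0 S0 unfolding lp_norm_finite[OF p \<open>p \<noteq> \<infinity>\<close> F(1)] r_def[symmetric] N_def S_def
        by (simp add: epowr_ennreal cong: sum.cong)
      show ?thesis
      proof (cases "N = 0")
        case True
        then show ?thesis by (simp add: lpN)
      next
        case False
        then have N0: "0 < N" by (simp add: N_def)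
        have NS: "N powr r = S" using S0 r1 by (simp add: N_def powr_powr)
        have pw: "(\<Sum>k\<in>F. ennreal (\<beta> k powr (r - 1)) * b k y) \<le> ennreal (N powr (r - 1)) * n y"
          if y: "y \<in> space \<mu>" for y
        proof (cases "n y = \<infinity>")
          case True
          then show ?thesis using N0 by (simp add: ennreal_mult_top)
        next
          case fin: False
          define c where "c k = (if k \<in> F then enn2real (b k y) else 0)" for k
          have le': "lp_norm p F (\<lambda>k. b k y) \<le> n y"
            using lp_norm_mono[OF p order_refl F(2)] le[OF y] by (rule order_trans)
          have bc: "b k y = ennreal (c k)" if "k \<in> F" for k
            using lp_norm_ge[OF p that, of "\<lambda>k. b k y"] le' fin that
            by (simp add: c_def) (metis ennreal_enn2real infinity_ennreal_def less_top
                neq_top_trans)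
          have c0: "0 \<le> c k" for k by (simp add: c_def)
          have "(\<Sum>k\<in>F. ennreal (\<beta> k powr (r - 1)) * b k y)
              = ennreal (\<Sum>k\<in>F. \<beta> k powr (r - 1) * c k)"
            using bc c0 by (simp add: sum_ennreal flip: ennreal_mult cong: sum.cong)
          also have "\<dots> \<le> ennreal (N powr (r - 1) * (\<Sum>k\<in>F. c k powr r) powr (1/r))"
            unfolding N_def S_def by (intro ennreal_leI Hoelder_sum_powr r1 F \<beta>0 c0)
          also have "\<dots> = ennreal (N powr (r - 1)) * lp_norm p F (\<lambda>k. b k y)"
            unfolding lp_norm_finite[OF p \<open>p \<noteq> \<infinity>\<close> F(1)] r_def[symmetric]
            using bc c0 by (simp add: ennreal_mult epowr_ennreal sum_nonneg cong: sum.cong)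
          also have "\<dots> \<le> ennreal (N powr (r - 1)) * n y" by (intro mult_left_mono le') auto
          finally show ?thesis .
        qed
        have "ennreal (N powr (r - 1)) * ennreal N = ennreal S"
          using N0 NS by (simp flip: ennreal_mult) (metis N0 diff_add_cancel powr_add powr_one
              less_imp_le)
        also have "\<dots> = (\<Sum>k\<in>F. ennreal (\<beta> k powr (r - 1)) * B k)"
        proof -
          have *: "\<beta> k powr (r - 1) * \<beta> k = \<beta> k powr r" for k
            using \<beta>0[of k] by (cases "\<beta> k = 0") (auto simp: powr_diff)
          have "ennreal (\<beta> k powr (r - 1)) * B k = ennreal (\<beta> k powr r)" if "k \<in> F" for k
            unfolding B\<beta>[OF that] *[symmetric] by (rule ennreal_mult[symmetric, OF powr_ge_zero \<beta>0])
          then have "(\<Sum>k\<in>F. ennreal (\<beta> k powr (r - 1)) * B k) = (\<Sum>k\<in>F. ennreal (\<beta> k powr r))"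
            by (intro sum.cong refl)
          then show ?thesis
            by (simp add: S_def sum_ennreal)
        qed
        also have "\<dots> = (\<Sum>k\<in>F. \<integral>\<^sup>+ y. ennreal (\<beta> k powr (r - 1)) * b k y \<partial>\<mu>)"
          unfolding B_def
          by (intro sum.cong refl nn_integral_cmult[symmetric] b subsetD[OF F(2)])
        also have "\<dots> = (\<integral>\<^sup>+ y. (\<Sum>k\<in>F. ennreal (\<beta> k powr (r - 1)) * b k y) \<partial>\<mu>)"
          by (rule nn_integral_sum[symmetric])
            (intro borel_measurable_times_ennreal borel_measurable_const b subsetD[OF F(2)])
        also have "\<dots> \<le> (\<integral>\<^sup>+ y. ennreal (N powr (r - 1)) * n y \<partial>\<mu>)"
          by (intro nn_integral_mono pw)
        also have "\<dots> = ennreal (N powr (r - 1)) * A"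
          unfolding A_def by (rule nn_integral_cmult) measurable
        finally have "ennreal N \<le> A"
          using N0 by (subst (asm) ennreal_mult_le_mult_iff) auto
        then show ?thesis by (simp add: lpN)
      qed
    qed simp
  qed
  then show "lp_norm p F (\<lambda>k. \<integral>\<^sup>+ y. b k y \<partial>\<mu>) \<le> (\<integral>\<^sup>+ y. n y \<partial>\<mu>)"
    by (simp add: A_def B_def[abs_def])
qed

lemma lp_norm_sum_le:
  assumes "1 \<le> p" "finite L"
  shows "lp_norm p I (\<lambda>k. \<Sum>l\<in>L. b l k) \<le> (\<Sum>l\<in>L. lp_norm p I (b l))"
  using lp_norm_nn_integral_le[OF assms(1), of I "\<lambda>k l. b l k" "count_space L"
      "\<lambda>l. lp_norm p I (b l)"]
  using assms by (simp add: nn_integral_count_space_finite)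

lemma lp_norm_add_le:
  assumes "1 \<le> p"
  shows "lp_norm p I (\<lambda>k. a k + b k) \<le> lp_norm p I a + lp_norm p I b"
  using lp_norm_sum_le[OF assms, of "UNIV :: bool set" I "\<lambda>l. if l then a else b"]
  by (simp add: UNIV_bool add.commute if_distrib)

lemma lp_norm_suminf_le:
  assumes "1 \<le> p"
  shows "lp_norm p I (\<lambda>k. \<Sum>l. b l k) \<le> (\<Sum>l. lp_norm p I (b l))"
  using lp_norm_nn_integral_le[OF assms(1), of I "\<lambda>k l. b l k" "count_space UNIV"
      "\<lambda>l. lp_norm p I (b l)"]
  by (simp add: nn_integral_count_space_nat)

section \<open>Decaying kernels and the Schur test\<close>

text \<open>The standard profile \<open>(1 + norm x)\<^sup>-\<^sup>N\<close> of a rapidly decreasing kernel.\<close>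

definition decay :: "nat \<Rightarrow> 'a::real_normed_vector \<Rightarrow> real" where
  "decay N x = inverse (1 + norm x) ^ N"

lemma decay_nonneg [simp]: "0 \<le> decay N x"
  by (simp add: decay_def)

lemma decay_le_1: "decay N x \<le> 1"
  unfolding decay_def by (intro power_le_one) (auto simp: inverse_le_1_iff)

lemma decay_add: "decay (M + N) x = decay M x * decay N x"
  by (simp add: decay_def power_add)

lemma decay_antimono: "M \<le> N \<Longrightarrow> decay N x \<le> decay M x"
  unfolding decay_def by (intro power_decreasing) (auto simp: inverse_le_1_iff)

lemma decay_measurable [measurable]:
  fixes f :: "'b \<Rightarrow> 'a::{real_normed_vector, second_countable_topology}"
  assumes [measurable]: "f \<in> borel_measurable M"
  shows "(\<lambda>x. decay N (f x)) \<in> borel_measurable M"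
  unfolding decay_def by measurable

text \<open>Moving the argument costs a factor that depends on the displacement only, because
\<open>1 + norm b \<le> (1 + norm (a - b)) * (1 + norm a)\<close>.\<close>

lemma decay_shift: "decay N a \<le> (1 + norm (a - b)) ^ N * decay N b"
proof -
  have "1 + norm b \<le> (1 + norm (a - b)) * (1 + norm a)"
    using norm_triangle_ineq4[of a "a - b"]
        by (simp add: algebra_simps) (smt (verit) mult_nonneg_nonneg norm_ge_zero)
  then have "inverse (1 + norm a) \<le> (1 + norm (a - b)) * inverse (1 + norm b)"
    by (simp add: field_simps add_pos_nonneg)
  then show ?thesis
    unfolding decay_def power_mult_distrib[symmetric]
    by (intro power_mono) auto
qed

text \<open>At a point with \<open>n \<le> norm (c *\<^sub>R x - y) < n + 1\<close> the profile is at most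
\<open>1 / (n + 1)\<^bsup>d+2\<^esup>\<close>, and this point lies in a ball of volume proportional to \<open>((n + 1) / c)\<^sup>d\<close>. Summing
over \<open>n\<close> leaves the convergent series of inverse squares.\<close>

lemma nn_integral_decay_le:
  "\<exists>C>0. \<forall>c>0. \<forall>y::'a::euclidean_space.
     (\<integral>\<^sup>+ x. ennreal (decay (DIM('a) + 2) (c *\<^sub>R x - y)) \<partial>lborel) \<le> ennreal (C / c ^ DIM('a))"
proof -
  let ?d = "DIM('a)"
  let ?D = "\<lambda>v::'a. decay (?d + 2) v" and ?s = "\<lambda>n. inverse (real (Suc n))"
  define S where "S = (\<Sum>n. ?s n ^ 2)"
  have summ: "summable (\<lambda>n. ?s n ^ 2)"
    using inverse_power_summable[of 2, where 'a = real]
        by (subst summable_Suc_iff) (simp add: power_inverse)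
  have S0: "0 < S" unfolding S_def using summ by (intro suminf_pos) auto
  define V where "V = unit_ball_vol (real ?d)"
  have V0: "0 < V" by (simp add: V_def)
  have "(\<integral>\<^sup>+ x. ennreal (?D (c *\<^sub>R x - y)) \<partial>lborel) \<le> ennreal (V * S / c ^ ?d)"
    if c: "0 < c" for c and y :: 'a
  proof -
    define B where "B n = ball ((1/c) *\<^sub>R y) (real (Suc n) / c)" for n
    define h where "h n x = ennreal (?s n ^ (?d + 2)) * indicator (B n) x" for n and x :: 'a
    have "ennreal (?D (c *\<^sub>R x - y)) \<le> (\<Sum>n. h n x)" for x
    proof -
      define n where "n = nat \<lfloor>norm (c *\<^sub>R x - y)\<rfloor>"
      have n: "real n \<le> norm (c *\<^sub>R x - y)" "norm (c *\<^sub>R x - y) < real (Suc n)"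
        unfolding n_def by (auto simp: ) linarith
      have "dist ((1/c) *\<^sub>R y) x = norm (c *\<^sub>R x - y) / c"
      proof -
        have "(1/c) *\<^sub>R y - x = (1/c) *\<^sub>R (y - c *\<^sub>R x)" using c by (simp add: algebra_simps)
        then show ?thesis using c by (simp add: dist_norm norm_minus_commute)
      qed
      then have "x \<in> B n" using n c by (simp add: B_def divide_strict_right_mono del: of_nat_Suc)
      moreover have "?D (c *\<^sub>R x - y) \<le> ?s n ^ (?d + 2)"
        unfolding decay_def using n by (intro power_mono le_imp_inverse_le) auto
      ultimately have "ennreal (?D (c *\<^sub>R x - y)) \<le> h n x"
        by (simp add: h_def ennreal_leI del: of_nat_Suc)
      also have "\<dots> = (\<Sum>n\<in>{n}. h n x)" by simp
      also have "\<dots> \<le> (\<Sum>n. h n x)" by (intro sum_le_suminf) auto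
      finally show ?thesis .
    qed
    then have "(\<integral>\<^sup>+ x. ennreal (?D (c *\<^sub>R x - y)) \<partial>lborel) \<le> (\<integral>\<^sup>+ x. (\<Sum>n. h n x) \<partial>lborel)"
      by (intro nn_integral_mono)
    also have "\<dots> = (\<Sum>n. \<integral>\<^sup>+ x. h n x \<partial>lborel)"
    proof (intro nn_integral_suminf)
      fix n
      have [measurable]: "B n \<in> sets lborel" by (simp add: B_def)
      show "h n \<in> borel_measurable lborel" unfolding h_def[abs_def] by measurable
    qed
    also have "\<dots> = (\<Sum>n. ennreal (V / c ^ ?d * ?s n ^ 2))"
    proof (intro suminf_cong)
      fix n
      have "(\<integral>\<^sup>+ x. h n x \<partial>lborel) = ennreal (?s n ^ (?d + 2)) * emeasure lborel (B n)"
        unfolding h_def by (intro nn_integral_cmult_indicator) (simp add: B_def)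
      also have "emeasure lborel (B n) = ennreal (V * (real (Suc n) / c) ^ ?d)"
        unfolding B_def V_def using c by (intro emeasure_ball) auto
      also have "ennreal (?s n ^ (?d + 2)) * \<dots>
          = ennreal (?s n ^ (?d + 2) * (V * (real (Suc n) / c) ^ ?d))"
        using c V0 by (intro ennreal_mult[symmetric]) auto
      also have "?s n ^ (?d + 2) * (V * (real (Suc n) / c) ^ ?d) = V / c ^ ?d * ?s n ^ 2"
        by (simp add: power_add power_divide field_simps power2_eq_square del: of_nat_Suc)
      finally show "(\<integral>\<^sup>+ x. h n x \<partial>lborel) = ennreal (V / c ^ ?d * ?s n ^ 2)" .
    qed
    also have "\<dots> = ennreal (\<Sum>n. V / c ^ ?d * ?s n ^ 2)"
      using c V0 summ by (intro suminf_ennreal2 summable_mult) auto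
    also have "(\<Sum>n. V / c ^ ?d * ?s n ^ 2) = V / c ^ ?d * S"
      unfolding S_def using summ by (rule suminf_mult)
    finally show ?thesis by simp
  qed
  then show ?thesis using V0 S0 by (intro exI[of _ "V * S"]) auto
qed

lemma norm_le_card_vec:
  fixes x :: "real^'n"
  assumes "\<And>l. \<bar>x $ l\<bar> \<le> r"
  shows "norm x \<le> real CARD('n) * r"
  using norm_le_l1_cart[of x] sum_bounded_above[of UNIV "\<lambda>l. \<bar>x $ l\<bar>" r] assms by simp

text \<open>The profile changes by a bounded factor within a unit cube, so each lattice term is
dominated by an integral over the cube at this lattice point; the cubes are disjoint. Bounds for
finite sets \<open>F\<close> suffice by \<open>lp_norm_leI\<close>.\<close>

lemma lattice_sum_decay_le:
  "\<exists>C>0. \<forall>(y::real^'n) F. finite F \<longrightarrow>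
     (\<Sum>k\<in>F. decay (CARD('n) + 2) (y - real_vec k)) \<le> C"
proof -
  let ?d = "CARD('n)"
  let ?D = "\<lambda>v::real^'n. decay (?d + 2) v"
  obtain C where C: "0 < C" and int: "\<And>c (y::real^'n). 0 < c \<Longrightarrow>
     (\<integral>\<^sup>+ x. ennreal (?D (c *\<^sub>R x - y)) \<partial>lborel) \<le> ennreal (C / c ^ ?d)"
    using nn_integral_decay_le[where 'a = "real^'n"] by auto
  define C' where "C' = (1 + real ?d) ^ (?d + 2)"
  have C': "0 < C'" unfolding C'_def by (intro zero_less_power) auto
  have "(\<Sum>k\<in>F. ?D (y - real_vec k)) \<le> C' * C" if F: "finite F" for F and y :: "real^'n"
  proof -
    define Q where "Q k = box (real_vec k) (real_vec k + 1 :: real^'n)" for k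
    have Q: "z \<in> Q k \<longleftrightarrow> (\<forall>l. real_of_int (k $ l) < z $ l \<and> z $ l < real_of_int (k $ l) + 1)" for z k
      by (simp add: Q_def mem_box_cart real_vec_def)
    have disj: "k = k'" if "z \<in> Q k" "z \<in> Q k'" for z k k'
    proof (rule vec_eq_iff[THEN iffD2, rule_format])
      fix l
      from that have "real_of_int (k $ l) < real_of_int (k' $ l) + 1"
          "real_of_int (k' $ l) < real_of_int (k $ l) + 1"
        unfolding Q by (metis order.strict_trans)+
      then show "k $ l = k' $ l" by linarith
    qed
    have vol: "emeasure lborel (Q k) = 1" for k
    proof -
      have one: "(1::real^'n) \<bullet> b = 1" if "b \<in> Basis" for b
        using that by (auto simp: Basis_vec_def inner_axis)
      show ?thesis
        unfolding Q_def by (subst emeasure_lborel_box) (auto simp: inner_add_left one prod.neutral)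
    qed
    have le: "ennreal (?D (y - real_vec k)) * indicator (Q k) z
        \<le> ennreal (C' * ?D (1 *\<^sub>R z - y)) * indicator (Q k) z" for k z
    proof (cases "z \<in> Q k")
      case True
      have "norm (real_vec k - z) \<le> real ?d * 1"
      proof (intro norm_le_card_vec)
        fix l
        have "real_of_int (k $ l) < z $ l \<and> z $ l < real_of_int (k $ l) + 1" using True
            by (simp add: Q)
        then show "\<bar>(real_vec k - z) $ l\<bar> \<le> 1" by (simp add: real_vec_def)
      qed
      then have "(1 + norm ((y - real_vec k) - (y - z))) ^ (?d + 2) \<le> C'"
        unfolding C'_def by (intro power_mono) (auto simp: norm_minus_commute)
      then have "?D (y - real_vec k) \<le> C' * ?D (y - z)"
        using decay_shift[of "?d + 2" "y - real_vec k" "y - z"]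
        by (meson decay_nonneg mult_right_mono order_trans)
      also have "?D (y - z) = ?D (1 *\<^sub>R z - y)"
        by (simp add: decay_def norm_minus_commute)
      finally show ?thesis by (intro mult_right_mono ennreal_leI) auto
    qed simp
    have "ennreal (\<Sum>k\<in>F. ?D (y - real_vec k))
        = (\<Sum>k\<in>F. ennreal (?D (y - real_vec k)))"
      by (simp add: sum_ennreal)
    also have "\<dots> = (\<Sum>k\<in>F. \<integral>\<^sup>+ z. ennreal (?D (y - real_vec k)) * indicator (Q k) z \<partial>lborel)"
      by (subst nn_integral_cmult_indicator) (auto simp: vol, simp add: Q_def)
    also have "\<dots> \<le> (\<Sum>k\<in>F. \<integral>\<^sup>+ z. ennreal (C' * ?D (1 *\<^sub>R z - y)) * indicator (Q k) z \<partial>lborel)"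
      by (intro sum_mono nn_integral_mono le)
    also have "\<dots> = (\<integral>\<^sup>+ z. (\<Sum>k\<in>F. ennreal (C' * ?D (1 *\<^sub>R z - y)) * indicator (Q k) z) \<partial>lborel)"
      by (intro nn_integral_sum[symmetric]) (simp add: Q_def)
    also have "\<dots> \<le> (\<integral>\<^sup>+ z. ennreal C' * ennreal (?D (1 *\<^sub>R z - y)) \<partial>lborel)"
    proof (intro nn_integral_mono)
      fix z
      have "(\<Sum>k\<in>F. indicator (Q k) z :: ennreal) \<le> 1"
      proof (cases "\<exists>k\<in>F. z \<in> Q k")
        case True
        then obtain k where k: "k \<in> F" "z \<in> Q k" by auto
        have "(\<Sum>k'\<in>F. indicator (Q k') z :: ennreal) = (\<Sum>k'\<in>F. if k' = k then 1 else 0)"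
          using k disj by (intro sum.cong) (auto simp: indicator_def)
        then show ?thesis using k F by simp
      next
        case False
        then have "(\<Sum>k'\<in>F. indicator (Q k') z :: ennreal) = 0" by (intro sum.neutral) auto
        then show ?thesis by simp
      qed
      then have "ennreal (C' * ?D (1 *\<^sub>R z - y)) * (\<Sum>k\<in>F. indicator (Q k) z)
          \<le> ennreal (C' * ?D (1 *\<^sub>R z - y)) * 1"
        by (intro mult_left_mono) auto
      then show "(\<Sum>k\<in>F. ennreal (C' * ?D (1 *\<^sub>R z - y)) * indicator (Q k) z)
          \<le> ennreal C' * ennreal (?D (1 *\<^sub>R z - y))"
        using C' by (simp add: sum_distrib_left ennreal_mult)
    qed
    also have "\<dots> = ennreal C' * (\<integral>\<^sup>+ z. ennreal (?D (1 *\<^sub>R z - y)) \<partial>lborel)"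
      by (intro nn_integral_cmult) measurable
    also have "\<dots> \<le> ennreal C' * ennreal (C / 1 ^ ?d)"
      by (intro mult_left_mono int) auto
    also have "\<dots> = ennreal (C' * C)" using C' C by (simp add: ennreal_mult)
    finally show ?thesis using C C' by (simp add: ennreal_le_iff)
  qed
  then show ?thesis using C C' by (intro exI[of _ "C' * C"]) auto
qed

text \<open>The Jensen inequality for a kernel of mass at most \<open>A\<close>. The pointwise inequality
\<open>u\<^sup>r\<^sup>-\<^sup>1 g \<le> (1 - 1/r) u\<^sup>r + g\<^sup>r/r\<close> is integrated against the kernel and then used twice: for
\<open>u = 1\<close> to see that the integral of \<open>g\<close> is finite, and for \<open>u\<close> this integral divided by \<open>A\<close>.\<close>

lemma epowr_nn_integral_kernel_le:
  fixes g :: "'a \<Rightarrow> real"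
  assumes r: "1 \<le> r" and g [measurable]: "g \<in> borel_measurable M" and g0: "\<And>x. 0 \<le> g x"
    and k [measurable]: "\<kappa> \<in> borel_measurable M" and A: "(\<integral>\<^sup>+ x. \<kappa> x \<partial>M) \<le> ennreal A" "0 < A"
  shows "epowr (\<integral>\<^sup>+ x. ennreal (g x) * \<kappa> x \<partial>M) r
    \<le> ennreal (A powr (r - 1)) * (\<integral>\<^sup>+ x. ennreal (g x powr r) * \<kappa> x \<partial>M)"
proof -
  let ?g = "\<lambda>x. ennreal (g x)" and ?h = "\<lambda>x. ennreal (g x powr r)"
      and ?a = "\<lambda>u. ennreal ((1 - 1/r) * u powr r)"
  define X where "X = (\<integral>\<^sup>+ x. ?g x * \<kappa> x \<partial>M)"
  define Y where "Y = (\<integral>\<^sup>+ x. ?h x * \<kappa> x \<partial>M)"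
  have main: "ennreal (u powr (r - 1)) * X \<le> ennreal ((1 - 1/r) * u powr r * A) + ennreal (1/r) * Y"
    if u: "0 \<le> u" for u :: real
  proof -
    have "ennreal (u powr (r - 1)) * X = (\<integral>\<^sup>+ x. ennreal (u powr (r - 1)) * (?g x * \<kappa> x) \<partial>M)"
      unfolding X_def by (intro nn_integral_cmult[symmetric]) measurable
    also have "\<dots> \<le> (\<integral>\<^sup>+ x. ?a u * \<kappa> x + ennreal (1/r) * (?h x * \<kappa> x) \<partial>M)"
    proof (intro nn_integral_mono)
      fix x
      have "ennreal (u powr (r - 1) * g x) \<le> ennreal ((1 - 1/r) * u powr r + g x powr r / r)"
        by (intro ennreal_leI Youngs_inequality_powr u g0 r)
      also have "\<dots> = ?a u + ennreal (1/r) * ?h x"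
        using r by (subst ennreal_plus) (auto simp: ennreal_mult[symmetric])
      finally have "ennreal (u powr (r - 1) * g x) * \<kappa> x \<le> (?a u + ennreal (1/r) * ?h x) * \<kappa> x"
        by (rule mult_right_mono) simp
      then show "ennreal (u powr (r - 1)) * (?g x * \<kappa> x)
          \<le> ?a u * \<kappa> x + ennreal (1/r) * (?h x * \<kappa> x)"
        using g0 by (simp add: ennreal_mult distrib_right mult.assoc)
    qed
    also have "\<dots> = ?a u * (\<integral>\<^sup>+ x. \<kappa> x \<partial>M) + ennreal (1/r) * Y"
      unfolding Y_def by (subst nn_integral_add) (auto simp: nn_integral_cmult)
    also have "\<dots> \<le> ?a u * ennreal A + ennreal (1/r) * Y"
      by (intro add_right_mono mult_left_mono A) auto
    also have "?a u * ennreal A = ennreal ((1 - 1/r) * u powr r * A)"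
      using r A by (intro ennreal_mult[symmetric]) auto
    finally show ?thesis .
  qed
  have "epowr X r \<le> ennreal (A powr (r - 1)) * Y"
  proof (cases "Y = \<infinity>")
    case True
    then show ?thesis using A by (simp add: ennreal_mult_top)
  next
    case False
    then obtain y where y: "Y = ennreal y" "0 \<le> y" by (cases Y) auto
    have "X < \<infinity>"
      using main[of 1] y r A by (auto simp: ennreal_mult[symmetric] ennreal_plus[symmetric] simp
          del: ennreal_plus intro: le_less_trans)
    then obtain x where x: "X = ennreal x" "0 \<le> x" by (cases X) auto
    show ?thesis
    proof (cases "x = 0")
      case False
      with x have x0: "0 < x" by simp
      define u where "u = x / A"
      have u: "0 < u" using x0 A by (simp add: u_def)
      have "u powr (r - 1) * x \<le> (1 - 1/r) * u powr r * A + (1/r) * y"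
        using main[of u] x y u r A
        by (simp add: ennreal_mult[symmetric] ennreal_plus[symmetric] del: ennreal_plus)
      moreover have "u powr (r - 1) * x = u powr r * A"
        using x0 A by (simp add: u_def powr_diff)
      ultimately have "(1/r) * (u powr r * A) \<le> (1/r) * y" by (simp add: algebra_simps)
      then have "u powr r * A \<le> y" using r by (simp add: divide_le_cancel)
      moreover have "u powr r * A = x powr r / A powr (r - 1)"
        using x0 A by (simp add: u_def powr_divide powr_diff)
      ultimately have "x powr r \<le> A powr (r - 1) * y"
        using A by (simp add: pos_divide_le_eq mult.commute)
      then show ?thesis using x y by (simp add: epowr_ennreal ennreal_mult[symmetric])
    qed (simp add: x epowr_0)
  qed
  then show ?thesis by (simp add: X_def Y_def)
qed

text \<open>The Schur test between \<open>L\<^sup>p\<close> and \<open>\<ell>\<^sup>p\<close>. The rows of the kernel have mass \<open>A\<close>, its columns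
have mass \<open>A * B\<close>, and only \<open>B\<close> enters with the exponent \<open>1/p\<close>.\<close>

lemma Schur_test:
  fixes G :: "'a \<Rightarrow> complex" and \<kappa> :: "'i \<Rightarrow> 'a \<Rightarrow> ennreal"
  assumes p: "1 \<le> p" and G [measurable]: "G \<in> borel_measurable M"
    and \<kappa> [measurable]: "\<And>k. k \<in> I \<Longrightarrow> \<kappa> k \<in> borel_measurable M"
    and row: "\<And>k. k \<in> I \<Longrightarrow> (\<integral>\<^sup>+ x. \<kappa> k x \<partial>M) \<le> ennreal A"
    and col: "\<And>F x. finite F \<Longrightarrow> F \<subseteq> I \<Longrightarrow> (\<Sum>k\<in>F. \<kappa> k x) \<le> ennreal (A * B)"
    and pos: "0 < A" "0 < B"
  shows "lp_norm p I (\<lambda>k. \<integral>\<^sup>+ x. ennreal (norm (G x)) * \<kappa> k x \<partial>M)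
    \<le> ennreal (A * B powr recip p) * Lp_norm p M G"
proof (rule lp_norm_leI[OF p])
  fix F assume F: "finite F" "F \<subseteq> I"
  let ?M = "\<lambda>k. \<integral>\<^sup>+ x. ennreal (norm (G x)) * \<kappa> k x \<partial>M"
  show "lp_norm p F (?M)
    \<le> ennreal (A * B powr recip p) * Lp_norm p M G"
  proof (cases "p = \<infinity>")
    case True
    have "?M k \<le> ennreal A * Lp_norm p M G" if k: "k \<in> I" for k
    proof -
      have [measurable]: "\<kappa> k \<in> borel_measurable M" by (rule \<kappa>[OF k])
      have "?M k \<le> (\<integral>\<^sup>+ x. Lp_norm p M G * \<kappa> k x \<partial>M)"
        using esssup_AE[of "\<lambda>x. ennreal (norm (G x))" M] True
        by (intro nn_integral_mono_AE) (auto simp: Lp_norm_def elim!: eventually_mono intro!: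
            mult_right_mono)
      also have "\<dots> = Lp_norm p M G * (\<integral>\<^sup>+ x. \<kappa> k x \<partial>M)"
        by (intro nn_integral_cmult) measurable
      also have "\<dots> \<le> Lp_norm p M G * ennreal A" by (intro mult_left_mono row k) auto
      finally show ?thesis by (simp add: mult.commute)
    qed
    with True F pos show ?thesis by (auto simp: lp_norm_def intro!: SUP_least)
  next
    case False
    note r = enn2real_exponent[OF p False]
    define r where "r = enn2real p"
    let ?G = "\<lambda>x. ennreal (norm (G x) powr r)"
    have r1: "1 \<le> r" using r by (simp add: r_def)
    define I' where "I' = (\<integral>\<^sup>+ x. ?G x \<partial>M)"
    have m\<kappa>: "(\<lambda>x. ?G x * \<kappa> k x) \<in> borel_measurable M" if "k \<in> F" for k
      using \<kappa>[OF subsetD[OF F(2) that]] by measurable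
    have "(\<Sum>k\<in>F. epowr (?M k) r)
        \<le> (\<Sum>k\<in>F. ennreal (A powr (r - 1)) * (\<integral>\<^sup>+ x. ?G x * \<kappa> k x \<partial>M))"
      by (intro sum_mono epowr_nn_integral_kernel_le r1 row \<kappa> subsetD[OF F(2)] pos) auto
    also have "\<dots> = ennreal (A powr (r - 1)) * (\<Sum>k\<in>F. \<integral>\<^sup>+ x. ?G x * \<kappa> k x \<partial>M)"
      by (simp add: sum_distrib_left)
    also have "(\<Sum>k\<in>F. \<integral>\<^sup>+ x. ?G x * \<kappa> k x \<partial>M)
        = (\<integral>\<^sup>+ x. (\<Sum>k\<in>F. ?G x * \<kappa> k x) \<partial>M)"
      by (rule nn_integral_sum[symmetric], rule m\<kappa>)
    also have "\<dots> \<le> (\<integral>\<^sup>+ x. ?G x * ennreal (A * B) \<partial>M)"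
      by (intro nn_integral_mono) (auto simp flip: sum_distrib_left intro!: mult_left_mono col F)
    also have "\<dots> = I' * ennreal (A * B)"
      unfolding I'_def by (intro nn_integral_multc) measurable
    also have "ennreal (A powr (r - 1)) * (I' * ennreal (A * B))
        = ennreal (A powr (r - 1) * (A * B)) * I'"
      using pos by (simp add: ennreal_mult ac_simps)
    also have "A powr (r - 1) * (A * B) = (A * B powr (1/r)) powr r"
      using pos r1 by (simp add: powr_mult powr_powr powr_diff)
    finally have le: "(\<Sum>k\<in>F. epowr (?M k) r)
        \<le> ennreal ((A * B powr (1/r)) powr r) * I'"
      by (simp add: mult_left_mono)
    have "lp_norm p F (?M)
        \<le> epowr (ennreal ((A * B powr (1/r)) powr r) * I') (1/r)"
      unfolding lp_norm_finite[OF p False F(1)] r_def[symmetric]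
      using le r1 by (intro epowr_mono) auto
    also have "\<dots> = ennreal (A * B powr (1/r)) * epowr I' (1/r)"
      using pos r1 by (simp add: epowr_mult powr_powr)
    also have "\<dots> = ennreal (A * B powr recip p) * Lp_norm p M G"
      using r False by (simp add: r_def Lp_norm_def I'_def)
    finally show ?thesis .
  qed
qed

lemma finite_wavelet_types: "finite (wavelet_types :: (int^'n) set)"
proof (rule finite_subset)
  show "(wavelet_types :: (int^'n) set) \<subseteq> (\<lambda>S. \<chi> l. if l \<in> S then 1 else 0) ` UNIV"
  proof
    fix i :: "int^'n" assume "i \<in> wavelet_types"
    then have "i = (\<chi> l. if l \<in> {l. i $ l = 1} then 1 else 0)"
      by (auto simp: wavelet_types_def vec_eq_iff)
    then show "i \<in> (\<lambda>S. \<chi> l. if l \<in> S then 1 else 0) ` UNIV" by blast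
  qed
qed simp

text \<open>The Schur test for the kernels at scale \<open>1/c\<close> around the lattice points, with constant
\<open>C\<close>. A predicate is used because several estimates that are combined later have to share this
constant. The shift \<open>v\<close> is there because finite differences involve translates of \<open>f\<close>.\<close>

definition schur_bound :: "'n::finite itself \<Rightarrow> real \<Rightarrow> bool" where
  "schur_bound _ C \<longleftrightarrow> 0 < C \<and> (\<forall>p c (v::real^'n) E G I. 1 \<le> p \<longrightarrow> 1 \<le> c \<longrightarrow> E \<in> sets lebesgue \<longrightarrow>
     G \<in> borel_measurable (lebesgue_on E) \<longrightarrow> I \<subseteq> (wavelet_types :: (int^'n) set) \<times> UNIV \<longrightarrow>
     lp_norm p I (\<lambda>(i, k). \<integral>\<^sup>+ x. ennreal (norm (G x)) *
        ennreal (c ^ CARD('n) * decay (CARD('n) + 2) (c *\<^sub>R (x - v) - real_vec k))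
            * indicator E x \<partial>lborel)
     \<le> ennreal (C * c powr (real CARD('n) * recip p)) * Lp_norm p (lebesgue_on E) G)"

text \<open>Normalised to bounded mass, the kernels have column sums of order \<open>c\<^sup>d\<close> by the bound for
lattice sums. Both bounds are invariant under translations.\<close>

lemma schur_bound_exists: "\<exists>C. schur_bound TYPE('n::finite) C"
proof -
  let ?d = "CARD('n)" and ?T = "wavelet_types :: (int^'n) set"
  obtain C1 where C1: "0 < C1" and int: "\<And>c (y::real^'n). 0 < c \<Longrightarrow>
     (\<integral>\<^sup>+ x. ennreal (decay (?d + 2) (c *\<^sub>R x - y)) \<partial>lborel) \<le> ennreal (C1 / c ^ ?d)"
    using nn_integral_decay_le[where 'a = "real^'n"] by auto
  obtain C2 where C2: "0 < C2" and lat: "\<And>(y::real^'n) F. finite F \<Longrightarrow>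
     (\<Sum>k\<in>F. decay (?d + 2) (y - real_vec k)) \<le> C2"
    using lattice_sum_decay_le[where 'n = 'n] by auto
  note finT = finite_wavelet_types[where 'n = 'n]
  define C where "C = max C1 (real (card ?T) * C2)"
  have C: "0 < C" using C1 by (simp add: C_def)
  let ?k = "\<lambda>c v k x. c ^ ?d * decay (?d + 2) (c *\<^sub>R (x - v) - real_vec k :: real^'n)"
  show ?thesis
    unfolding schur_bound_def
  proof (intro exI[of _ C] conjI C allI impI)
    fix p :: ennreal and c :: real and v :: "real^'n" and E and G :: "real^'n \<Rightarrow> complex"
      and I :: "((int^'n) \<times> (int^'n)) set"
    assume p: "1 \<le> p" and c: "1 \<le> c" and E[measurable]: "E \<in> sets lebesgue"
      and G: "G \<in> borel_measurable (lebesgue_on E)" and I: "I \<subseteq> ?T \<times> UNIV"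
    define K where "K = (\<lambda>(i::int^'n, k) x. ennreal (?k c v k x))"
    have Km [measurable]: "K ik \<in> borel_measurable lborel" for ik
      unfolding K_def by (cases ik) (simp, measurable)
    have Km': "K ik \<in> borel_measurable (lebesgue_on E)" for ik
      by (intro measurable_restrict_space1 measurable_completion Km)
    have "lp_norm p I (\<lambda>ik. \<integral>\<^sup>+ x. ennreal (norm (G x)) * K ik x \<partial>lebesgue_on E)
        \<le> ennreal (C * (c ^ ?d) powr recip p) * Lp_norm p (lebesgue_on E) G"
    proof (rule Schur_test[OF p G Km'])
      show "0 < C" "0 < c ^ ?d" using C c by auto
    next
      fix ik :: "(int^'n) \<times> (int^'n)"
      obtain i k where ik: "ik = (i, k)" by (cases ik)
      have "(\<integral>\<^sup>+ x. K ik x \<partial>lebesgue_on E) = (\<integral>\<^sup>+ x. K ik x * indicator E x \<partial>lborel)"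
        by (subst nn_integral_restrict_space) (auto simp: nn_integral_completion)
      also have "\<dots> \<le> (\<integral>\<^sup>+ x. K ik x \<partial>lborel)"
        by (intro nn_integral_mono) (auto simp: indicator_def)
      also have "\<dots> = (\<integral>\<^sup>+ x. ennreal (c ^ ?d)
          * ennreal (decay (?d + 2) (c *\<^sub>R x - (c *\<^sub>R v + real_vec k))) \<partial>lborel)"
        using c by (intro nn_integral_cong) (simp add: K_def ik ennreal_mult algebra_simps)
      also have "\<dots> = ennreal (c ^ ?d) * (\<integral>\<^sup>+ x. ennreal (decay (?d + 2) (c *\<^sub>R x
          - (c *\<^sub>R v + real_vec k))) \<partial>lborel)"
        by (intro nn_integral_cmult) measurable
      also have "\<dots> \<le> ennreal (c ^ ?d) * ennreal (C1 / c ^ ?d)"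
        using c by (intro mult_left_mono int) auto
      also have "\<dots> = ennreal C1" using c C1 by (simp flip: ennreal_mult)
      also have "\<dots> \<le> ennreal C" by (simp add: C_def ennreal_leI)
      finally show "(\<integral>\<^sup>+ x. K ik x \<partial>lebesgue_on E) \<le> ennreal C" .
    next
      fix F :: "((int^'n) \<times> (int^'n)) set" and x assume F: "finite F" "F \<subseteq> I"
      have "(\<Sum>ik\<in>F. K ik x) \<le> (\<Sum>ik\<in>?T \<times> snd ` F. K ik x)"
        using F I finT by (intro sum_mono2) (auto intro: rev_image_eqI)
      also have "\<dots> = (\<Sum>i\<in>?T. \<Sum>k\<in>snd ` F. K (i, k) x)"
        by (simp add: sum.cartesian_product)
      also have "\<dots> = ennreal (\<Sum>i\<in>?T. \<Sum>k\<in>snd ` F. ?k c v k x)"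
        unfolding K_def prod.case using c
        by (simp add: sum_nonneg del: sum_constant)
      also have "\<dots> \<le> ennreal (\<Sum>i\<in>?T. c ^ ?d * C2)"
        using c lat[of "snd ` F" "c *\<^sub>R (x - v)"] F
        by (intro ennreal_leI sum_mono) (auto simp flip: sum_distrib_left intro!: mult_left_mono)
      also have "\<dots> \<le> ennreal (C * c ^ ?d)"
        using c by (intro ennreal_leI) (simp add: C_def max_mult_distrib_right max_def ac_simps)
      finally show "(\<Sum>ik\<in>F. K ik x) \<le> ennreal (C * c ^ ?d)" .
    qed
    also have "(\<lambda>ik. \<integral>\<^sup>+ x. ennreal (norm (G x)) * K ik x \<partial>lebesgue_on E) =
        (\<lambda>(i, k). \<integral>\<^sup>+ x. ennreal (norm (G x)) *
        ennreal (?k c v k x) * indicator E x \<partial>lborel)"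
      by (auto simp: K_def fun_eq_iff nn_integral_restrict_space nn_integral_completion)
    also have "(c ^ ?d) powr recip p = c powr (real ?d * recip p)"
      using c by (simp add: powr_powr flip: powr_realpow)
    finally show "lp_norm p I (\<lambda>(i, k). \<integral>\<^sup>+ x. ennreal (norm (G x)) *
        ennreal (?k c v k x) * indicator E x \<partial>lborel)
      \<le> ennreal (C * c powr (real ?d * recip p)) * Lp_norm p (lebesgue_on E) G" .
  qed
qed

lemma schur_boundD:
  fixes v :: "real^'n"
  assumes "schur_bound TYPE('n) C" "1 \<le> p" "1 \<le> c" "E \<in> sets lebesgue"
      "G \<in> borel_measurable (lebesgue_on E)"
    "I \<subseteq> (wavelet_types :: (int^'n) set) \<times> UNIV"
  shows "lp_norm p I (\<lambda>(i, k). \<integral>\<^sup>+ x. ennreal (norm (G x)) *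
        ennreal (c ^ CARD('n) * decay (CARD('n) + 2) (c *\<^sub>R (x - v) - real_vec k))
            * indicator E x \<partial>lborel)
     \<le> ennreal (C * c powr (real CARD('n) * recip p)) * Lp_norm p (lebesgue_on E) G"
  using assms(1)[unfolded schur_bound_def, THEN conjunct2, rule_format, OF assms(2-6)] .

section \<open>Finite differences and averaging\<close>

text \<open>Test functions and the functions they are paired with. The two classes are in duality for
each fixed order, and both are stable under translation, which is all that the Fubini arguments
below require.\<close>

definition decaying :: "nat \<Rightarrow> ('a::euclidean_space \<Rightarrow> complex) \<Rightarrow> bool" where
  "decaying M K \<longleftrightarrow> K \<in> borel_measurable borel \<and> (\<exists>C. \<forall>x. norm (K x) \<le> C * decay M x)"

definition tempered :: "nat \<Rightarrow> ('a::euclidean_space \<Rightarrow> complex) \<Rightarrow> bool" where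
  "tempered M f \<longleftrightarrow> f \<in> borel_measurable borel \<and> integrable lborel (\<lambda>x. norm (f x) * decay M x)"

lemma decaying_measurable [measurable_dest]: "decaying M K \<Longrightarrow> K \<in> borel_measurable borel"
  by (simp add: decaying_def)

lemma tempered_measurable [measurable_dest]: "tempered M f \<Longrightarrow> f \<in> borel_measurable borel"
  by (simp add: tempered_def)

lemma decayingE:
  assumes "decaying M K"
  obtains C where "0 \<le> C" "\<And>x. norm (K x) \<le> C * decay M x"
proof -
  from assms obtain C where C: "\<And>x. norm (K x) \<le> C * decay M x" by (auto simp: decaying_def)
  have "0 \<le> C * decay M (0::'a)" using C[of 0] norm_ge_zero order_trans by blast
  then have "0 \<le> C" by (simp add: decay_def)
  with C that show thesis by blast
qed

lemma norm_integral_le_nn_integral: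
  fixes g :: "'a \<Rightarrow> 'b::{banach, second_countable_topology}"
  shows "ennreal (norm (\<integral>x. g x \<partial>M)) \<le> (\<integral>\<^sup>+x. ennreal (norm (g x)) \<partial>M)"
  by (cases "integrable M g") (auto simp: integral_norm_bound_ennreal not_integrable_integral_eq)

lemma decaying_scale:
  assumes K: "decaying M K"
  shows "decaying M (\<lambda>x. c * K x)"
proof -
  obtain C where C: "\<And>x. norm (K x) \<le> C * decay M x" using K by (rule decayingE) blast
  have "norm (c * K x) \<le> (norm c * C) * decay M x" for x
    using mult_left_mono[OF C[of x], of "norm c"] by (simp add: norm_mult mult.assoc)
  then show ?thesis using K unfolding decaying_def by (intro conjI exI[of _ "norm c * C"]) auto
qed

lemma decaying_add:
  assumes "decaying M K" "decaying M L"
  shows "decaying M (\<lambda>x. K x + L x)"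
proof -
  from assms obtain C D where C: "\<And>x. norm (K x) \<le> C * decay M x"
      and D: "\<And>x. norm (L x) \<le> D * decay M x"
    by (auto simp: decaying_def)
  have "norm (K x + L x) \<le> (C + D) * decay M x" for x
    using norm_triangle_ineq[of "K x" "L x"] C[of x] D[of x] by (simp add: distrib_right)
  with assms show ?thesis unfolding decaying_def by (intro conjI exI[of _ "C + D"]) auto
qed

lemma decaying_sum: "(\<And>i. i \<in> I \<Longrightarrow> decaying M (K i)) \<Longrightarrow> decaying M (\<lambda>x. \<Sum>i\<in>I. K i x)"
proof (induction I rule: infinite_finite_induct)
  case (insert x F)
  then show ?case by (simp add: decaying_add)
qed (auto simp: decaying_def intro!: exI[of _ 0])

lemma decaying_translate:
  assumes K: "decaying M K"
  shows "decaying M (\<lambda>x. K (x - v))"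
proof -
  obtain C where C: "0 \<le> C" "\<And>x. norm (K x) \<le> C * decay M x" using K by (rule decayingE) blast
  have "norm (K (x - v)) \<le> (C * (1 + norm v) ^ M) * decay M x" for x
    using C(2)[of "x - v"] mult_left_mono[OF decay_shift[of M "x - v" x] C(1)]
    by (simp add: mult.assoc)
  with K show ?thesis unfolding decaying_def
    by (intro conjI exI[of _ "C * (1 + norm v) ^ M"]) (measurable, auto)
qed

lemma integrable_pairing:
  assumes f: "tempered M f" and K: "decaying M K"
  shows "integrable lborel (\<lambda>x. f x * K x)"
proof -
  note [measurable] = tempered_measurable[OF f] decaying_measurable[OF K]
  obtain C where C: "0 \<le> C" "\<And>x. norm (K x) \<le> C * decay M x" using K by (rule decayingE) blast
  have "integrable lborel (\<lambda>x. C * (norm (f x) * decay M x))"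
    using f by (intro integrable_mult_right) (simp add: tempered_def)
  then show ?thesis
  proof (rule Bochner_Integration.integrable_bound)
    show "AE x in lborel. norm (f x * K x) \<le> norm (C * (norm (f x) * decay M x))"
    proof (intro always_eventually allI)
      fix x
      have "norm (f x * K x) \<le> norm (f x) * (C * decay M x)"
        unfolding norm_mult by (intro mult_left_mono C) auto
      then show "norm (f x * K x) \<le> norm (C * (norm (f x) * decay M x))"
        using C(1) by (simp add: abs_mult mult.left_commute)
    qed
  qed measurable
qed

lemma lborel_translate:
  fixes v :: "'a::euclidean_space"
  shows "lborel = distr lborel borel (\<lambda>x. x + v)"
  using lborel_distr_plus[of v] by (simp add: add.commute[of _ v] cong: distr_cong)

lemma integrable_translate_iff:
  fixes f :: "'a::euclidean_space \<Rightarrow> 'b::{banach, second_countable_topology}"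
  assumes [measurable]: "f \<in> borel_measurable borel"
  shows "integrable lborel (\<lambda>x. f (x + v)) \<longleftrightarrow> integrable lborel f"
  by (subst (2) lborel_translate[of v]) (simp add: integrable_distr_eq)

lemma integral_translate:
  fixes f :: "'a::euclidean_space \<Rightarrow> 'b::{banach, second_countable_topology}"
  assumes [measurable]: "f \<in> borel_measurable borel"
  shows "(\<integral>x. f (x + v) \<partial>lborel) = (\<integral>x. f x \<partial>lborel)"
  by (subst (2) lborel_translate[of v]) (simp add: integral_distr)

lemma nn_integral_translate:
  fixes f :: "'a::euclidean_space \<Rightarrow> ennreal"
  assumes [measurable]: "f \<in> borel_measurable borel"
  shows "(\<integral>\<^sup>+x. f (x + v) \<partial>lborel) = (\<integral>\<^sup>+x. f x \<partial>lborel)"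
  by (subst (2) lborel_translate[of v]) (simp add: nn_integral_distr)

lemma tempered_translate:
  assumes f: "tempered M f"
  shows "tempered M (\<lambda>x. f (x + v))"
proof -
  note [measurable] = tempered_measurable[OF f]
  have "decaying M (\<lambda>x. of_real (decay M x))"
    unfolding decaying_def by (intro conjI exI[of _ 1]) auto
  from decaying_translate[OF this, of v]
  have "integrable lborel (\<lambda>x. f x * of_real (decay M (x - v)))"
    by (intro integrable_pairing[OF f])
  then have "integrable lborel (\<lambda>x. norm (f x * of_real (decay M (x - v))))"
    by (rule integrable_norm)
  then have "integrable lborel (\<lambda>x. norm (f x) * decay M (x - v))"
    by (simp add: norm_mult)
  then have "integrable lborel (\<lambda>x. norm (f (x + v)) * decay M x)"
    by (subst (asm) integrable_translate_iff[of _ v, symmetric]) auto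
  moreover have "(\<lambda>x. f (x + v)) \<in> borel_measurable borel" by measurable
  ultimately show ?thesis by (simp add: tempered_def)
qed

lemma integrable_product_mult:
  fixes u :: "'a::euclidean_space \<Rightarrow> real" and v :: "'b::euclidean_space \<Rightarrow> real"
  assumes u: "integrable lborel u" and v: "integrable lborel v"
  shows "integrable (lborel \<Otimes>\<^sub>M lborel) (\<lambda>(x, y). u x * v y)"
proof -
  have [measurable]: "u \<in> borel_measurable borel" "v \<in> borel_measurable borel"
    using u v by auto
  have "(\<integral>\<^sup>+ z. ennreal (norm (case z of (x, y) \<Rightarrow> u x * v y)) \<partial>(lborel \<Otimes>\<^sub>M lborel))
      = (\<integral>\<^sup>+ x. \<integral>\<^sup>+ y. ennreal (norm (u x)) * ennreal (norm (v y)) \<partial>lborel \<partial>lborel)"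
    by (subst lborel.nn_integral_fst[symmetric]) (auto simp: abs_mult ennreal_mult)
  also have "\<dots> = (\<integral>\<^sup>+ x. ennreal (norm (u x)) \<partial>lborel) * (\<integral>\<^sup>+ y. ennreal (norm (v y)) \<partial>lborel)"
    by (simp add: nn_integral_cmult nn_integral_multc)
  also have "\<dots> < \<infinity>" using u v by (simp add: integrable_iff_bounded ennreal_mult_less_top)
  finally show ?thesis by (auto simp: integrable_iff_bounded)
qed

text \<open>The bump \<open>(1 - norm h\<^sup>2)\<^sup>N\<close> on the unit ball. It is only finitely smooth, but it is a
polynomial inside of its support and vanishes to order \<open>N\<close> at the boundary: this makes it close to
a polynomial near each point without any Taylor expansion.\<close>

definition bump_profile :: "nat \<Rightarrow> 'a::euclidean_space \<Rightarrow> real" where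
  "bump_profile N h = max 0 (1 - (norm h)\<^sup>2) ^ N"

definition bump :: "nat \<Rightarrow> 'a::euclidean_space \<Rightarrow> real" where
  "bump N h = bump_profile N h / (\<integral>h. bump_profile N (h::'a) \<partial>lborel)"

lemma bump_profile_measurable [measurable]: "bump_profile N \<in> borel_measurable borel"
  unfolding bump_profile_def[abs_def] by measurable

lemma bump_profile_nonneg: "0 \<le> bump_profile N h"
  by (simp add: bump_profile_def)

lemma bump_profile_le_1: "bump_profile N h \<le> 1"
  by (simp add: bump_profile_def power_le_one)

lemma bump_profile_outside: "0 < N \<Longrightarrow> 1 \<le> norm h \<Longrightarrow> bump_profile N h = 0"
  by (simp add: bump_profile_def max_def one_le_power power_0_left)
    (metis abs_le_square_iff abs_norm_cancel abs_one diff_ge_0_iff_ge nle_le one_power2 power_one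
        zero_power)

lemma bump_profile_integrable:
  assumes N: "0 < N"
  shows "integrable lborel (bump_profile N :: 'a::euclidean_space \<Rightarrow> real)"
proof -
  have "integrable lborel (indicator (cball 0 1) :: 'a \<Rightarrow> real)"
    by (rule integrable_real_indicator) (auto simp: emeasure_cball)
  then show ?thesis
  proof (rule Bochner_Integration.integrable_bound)
    show "AE x in lborel. norm (bump_profile N x) \<le> norm (indicator (cball (0::'a) 1) x :: real)"
    proof (intro always_eventually allI)
      fix x :: 'a
      show "norm (bump_profile N x) \<le> norm (indicator (cball (0::'a) 1) x :: real)"
        using bump_profile_outside[OF N, of x] bump_profile_le_1[of N x] bump_profile_nonneg[of N x]
        by (cases "norm x \<le> 1") auto
    qed
  qed measurable
qed

text \<open>The ball of radius \<open>1/2\<close> alone contributes a positive amount, as the profile is at least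
\<open>(3/4)\<^sup>N\<close> there.\<close>

lemma bump_profile_integral_pos:
  assumes N: "0 < N"
  shows "0 < (\<integral>h. bump_profile N (h::'a::euclidean_space) \<partial>lborel)"
proof -
  have "0 < (3/4) ^ N * measure lborel (ball (0::'a) (1/2))"
    using content_ball_pos[of "1/2" "0::'a"] by simp
  also have "\<dots> = (\<integral>h. (3/4) ^ N * indicator (ball (0::'a) (1/2)) h \<partial>lborel)"
    by simp
  also have "\<dots> \<le> (\<integral>h. bump_profile N (h::'a) \<partial>lborel)"
  proof (rule Bochner_Integration.integral_mono[OF _ bump_profile_integrable[OF N]])
    show "integrable lborel (\<lambda>h. (3/4) ^ N * indicator (ball (0::'a) (1/2)) h :: real)"
      by (intro integrable_mult_right integrable_real_indicator) (auto simp: emeasure_ball)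
    fix h :: 'a
    have "(3/4) ^ N \<le> bump_profile N h" if "norm h < 1/2"
    proof -
      have "(norm h)\<^sup>2 \<le> (1/2)\<^sup>2" using that by (intro power_mono) auto
      then show ?thesis unfolding bump_profile_def
          by (intro power_mono) (auto simp: power2_eq_square)
    qed
    then show "(3/4) ^ N * indicator (ball (0::'a) (1/2)) h \<le> bump_profile N h"
      by (auto simp: indicator_def bump_profile_nonneg)
  qed
  finally show ?thesis .
qed

lemma bump_measurable [measurable]: "bump N \<in> borel_measurable borel"
  unfolding bump_def[abs_def] by measurable

lemma bump_nonneg [simp]: "0 \<le> bump N h"
  unfolding bump_def by (intro divide_nonneg_nonneg integral_nonneg_AE)
      (auto simp: bump_profile_nonneg)

lemma bump_outside: "0 < N \<Longrightarrow> 1 \<le> norm h \<Longrightarrow> bump N h = 0"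
  by (simp add: bump_def bump_profile_outside)

lemma bump_integrable: "0 < N \<Longrightarrow> integrable lborel (bump N)"
  unfolding bump_def[abs_def] by (intro integrable_divide_zero bump_profile_integrable) auto

lemma bump_integral: "0 < N \<Longrightarrow> (\<integral>h. bump N (h::'a::euclidean_space) \<partial>lborel) = 1"
  using bump_profile_integral_pos[of N, where 'a = 'a] by (simp add: bump_def)

lemma bump_nn_integral: "0 < N \<Longrightarrow> (\<integral>\<^sup>+h. ennreal (bump N (h::'a::euclidean_space)) \<partial>lborel) = 1"
  using bump_integral[of N, where 'a = 'a]
  by (subst nn_integral_eq_integral) (auto simp: bump_integrable)

text \<open>Convolution with the bump dilated to scale \<open>r\<close>, written as an average over translates so
that \<open>r = 0\<close> gives the identity.\<close>

definition avg :: "nat \<Rightarrow> real \<Rightarrow> ('a::euclidean_space \<Rightarrow> complex) \<Rightarrow> 'a \<Rightarrow> complex" where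
  "avg N r K x = (\<integral>h. bump N h *\<^sub>R K (x - r *\<^sub>R h) \<partial>lborel)"

lemma avg_measurable [measurable]:
  assumes [measurable]: "K \<in> borel_measurable borel"
  shows "avg N r K \<in> borel_measurable borel"
  unfolding avg_def[abs_def] by measurable

lemma norm_bump_translate_le:
  assumes N: "0 < N" and C: "0 \<le> C" "\<And>x. norm (K x) \<le> C * decay M x"
  shows "norm (bump N h *\<^sub>R K (x - r *\<^sub>R h)) \<le> bump N h * (C * (1 + \<bar>r\<bar>) ^ M * decay M x)"
proof (cases "norm h < 1")
  case True
  have "norm (K (x - r *\<^sub>R h)) \<le> C * decay M (x - r *\<^sub>R h)" by (rule C)
  also have "\<dots> \<le> C * ((1 + norm ((x - r *\<^sub>R h) - x)) ^ M * decay M x)"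
    by (intro mult_left_mono decay_shift C)
  also have "\<dots> \<le> C * ((1 + \<bar>r\<bar>) ^ M * decay M x)"
    using True by (intro mult_left_mono mult_right_mono power_mono C) (auto simp: mult_left_le)
  finally show ?thesis by (simp add: mult_left_mono mult.assoc)
qed (simp add: bump_outside[OF N])

lemma integrable_bump_translate:
  assumes N: "0 < N" and K: "decaying M K"
  shows "integrable lborel (\<lambda>h. bump N h *\<^sub>R K (x - r *\<^sub>R h))"
proof -
  note [measurable] = decaying_measurable[OF K]
  obtain C where C: "0 \<le> C" "\<And>x. norm (K x) \<le> C * decay M x" using K by (rule decayingE) blast
  have "integrable lborel (\<lambda>h. bump N h * (C * (1 + \<bar>r\<bar>) ^ M * decay M x))"
    using bump_integrable[OF N] by (rule integrable_mult_left)
  then show ?thesis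
  proof (rule Bochner_Integration.integrable_bound)
    have "norm (bump N h *\<^sub>R K (x - r *\<^sub>R h)) \<le> norm (bump N h * (C * (1 + \<bar>r\<bar>) ^ M * decay M x))"
        for h
      using norm_bump_translate_le[OF N C, of h x r] by (rule order_trans) simp
    then show "AE h in lborel. norm (bump N h *\<^sub>R K (x - r *\<^sub>R h))
        \<le> norm (bump N h * (C * (1 + \<bar>r\<bar>) ^ M * decay M x))"
      by simp
  qed measurable
qed

lemma decaying_avg:
  assumes N: "0 < N" and K: "decaying M K"
  shows "decaying M (avg N r K)"
proof -
  note [measurable] = decaying_measurable[OF K]
  obtain C where C: "0 \<le> C" "\<And>x. norm (K x) \<le> C * decay M x" using K by (rule decayingE) blast
  have "norm (avg N r K x) \<le> (C * (1 + \<bar>r\<bar>) ^ M) * decay M x" for x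
  proof -
    have "norm (avg N r K x) \<le> (\<integral>h. norm (bump N h *\<^sub>R K (x - r *\<^sub>R h)) \<partial>lborel)"
      unfolding avg_def by (rule integral_norm_bound)
    also have "\<dots> \<le> (\<integral>h. bump N (h::'a) * (C * (1 + \<bar>r\<bar>) ^ M * decay M x) \<partial>lborel)"
    proof (rule Bochner_Integration.integral_mono)
      show "integrable lborel (\<lambda>h. norm (bump N h *\<^sub>R K (x - r *\<^sub>R h)))"
        by (intro integrable_norm integrable_bump_translate[OF N K])
      show "integrable lborel (\<lambda>h::'a. bump N h * (C * (1 + \<bar>r\<bar>) ^ M * decay M x))"
        using bump_integrable[OF N] by (rule integrable_mult_left)
    qed (rule norm_bump_translate_le[OF N C])
    also have "\<dots> = (C * (1 + \<bar>r\<bar>) ^ M) * decay M x"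
      by (simp add: bump_integral[OF N] mult.assoc)
    finally show ?thesis .
  qed
  then show ?thesis unfolding decaying_def by (intro conjI exI[of _ "C * (1 + \<bar>r\<bar>) ^ M"]) auto
qed

lemma avg_0: "0 < N \<Longrightarrow> avg N 0 K x = K x"
  by (simp add: avg_def bump_integral bump_integrable)

lemma avg_sum:
  assumes N: "0 < N" and K: "\<And>i. i \<in> I \<Longrightarrow> decaying M (K i)"
  shows "avg N r (\<lambda>x. \<Sum>i\<in>I. c i * K i x) x = (\<Sum>i\<in>I. c i * avg N r (K i) x)"
proof -
  have "avg N r (\<lambda>x. \<Sum>i\<in>I. c i * K i x) x
      = (\<integral>h. (\<Sum>i\<in>I. c i * (bump N h *\<^sub>R K i (x - r *\<^sub>R h))) \<partial>lborel)"
    unfolding avg_def by (simp add: scaleR_sum_right mult_scaleR_right)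
  also have "\<dots> = (\<Sum>i\<in>I. (\<integral>h. c i * (bump N h *\<^sub>R K i (x - r *\<^sub>R h)) \<partial>lborel))"
    by (intro Bochner_Integration.integral_sum integrable_mult_right
        integrable_bump_translate[OF N K])
  also have "\<dots> = (\<Sum>i\<in>I. c i * avg N r (K i) x)"
    unfolding avg_def by (intro sum.cong refl Bochner_Integration.integral_mult_right_zero)
  finally show ?thesis .
qed

lemma avg_commute:
  assumes N: "0 < N" and K: "decaying M K"
  shows "avg N r (avg N s K) x = avg N s (avg N r K) x"
proof -
  note [measurable] = decaying_measurable[OF K]
  obtain C where C: "0 \<le> C" "\<And>x. norm (K x) \<le> C * decay M x" using K by (rule decayingE) blast
  define F where "F h k = bump N h *\<^sub>R (bump N k *\<^sub>R K (x - r *\<^sub>R h - s *\<^sub>R k))" for h k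
  have "integrable (lborel \<Otimes>\<^sub>M lborel) (\<lambda>(h, k). (C * bump N h) * bump N (k::'a))"
    by (intro integrable_product_mult integrable_mult_right bump_integrable N)
  then have "integrable (lborel \<Otimes>\<^sub>M lborel) (case_prod F)"
  proof (rule Bochner_Integration.integrable_bound)
    show "case_prod F \<in> borel_measurable (lborel \<Otimes>\<^sub>M lborel)"
      unfolding F_def by measurable
    have "norm (F h k) \<le> bump N h * (bump N k * C)" for h k
    proof -
      have "norm (K (x - r *\<^sub>R h - s *\<^sub>R k)) \<le> C * 1"
        using C(2) by (rule order_trans) (intro mult_left_mono decay_le_1 C(1))
      then show ?thesis
        by (simp add: F_def mult.assoc mult_left_mono)
    qed
    then show "AE z in lborel \<Otimes>\<^sub>M lborel. norm (case_prod F z)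
        \<le> norm (case z of (h, k) \<Rightarrow> (C * bump N h) * bump N k)"
      using C(1) by (auto intro!: always_eventually simp: abs_mult ac_simps)
  qed
  from lborel_pair.Fubini_integral[OF this]
  have "(\<integral>k. \<integral>h. F h k \<partial>lborel \<partial>lborel) = (\<integral>h. \<integral>k. F h k \<partial>lborel \<partial>lborel)" .
  moreover have "(\<integral>h. \<integral>k. F h k \<partial>lborel \<partial>lborel) = avg N r (avg N s K) x"
    by (simp add: F_def avg_def del: scaleR_scaleR)
  moreover have "(\<integral>k. \<integral>h. F h k \<partial>lborel \<partial>lborel) = avg N s (avg N r K) x"
  proof -
    have "F h k = bump N k *\<^sub>R (bump N h *\<^sub>R K (x - s *\<^sub>R k - r *\<^sub>R h))" for h k
      by (simp add: F_def mult.commute diff_diff_eq add.commute[of "r *\<^sub>R h"])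
    then show ?thesis by (simp add: avg_def del: scaleR_scaleR)
  qed
  ultimately show ?thesis by simp
qed

lemma integral_avg:
  assumes N: "0 < N" and f: "tempered M f" and K: "decaying M K"
  shows "(\<integral>h. bump N h *\<^sub>R (\<integral>x. f x * K (x - r *\<^sub>R h) \<partial>lborel) \<partial>lborel)
      = (\<integral>x. f x * avg N r K x \<partial>lborel)"
    and "integrable lborel (\<lambda>h. bump N h *\<^sub>R (\<integral>x. f x * K (x - r *\<^sub>R h) \<partial>lborel))"
proof -
  note [measurable] = tempered_measurable[OF f] decaying_measurable[OF K]
  obtain C where C: "0 \<le> C" "\<And>x. norm (K x) \<le> C * decay M x" using K by (rule decayingE) blast
  define F where "F h x = f x * (bump N h *\<^sub>R K (x - r *\<^sub>R h))" for h x
  define D where "D = C * (1 + \<bar>r\<bar>) ^ M"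
  have D: "0 \<le> D" using C by (simp add: D_def)
  have "integrable (lborel \<Otimes>\<^sub>M lborel) (\<lambda>(h::'a, x). (D * bump N h) * (norm (f x) * decay M x))"
    using f by (intro integrable_product_mult integrable_mult_right bump_integrable N)
        (simp add: tempered_def)
  then have int: "integrable (lborel \<Otimes>\<^sub>M lborel) (case_prod F)"
  proof (rule Bochner_Integration.integrable_bound)
    show "case_prod F \<in> borel_measurable (lborel \<Otimes>\<^sub>M lborel)"
      unfolding F_def by measurable
    have "norm (F h x) \<le> norm (f x) * (bump N h * (D * decay M x))" for h x
      unfolding F_def norm_mult D_def by (intro mult_left_mono norm_bump_translate_le[OF N C]) auto
    then show "AE z in lborel \<Otimes>\<^sub>M lborel. norm (case_prod F z)
        \<le> norm (case z of (h, x) \<Rightarrow> (D * bump N h) * (norm (f x) * decay M x))"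
      using D by (auto intro!: always_eventually simp: abs_mult ac_simps)
  qed
  have 1: "(\<integral>x. F h x \<partial>lborel) = bump N h *\<^sub>R (\<integral>x. f x * K (x - r *\<^sub>R h) \<partial>lborel)" for h
    by (simp add: F_def)
  have 2: "(\<integral>h. F h x \<partial>lborel) = f x * avg N r K x" for x
    by (simp add: F_def avg_def integrable_bump_translate[OF N K] del: mult_scaleR_right)
  show "(\<integral>h. bump N h *\<^sub>R (\<integral>x. f x * K (x - r *\<^sub>R h) \<partial>lborel) \<partial>lborel)
      = (\<integral>x. f x * avg N r K x \<partial>lborel)"
    using lborel_pair.Fubini_integral[OF int] by (simp add: 1 2)
  show "integrable lborel (\<lambda>h. bump N h *\<^sub>R (\<integral>x. f x * K (x - r *\<^sub>R h) \<partial>lborel))"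
    using lborel_pair.integrable_fst[OF int] by (simp add: 1)
qed

lemma fin_diff_eq_sum:
  "fin_diff m h f x = (-1) ^ m * (\<Sum>i\<le>m. (-1) ^ i * of_nat (m choose i) * f (x + real i *\<^sub>R h))"
proof (induction m arbitrary: x)
  case (Suc m)
  define F where "F i = f (x + real i *\<^sub>R h)" for i
  have "(\<Sum>i\<le>Suc m. (-1) ^ i * of_nat (Suc m choose i) * F i)
      = F 0 + (\<Sum>i\<le>m. (-1) ^ Suc i * (of_nat (m choose i) + of_nat (m choose Suc i)) * F (Suc i))"
    by (subst sum.atMost_Suc_shift) simp
  also have "\<dots> = (F 0 + (\<Sum>i\<le>m. (-1) ^ Suc i * of_nat (m choose Suc i) * F (Suc i)))
      - (\<Sum>i\<le>m. (-1) ^ i * of_nat (m choose i) * F (Suc i))"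
    by (simp add: algebra_simps sum.distrib sum_subtractf sum_negf)
  also have "F 0 + (\<Sum>i\<le>m. (-1) ^ Suc i * of_nat (m choose Suc i) * F (Suc i))
      = (\<Sum>i\<le>Suc m. (-1) ^ i * of_nat (m choose i) * F i)"
    by (subst sum.atMost_Suc_shift) simp
  also have "\<dots> = (\<Sum>i\<le>m. (-1) ^ i * of_nat (m choose i) * F i)"
    by simp
  finally have *: "(\<Sum>i\<le>Suc m. (-1) ^ i * of_nat (Suc m choose i) * F i)
      = (\<Sum>i\<le>m. (-1) ^ i * of_nat (m choose i) * F i) - (\<Sum>i\<le>m. (-1) ^ i * of_nat (m choose i)
          * F (Suc i))" .
  have "f (x + h + real i *\<^sub>R h) = F (Suc i)" for i
    by (simp add: F_def algebra_simps)
  then have "fin_diff (Suc m) h f x = (-1) ^ m * (\<Sum>i\<le>m. (-1) ^ i * of_nat (m choose i) * F (Suc i))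
      - (-1) ^ m * (\<Sum>i\<le>m. (-1) ^ i * of_nat (m choose i) * F i)"
    by (simp add: Suc.IH F_def[symmetric])
  also have "\<dots> = (-1) ^ Suc m * (\<Sum>i\<le>Suc m. (-1) ^ i * of_nat (Suc m choose i) * F i)"
    unfolding * by (simp add: algebra_simps)
  finally show ?case by (simp add: F_def)
qed simp

lemma fin_diff_measurable [measurable]:
  fixes f :: "real^'n \<Rightarrow> complex"
  assumes [measurable]: "f \<in> borel_measurable borel" "g \<in> borel_measurable M"
      "u \<in> borel_measurable M"
  shows "(\<lambda>z. fin_diff m (g z) f (u z)) \<in> borel_measurable M"
  unfolding fin_diff_eq_sum by measurable

text \<open>The binomial coefficients are those of \<open>1 - (1 - T)\<^sup>m\<close>, where \<open>T\<close> is a translation. Thus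
\<open>K - smooth N m S K\<close> is an average of \<open>m\<close>-th differences of \<open>K\<close> with steps at most \<open>S\<close>, up to the
sign. For \<open>m = 0\<close> the operator is \<open>0\<close>, in accordance with \<open>fin_diff 0 h f = f\<close>.\<close>

definition smooth :: "nat \<Rightarrow> nat \<Rightarrow> real \<Rightarrow> (real^'n \<Rightarrow> complex) \<Rightarrow> real^'n \<Rightarrow> complex" where
  "smooth N m S K x = (\<Sum>i=1..m. ((-1) ^ Suc i * of_nat (m choose i)) * avg N (real i * S) K x)"

lemma decaying_smooth:
  assumes "0 < N" "decaying M K"
  shows "decaying M (smooth N m S K)"
  unfolding smooth_def[abs_def] by (intro decaying_sum decaying_scale decaying_avg assms)

lemma smooth_commute:
  assumes N: "0 < N" and K: "decaying M K"
  shows "smooth N m S (smooth N m S' K) x = smooth N m S' (smooth N m S K) x"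
proof -
  have "smooth N m S (smooth N m S' K) x = (\<Sum>i=1..m. \<Sum>j=1..m. ((-1) ^ Suc i * of_nat (m choose i)) *
      (((-1) ^ Suc j * of_nat (m choose j))
          * avg N (real i * S) (avg N (real j * S') K) x))" for S S'
    unfolding smooth_def[abs_def]
    by (subst avg_sum[OF N decaying_avg[OF N K]]) (simp add: sum_distrib_left)
  note * = this
  show ?thesis
    unfolding * by (subst sum.swap) (simp only: avg_commute[OF N K] mult.left_commute)
qed

text \<open>Expanding \<open>fin_diff\<close> by the binomial formula and moving the translations from \<open>f\<close> to
\<open>K\<close> turns the average over \<open>h\<close> into averages of \<open>K\<close>; the term without translation gives
\<open>K\<close> itself since the bump has integral \<open>1\<close>.\<close>

lemma integral_fin_diff:
  assumes N: "0 < N" and f: "tempered M f" and K: "decaying M K"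
  shows "(\<integral>h. bump N h *\<^sub>R (\<integral>x. fin_diff m (S *\<^sub>R h) f x * K x \<partial>lborel) \<partial>lborel)
    = (-1) ^ m * ((\<integral>x. f x * K x \<partial>lborel) - (\<integral>x. f x * smooth N m S K x \<partial>lborel))"
proof -
  note [measurable] = tempered_measurable[OF f] decaying_measurable[OF K]
  define a where "a i = ((-1) ^ i * of_nat (m choose i) :: complex)" for i
  define J where "J r h = (\<integral>x. f x * K (x - r *\<^sub>R h) \<partial>lborel)" for r h
  let ?I = "\<lambda>h. \<integral>x. fin_diff m (S *\<^sub>R h) f x * K x \<partial>lborel"
  let ?A = "\<lambda>i. \<integral>x. f x * avg N (real i * S) K x \<partial>lborel"
  have tr: "(\<integral>x. f (x + v) * K x \<partial>lborel) = (\<integral>x. f x * K (x - v) \<partial>lborel)" for v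
    using integral_translate[of "\<lambda>x. f x * K (x - v)" v] by simp
  have J: "?I h = (-1) ^ m * (\<Sum>i\<le>m. a i * J (real i * S) h)" for h
  proof -
    have "?I h
        = (\<integral>x. (\<Sum>i\<le>m. ((-1) ^ m * a i) * (f (x + (real i * S) *\<^sub>R h) * K x)) \<partial>lborel)"
      by (simp add: fin_diff_eq_sum a_def sum_distrib_left sum_distrib_right mult.assoc)
    also have "\<dots> = (\<Sum>i\<le>m. \<integral>x. ((-1) ^ m * a i) * (f (x + (real i * S) *\<^sub>R h) * K x) \<partial>lborel)"
      by (intro Bochner_Integration.integral_sum integrable_mult_right
          integrable_pairing[OF tempered_translate[OF f] K])
    also have "\<dots> = (\<Sum>i\<le>m. ((-1) ^ m * a i) * (\<integral>x. f (x + (real i * S) *\<^sub>R h) * K x \<partial>lborel))"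
      by (intro sum.cong refl Bochner_Integration.integral_mult_right_zero)
    finally show ?thesis by (simp add: tr J_def sum_distrib_left mult.assoc)
  qed
  have "(\<integral>h. bump N h *\<^sub>R ?I h \<partial>lborel)
      = (\<integral>h. (\<Sum>i\<le>m. ((-1) ^ m * a i) * (bump N h *\<^sub>R J (real i * S) h)) \<partial>lborel)"
    by (simp add: J sum_distrib_left scaleR_sum_right mult.assoc)
  also have "\<dots> = (\<Sum>i\<le>m. \<integral>h. ((-1) ^ m * a i) * (bump N h *\<^sub>R J (real i * S) h) \<partial>lborel)"
    unfolding J_def by (intro Bochner_Integration.integral_sum integrable_mult_right
        integral_avg(2)[OF N f K])
  also have "\<dots> = (\<Sum>i\<le>m. ((-1) ^ m * a i) * (\<integral>h. bump N h *\<^sub>R J (real i * S) h \<partial>lborel))"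
    unfolding J_def by (intro sum.cong refl Bochner_Integration.integral_mult_right_zero)
  also have "\<dots> = (-1) ^ m * (\<Sum>i\<le>m. a i * ?A i)"
    unfolding J_def integral_avg(1)[OF N f K] by (simp add: sum_distrib_left mult.assoc)
  also have "(\<Sum>i\<le>m. a i * ?A i)
      = (\<integral>x. f x * K x \<partial>lborel) + (\<Sum>i=1..m. a i * ?A i)"
    by (simp add: atMost_atLeast0 sum.atLeast_Suc_atMost a_def avg_0[OF N])
  also have "(\<Sum>i=1..m. a i * ?A i)
      = - (\<integral>x. f x * smooth N m S K x \<partial>lborel)"
  proof -
    have "(\<integral>x. f x * smooth N m S K x \<partial>lborel)
        = (\<integral>x. (\<Sum>i=1..m. (- a i) * (f x * avg N (real i * S) K x)) \<partial>lborel)"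
      by (simp add: smooth_def a_def sum_distrib_left mult.left_commute)
    also have "\<dots> = (\<Sum>i=1..m. \<integral>x. (- a i) * (f x * avg N (real i * S) K x) \<partial>lborel)"
      by (intro Bochner_Integration.integral_sum integrable_mult_right integrable_pairing[OF f]
          decaying_avg N K)
    also have "\<dots> = (\<Sum>i=1..m. (- a i) * ?A i)"
      by (intro sum.cong refl Bochner_Integration.integral_mult_right_zero)
    finally show ?thesis by (simp add: sum_negf)
  qed
  finally show ?thesis by simp
qed

text \<open>The quantity that majorises the left-hand side of \<open>integral_fin_diff\<close> after absolute values
have been taken inside of both integrals.\<close>

definition mean_diff :: "nat \<Rightarrow> nat \<Rightarrow> real \<Rightarrow> (real^'n \<Rightarrow> complex) \<Rightarrow> (real^'n \<Rightarrow> complex) \<Rightarrow> ennreal"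
    where
  "mean_diff N m S f K = (\<integral>\<^sup>+h. ennreal (bump N h) *
     (\<integral>\<^sup>+x. ennreal (norm (fin_diff m (S *\<^sub>R h) f x)) * ennreal (norm (K x)) \<partial>lborel) \<partial>lborel)"

lemma norm_pairing_smooth_le:
  assumes N: "0 < N" and f: "tempered M f" and K: "decaying M K"
  shows "ennreal (norm ((\<integral>x. f x * K x \<partial>lborel) - (\<integral>x. f x * smooth N m S K x \<partial>lborel)))
    \<le> mean_diff N m S f K"
proof -
  let ?I = "\<lambda>h. \<integral>x. fin_diff m (S *\<^sub>R h) f x * K x \<partial>lborel"
  note [measurable] = tempered_measurable[OF f] decaying_measurable[OF K]
  have "norm ((\<integral>x. f x * K x \<partial>lborel) - (\<integral>x. f x * smooth N m S K x \<partial>lborel))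
      = norm (\<integral>h. bump N h *\<^sub>R (?I h) \<partial>lborel)"
    unfolding integral_fin_diff[OF N f K] by (simp add: norm_mult norm_power)
  also have "ennreal \<dots> \<le> (\<integral>\<^sup>+h. ennreal (norm (bump N h *\<^sub>R (?I h))) \<partial>lborel)"
    by (rule norm_integral_le_nn_integral)
  also have "\<dots> \<le> mean_diff N m S f K"
    unfolding mean_diff_def
  proof (intro nn_integral_mono)
    fix h
    have "ennreal (norm (?I h))
        \<le> (\<integral>\<^sup>+x. ennreal (norm (fin_diff m (S *\<^sub>R h) f x * K x)) \<partial>lborel)"
      by (rule norm_integral_le_nn_integral)
    then show "ennreal (norm (bump N h *\<^sub>R (?I h)))
        \<le> ennreal (bump N h) * (\<integral>\<^sup>+x. ennreal (norm (fin_diff m (S *\<^sub>R h) f x))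
            * ennreal (norm (K x)) \<partial>lborel)"
      by (simp add: ennreal_mult norm_mult mult_left_mono)
  qed
  finally show ?thesis .
qed

text \<open>Since smoothing operators commute, \<open>u l - u (Suc l)\<close> is the difference of
\<open>u l - smooth (S (Suc l)) (u l)\<close> and \<open>u (Suc l) - smooth (S l) (u (Suc l))\<close>: the two smoothed
terms coincide. Each of these pairs with \<open>f\<close> through differences of \<open>f\<close>.\<close>

lemma norm_pairing_le_telescope:
  fixes f K :: "real^'n \<Rightarrow> complex" and S :: "nat \<Rightarrow> real" and m :: nat
  assumes N: "0 < N" and f: "tempered M f" and K: "decaying M K"
  defines "u \<equiv> \<lambda>l. smooth N m (S l) K"
  shows "ennreal (norm (\<integral>x. f x * K x \<partial>lborel)) \<le>
    mean_diff N m (S 0) f K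
    + (\<Sum>l<j. mean_diff N m (S (Suc l)) f (u l) + mean_diff N m (S l) f (u (Suc l)))
    + (\<integral>\<^sup>+x. ennreal (norm (f x)) * ennreal (norm (u j x)) \<partial>lborel)"
proof -
  define P where "P L = (\<integral>x. f x * L x \<partial>lborel)" for L
  let ?a = "\<lambda>l. P (u l) - P (smooth N m (S (Suc l)) (u l))"
  let ?b = "\<lambda>l. P (u (Suc l)) - P (smooth N m (S l) (u (Suc l)))"
  let ?d = "\<lambda>l. P (u l) - P (u (Suc l))"
  let ?m = "\<lambda>l. mean_diff N m (S (Suc l)) f (u l) + mean_diff N m (S l) f (u (Suc l))"
  have u: "decaying M (u l)" for l unfolding u_def by (intro decaying_smooth N K)
  have comm: "smooth N m (S (Suc l)) (u l) = smooth N m (S l) (u (Suc l))" for l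
    unfolding u_def by (intro ext smooth_commute[OF N K])
  have E: "ennreal (norm (P L - P (smooth N m s L))) \<le> mean_diff N m s f L" if "decaying M L"
      for L s
    unfolding P_def by (rule norm_pairing_smooth_le[OF N f that])
  have step: "ennreal (norm (?d l)) \<le> ?m l" for l
  proof -
    have "P (u l) - P (u (Suc l)) = (?a l) - (?b l)"
      by (simp add: comm)
    then have "norm (?d l) \<le> norm (?a l) + norm (?b l)"
      by (metis norm_triangle_ineq4)
    then have "ennreal (norm (?d l)) \<le> ennreal (norm (?a l)) + ennreal (norm (?b l))"
      by (simp add: ennreal_leI flip: ennreal_plus)
    also have "\<dots> \<le> ?m l"
      by (intro add_mono E u)
    finally show ?thesis .
  qed
  have "P K = (P K - P (u 0)) + (\<Sum>l<j. ?d l) + P (u j)"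
    by (subst sum_lessThan_telescope') simp
  then have "norm (P K) \<le> norm ((P K - P (u 0)) + (\<Sum>l<j. ?d l)) + norm (P (u j))"
    using norm_triangle_ineq[of "(P K - P (u 0)) + (\<Sum>l<j. ?d l)" "P (u j)"]
    by (simp only: )
  also have "\<dots> \<le> norm (P K - P (u 0)) + (\<Sum>l<j. norm (?d l)) + norm (P (u j))"
    by (intro add_right_mono order_trans[OF norm_triangle_ineq] add_left_mono norm_sum)
  finally have le: "norm (P K) \<le> norm (P K - P (u 0)) + (\<Sum>l<j. norm (?d l)) + norm (P (u j))" .
  have "ennreal (norm (P K)) \<le> ennreal (norm (P K - P (u 0))) + (\<Sum>l<j. ennreal (norm (?d l)))
      + ennreal (norm (P (u j)))"
  proof -
    note ennreal_leI[OF le]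
    also have "ennreal (norm (P K - P (u 0)) + (\<Sum>l<j. norm (?d l)) + norm (P (u j)))
        = ennreal (norm (P K - P (u 0))) + (\<Sum>l<j. ennreal (norm (?d l))) + ennreal (norm (P (u j)))"
      by (simp add: sum_nonneg)
    finally show ?thesis .
  qed
  also have "\<dots> \<le> mean_diff N m (S 0) f K
    + (\<Sum>l<j. ?m l)
    + (\<integral>\<^sup>+x. ennreal (norm (f x)) * ennreal (norm (u j x)) \<partial>lborel)"
  proof (intro add_mono sum_mono step)
    show "ennreal (norm (P K - P (u 0))) \<le> mean_diff N m (S 0) f K"
      unfolding u_def by (rule E[OF K])
    have "ennreal (norm (P (u j))) \<le> (\<integral>\<^sup>+x. ennreal (norm (f x * u j x)) \<partial>lborel)"
      unfolding P_def by (rule norm_integral_le_nn_integral)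
    then show "ennreal (norm (P (u j))) \<le> (\<integral>\<^sup>+x. ennreal (norm (f x))
        * ennreal (norm (u j x)) \<partial>lborel)"
      by (simp add: norm_mult ennreal_mult)
  qed
  finally show ?thesis unfolding P_def .
qed

section \<open>Smoothing a function with vanishing moments\<close>

text \<open>The part of the Schwartz condition that concerns the size of the function.\<close>

definition rapidly_decaying :: "('a::euclidean_space \<Rightarrow> complex) \<Rightarrow> bool" where
  "rapidly_decaying g \<longleftrightarrow> (\<forall>M. decaying M g)"

lemma decay_integrable: "integrable lborel (decay (DIM('a) + 2) :: 'a::euclidean_space \<Rightarrow> real)"
proof -
  obtain C where "\<And>c (y::'a). 0 < c \<Longrightarrow>
     (\<integral>\<^sup>+ x. ennreal (decay (DIM('a) + 2) (c *\<^sub>R x - y)) \<partial>lborel) \<le> ennreal (C / c ^ DIM('a))"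
    using nn_integral_decay_le[where 'a = 'a] by auto
  from this[of 1 0] have "(\<integral>\<^sup>+ x. ennreal (decay (DIM('a) + 2) (x::'a)) \<partial>lborel) < \<infinity>"
    by (auto intro: le_less_trans)
  then show ?thesis by (intro integrableI_nonneg) auto
qed

lemma decaying_integrable:
  fixes g :: "'a::euclidean_space \<Rightarrow> complex"
  assumes "decaying (DIM('a) + 2) g"
  shows "integrable lborel g"
proof -
  have "tempered (DIM('a) + 2) (\<lambda>_::'a. 1)"
    using decay_integrable[where 'a = 'a] by (simp add: tempered_def)
  from integrable_pairing[OF this assms] show ?thesis by simp
qed

text \<open>The functions of rapid decay all of whose moments vanish form a module over the polynomials:
they are closed under sums and under multiplication by a coordinate, which only raises one exponent
in each moment.\<close>

lemma moments_zero_polynomial_mult: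
  fixes g :: "real^'n \<Rightarrow> complex"
  assumes p: "real_polynomial_function p"
    and g: "rapidly_decaying g" "vanishing_moments g"
  shows "rapidly_decaying (\<lambda>x. of_real (p x) * g x) \<and> vanishing_moments (\<lambda>x. of_real (p x) * g x)"
proof -
  define \<M> where "\<M> g \<longleftrightarrow> rapidly_decaying g \<and> vanishing_moments g" for g :: "real^'n \<Rightarrow> complex"
  define monom where "monom \<alpha> x = (of_real (\<Prod>l\<in>UNIV. (x $ l) ^ \<alpha> l) :: complex)"
      for \<alpha> :: "'n \<Rightarrow> nat" and x :: "real^'n"
  have monom_meas [measurable]: "monom \<alpha> \<in> borel_measurable borel" for \<alpha>
    unfolding monom_def[abs_def] by measurable
  have coord: "rapidly_decaying (\<lambda>x. of_real (x $ l) * g x)" if g: "rapidly_decaying g"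
      for g :: "real^'n \<Rightarrow> complex" and l
    unfolding rapidly_decaying_def
  proof
    fix M
    from g have "decaying (M + 1) g" by (simp add: rapidly_decaying_def)
    then obtain C where C: "0 \<le> C" "\<And>x. norm (g x) \<le> C * decay (M + 1) x"
        and [measurable]: "g \<in> borel_measurable borel"
      by (auto elim!: decayingE dest: decaying_measurable)
    have "norm (of_real (x $ l) * g x) \<le> C * decay M x" for x
    proof -
      have "norm (of_real (x $ l) * g x) \<le> (1 + norm x) * (C * decay (M + 1) x)"
        unfolding norm_mult using component_le_norm_cart[of x l] by (intro mult_mono C) auto
      also have "\<dots> = C * decay M x"
        using norm_ge_zero[of x] by (simp add: decay_def add_nonneg_eq_0_iff)
      finally show ?thesis .
    qed
    then show "decaying M (\<lambda>x. of_real (x $ l) * g x)" unfolding decaying_def by auto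
  qed
  have monom_mult: "rapidly_decaying (\<lambda>x. monom \<alpha> x * g x)" if g: "rapidly_decaying g" for g \<alpha>
  proof -
    have "rapidly_decaying (\<lambda>x. of_real (\<Prod>l\<in>L. (x $ l) ^ \<alpha> l) * g x)" if "finite L" for L
      using that
    proof induction
      case (insert l L)
      have "rapidly_decaying (\<lambda>x. of_real ((x $ l) ^ n) * (of_real (\<Prod>l\<in>L. (x $ l) ^ \<alpha> l) * g x))"
          for n
      proof (induction n)
        case (Suc n)
        from coord[OF this, of l] show ?case by (simp add: mult.assoc)
      qed (use insert in simp)
      with insert show ?case by (simp add: mult.assoc)
    qed (use g in simp)
    then show ?thesis unfolding monom_def by simp
  qed
  have \<M>_alt: "\<M> g \<longleftrightarrow> rapidly_decaying g \<and> (\<forall>\<alpha>. (\<integral>x. monom \<alpha> x * g x \<partial>lborel) = 0)" for g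
  proof -
    have "(\<integral>x. monom \<alpha> x * g x \<partial>lebesgue) = (\<integral>x. monom \<alpha> x * g x \<partial>lborel)"
        if "rapidly_decaying g" for \<alpha>
    proof -
      from that have [measurable]: "g \<in> borel_measurable borel"
        by (auto simp: rapidly_decaying_def decaying_def)
      show ?thesis by (rule integral_completion) measurable
    qed
    then show ?thesis by (auto simp: \<M>_def vanishing_moments_def monom_def)
  qed
  have int: "integrable lborel (\<lambda>x. monom \<alpha> x * g x)" if "rapidly_decaying g" for g \<alpha>
    using monom_mult[OF that] by (intro decaying_integrable) (simp add: rapidly_decaying_def)
  have \<M>_add: "\<M> (\<lambda>x. g x + h x)" if "\<M> g" "\<M> h" for g h
    using that int[of g] int[of h] unfolding \<M>_alt
    by (auto simp: rapidly_decaying_def decaying_add distrib_left)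
  have \<M>_scale: "\<M> (\<lambda>x. c * g x)" if "\<M> g" for g c
    using that unfolding \<M>_alt by (auto simp: rapidly_decaying_def decaying_scale
        mult.left_commute[of _ c])
  have \<M>_sum: "\<M> (\<lambda>x. \<Sum>i\<in>I. h i x)" if "finite I" "\<And>i. i \<in> I \<Longrightarrow> \<M> (h i)" for I :: "'n set" and h
    using that
  proof induction
    case empty
    show ?case by (simp add: \<M>_alt rapidly_decaying_def decaying_sum[of "{}", simplified])
  qed (simp add: \<M>_add)
  have \<M>_coord: "\<M> (\<lambda>x. of_real (x $ l) * g x)" if "\<M> g" for g l
  proof -
    have "monom \<alpha> x * (of_real (x $ l) * g x) = monom (\<alpha>(l := Suc (\<alpha> l))) x * g x" for \<alpha> x
    proof -
      have "(\<Prod>k\<in>UNIV. (x $ k) ^ (\<alpha>(l := Suc (\<alpha> l))) k)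
          = (\<Prod>k\<in>UNIV. (x $ k) ^ \<alpha> k * (if k = l then x $ l else 1))"
        by (intro prod.cong) auto
      also have "\<dots> = (\<Prod>k\<in>UNIV. (x $ k) ^ \<alpha> k) * x $ l"
        by (simp add: prod.distrib)
      finally show ?thesis by (simp add: monom_def)
    qed
    then have "(\<integral>x. monom \<alpha> x * (of_real (x $ l) * g x) \<partial>lborel) = 0" for \<alpha>
      using that by (simp only: \<M>_alt)
    then show ?thesis using that by (simp add: \<M>_alt coord)
  qed
  have "\<M> g \<Longrightarrow> \<M> (\<lambda>x. of_real (p x) * g x)" for g
    using p
  proof (induction p arbitrary: g)
    case (linear f)
    have "of_real (f x) * g x = (\<Sum>l\<in>UNIV. of_real (f (axis l 1)) * (of_real (x $ l) * g x))" for x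
    proof -
      have "f x = f (\<Sum>l\<in>UNIV. (x $ l) *\<^sub>R axis l 1)"
        by (simp add: basis_expansion flip: scalar_mult_eq_scaleR)
      also have "\<dots> = (\<Sum>l\<in>UNIV. (x $ l) * f (axis l 1))"
        using linear(1) by (simp add: bounded_linear.linear linear_sum linear_scale)
      finally show ?thesis by (simp add: sum_distrib_right mult.assoc mult.left_commute)
    qed
    moreover have "\<M> (\<lambda>x. \<Sum>l\<in>UNIV. of_real (f (axis l 1)) * (of_real (x $ l) * g x))"
      by (intro \<M>_sum \<M>_scale \<M>_coord linear) simp
    ultimately show ?case by simp
  next
    case (const c)
    then show ?case by (simp add: \<M>_scale)
  next
    case (add f1 f2)
    then show ?case using \<M>_add[OF add.IH(1) add.IH(2)] by (simp add: distrib_right)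
  next
    case (mult f1 f2)
    then show ?case using mult.IH(1)[OF mult.IH(2)] by (simp add: mult.assoc)
  qed
  with g show ?thesis by (simp add: \<M>_def)
qed

lemma integral_polynomial_eq_0:
  fixes g :: "real^'n \<Rightarrow> complex"
  assumes p: "real_polynomial_function p" and g: "rapidly_decaying g" "vanishing_moments g"
  shows "(\<integral>x. of_real (p x) * g x \<partial>lborel) = 0" "integrable lborel (\<lambda>x. of_real (p x) * g x)"
proof -
  note * = moments_zero_polynomial_mult[OF p g]
  then have dec: "decaying (DIM(real^'n) + 2) (\<lambda>x. of_real (p x) * g x)"
      by (simp add: rapidly_decaying_def)
  then show "integrable lborel (\<lambda>x. of_real (p x) * g x)" by (rule decaying_integrable)
  from * have "(\<integral>x. of_real (\<Prod>l\<in>UNIV. (x $ l) ^ (\<lambda>_. 0) l) * (of_real (p x) * g x) \<partial>lebesgue) = 0"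
    unfolding vanishing_moments_def by (elim conjE allE[of _ "\<lambda>_. 0"])
  then have "(\<integral>x. of_real (p x) * g x \<partial>lebesgue) = 0" by simp
  then show "(\<integral>x. of_real (p x) * g x \<partial>lborel) = 0"
    using decaying_measurable[OF dec] by (subst (asm) integral_completion) auto
qed

text \<open>The function \<open>b \<mapsto> bump_profile N (a - b)\<close> is compared with a polynomial that depends on
whether \<open>a\<close> lies in the unit ball. The two differ only if exactly one of \<open>a\<close> and \<open>a - b\<close> lies in
the ball; then the distance of \<open>a - b\<close> to the unit sphere is at most \<open>norm b\<close>.\<close>

lemma bump_profile_polynomial_error:
  fixes a b :: "'a::euclidean_space"
  assumes N: "0 < N"
  shows "norm a \<le> 1 \<Longrightarrow> \<bar>bump_profile N (a - b) - (1 - (norm (a - b))\<^sup>2) ^ N\<bar>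
      \<le> (norm b * (2 + norm b)) ^ N"
    and "1 < norm a \<Longrightarrow> bump_profile N (a - b) \<le> (norm b * (2 + norm b)) ^ N"
proof -
  define s where "s = norm (a - b)"
  have s0: "0 \<le> s" by (simp add: s_def)
  have fac: "1 - s\<^sup>2 = (1 - s) * (1 + s)" by (simp add: power2_eq_square algebra_simps)
  have nonneg: "0 \<le> (norm b * (2 + norm b)) ^ N" by simp
  {
    assume a: "norm a \<le> 1"
    show "\<bar>bump_profile N (a - b) - (1 - (norm (a - b))\<^sup>2) ^ N\<bar> \<le> (norm b * (2 + norm b)) ^ N"
    proof (cases "s \<le> 1")
      case True
      then have "0 \<le> 1 - s\<^sup>2" unfolding fac using s0 by simp
      then show ?thesis using nonneg by (simp add: bump_profile_def s_def[symmetric] max_def)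
    next
      case False
      then have b0: "bump_profile N (a - b) = 0" using bump_profile_outside[OF N, of "a - b"]
          by (simp add: s_def)
      have s: "s \<le> 1 + norm b" using norm_triangle_ineq4[of a b] a by (simp add: s_def)
      have "\<bar>1 - s\<^sup>2\<bar> = (s - 1) * (1 + s)" unfolding fac abs_mult using False s0 by simp
      also have "\<dots> \<le> norm b * (2 + norm b)" using s s0 False by (intro mult_mono) auto
      finally have "\<bar>1 - s\<^sup>2\<bar> ^ N \<le> (norm b * (2 + norm b)) ^ N" by (rule power_mono) simp
      then show ?thesis by (simp add: b0 power_abs s_def)
    qed
  next
    assume a: "1 < norm a"
    show "bump_profile N (a - b) \<le> (norm b * (2 + norm b)) ^ N"
    proof (cases "s < 1")
      case True
      have "norm a \<le> s + norm b" using norm_triangle_ineq[of "a - b" b] by (simp add: s_def)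
      then have s: "1 - s \<le> norm b" using a by simp
      have pos: "0 \<le> 1 - s\<^sup>2" unfolding fac using True s0 by simp
      have "1 - s\<^sup>2 \<le> norm b * (2 + norm b)"
        unfolding fac using s True s0 by (intro mult_mono) auto
      then have "(1 - s\<^sup>2) ^ N \<le> (norm b * (2 + norm b)) ^ N" using pos by (rule power_mono)
      then show ?thesis using pos by (simp add: bump_profile_def s_def[symmetric])
    qed (use nonneg bump_profile_outside[OF N, of "a - b"] in \<open>simp add: s_def\<close>)
  }
qed

lemma integral_affine:
  fixes g :: "'a::euclidean_space \<Rightarrow> complex"
  assumes [measurable]: "g \<in> borel_measurable borel" and r: "0 < r"
  shows "(\<integral>z. g z \<partial>lborel) = r ^ DIM('a) *\<^sub>R (\<integral>h. g (y - r *\<^sub>R h) \<partial>lborel)"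
proof -
  have "(\<integral>z. g z \<partial>lborel) = (\<integral>z. g z \<partial>density (distr lborel borel (\<lambda>h. y
      + (- r) *\<^sub>R h)) (\<lambda>_. ennreal (\<bar>- r\<bar> ^ DIM('a))))"
    using r by (subst lborel_affine[of "- r" y]) auto
  also have "\<dots> = r ^ DIM('a) *\<^sub>R (\<integral>h. g (y - r *\<^sub>R h) \<partial>lborel)"
    using r by (subst integral_density) (auto simp: integral_distr)
  finally show ?thesis .
qed

text \<open>Averaging at a scale \<open>r\<close> bounded from below turns the decay of \<open>\<Psi>\<close> in \<open>y\<close> into decay in
\<open>r + norm y\<close>. For \<open>norm y \<ge> 2 * r\<close> only values of \<open>\<Psi>\<close> at distance at least \<open>norm y / 2\<close> from
the origin enter. For all \<open>y\<close>, the bump may be replaced by its error of approximation by a polynomial, because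
\<open>\<Psi>\<close> is orthogonal to polynomials; this error is of order \<open>r\<^sup>-\<^sup>N\<close>.\<close>

lemma avg_decay:
  fixes \<Psi> :: "real^'n \<Rightarrow> complex"
  assumes N: "0 < N" and \<kappa>: "0 < \<kappa>"
    and \<Psi>: "rapidly_decaying \<Psi>" "vanishing_moments \<Psi>"
  shows "\<exists>C\<ge>0. \<forall>r\<ge>\<kappa>. \<forall>y. norm (avg N r \<Psi> y) \<le> C * inverse (r + norm y) ^ N"
proof -
  let ?d = "CARD('n)"
  have [measurable]: "\<Psi> \<in> borel_measurable borel" using \<Psi>(1)
      by (auto simp: rapidly_decaying_def decaying_def)
  define M where "M = DIM(real^'n) + 2"
  have dec: "decaying n \<Psi>" for n using \<Psi>(1) by (simp add: rapidly_decaying_def)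
  obtain C1 where C1: "0 \<le> C1" "\<And>x. norm (\<Psi> x) \<le> C1 * decay N x" using dec[of N]
      by (rule decayingE) blast
  obtain C2 where C2: "0 \<le> C2" "\<And>x. norm (\<Psi> x) \<le> C2 * decay (2 * N + M) x"
      using dec[of "2 * N + M"] by (rule decayingE) blast
  define c where "c = (\<integral>h. bump_profile N (h::real^'n) \<partial>lborel)"
  have c: "0 < c" unfolding c_def by (rule bump_profile_integral_pos[OF N])
  define I where "I = (\<integral>x. decay M (x::real^'n) \<partial>lborel)"
  have I: "0 \<le> I" unfolding I_def by (intro integral_nonneg_AE) auto
  have Iint: "integrable lborel (decay M :: real^'n \<Rightarrow> real)" unfolding M_def
      by (rule decay_integrable)
  define A where "A = (2 + 1 / \<kappa>) ^ N * C2 * I"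
  have A: "0 \<le> A" using \<kappa> C2 I by (simp add: A_def)
  let ?c = "(2 + 1/\<kappa>) ^ N"
  have sup_bound: "norm (avg N r \<Psi> y) \<le> (inverse \<kappa> ^ ?d * inverse c * A) * inverse r ^ N"
      if r: "\<kappa> \<le> r" for r y
  proof -
    have r0: "0 < r" using r \<kappa> by simp
    define B where "B z = bump_profile N ((1/r) *\<^sub>R (y - z))" for z
    have Bm [measurable]: "B \<in> borel_measurable borel" unfolding B_def[abs_def] by measurable
    \<comment> \<open>The polynomial that approximates the bump seen from \<open>z = 0\<close>.\<close>
    define P where "P z = (if norm y \<le> r then (1 - (norm ((1/r) *\<^sub>R (y - z)))\<^sup>2) ^ N else 0)" for z
    have P: "real_polynomial_function P"
    proof -
      have eq: "(norm ((1/r) *\<^sub>R (y - z)))\<^sup>2 = (1/r)\<^sup>2 * (\<Sum>l\<in>UNIV. (y $ l - z $ l)\<^sup>2)" for z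
        by (simp add: power_mult_distrib power_divide norm_vec_def L2_set_def sum_nonneg
            sum_divide_distrib)
      have lin: "real_polynomial_function (\<lambda>z::real^'n. z $ l)" for l
        by (rule real_polynomial_function.intros(1)) (rule bounded_linear_vec_nth)
      show ?thesis
      proof (cases "norm y \<le> r")
        case True
        have "real_polynomial_function (\<lambda>z. (1 - (1/r)\<^sup>2 * (\<Sum>l\<in>UNIV. (y $ l - z $ l)\<^sup>2)) ^ N)"
          by (intro real_polynomial_function_power real_polynomial_function_diff
              real_polynomial_function.intros(2)
              real_polynomial_function.intros(4) real_polynomial_function_sum lin) auto
        then show ?thesis using True by (simp only: P_def[abs_def] eq if_True)
      qed (simp add: P_def[abs_def] real_polynomial_function.intros(2))
    qed
    note zero = integral_polynomial_eq_0[OF P \<Psi>]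
    have err: "\<bar>B z - P z\<bar> \<le> inverse r ^ N * (?c * (1 + norm z) ^ (2 * N))" for z
    proof -
      define a b where "a = (1/r) *\<^sub>R y" and "b = (1/r) *\<^sub>R z"
      have ab: "(1/r) *\<^sub>R (y - z) = a - b" by (simp add: a_def b_def algebra_simps)
      have na: "norm a \<le> 1 \<longleftrightarrow> norm y \<le> r" using r0 by (simp add: a_def)
      have "\<bar>B z - P z\<bar> \<le> (norm b * (2 + norm b)) ^ N"
        using bump_profile_polynomial_error[OF N, of a b] na bump_profile_nonneg[of N "a - b"]
        by (cases "norm y \<le> r") (auto simp: B_def P_def ab simp del: not_le)
      also have "\<dots> \<le> (inverse r * ((2 + 1/\<kappa>) * (1 + norm z)\<^sup>2)) ^ N"
      proof (intro power_mono)
        have nb: "norm b = inverse r * norm z" using r0 by (simp add: b_def divide_inverse)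
        have "norm b \<le> 1/\<kappa> * norm z"
          unfolding nb using r \<kappa> by (intro mult_right_mono) (auto simp: field_simps)
        then have "norm z * (2 + norm b) \<le> (1 + norm z) * ((2 + 1/\<kappa>) * (1 + norm z))"
          using \<kappa> by (intro mult_mono) (auto simp: algebra_simps intro: order_trans)
        also have "\<dots> = (2 + 1/\<kappa>) * (1 + norm z)\<^sup>2" by (simp add: power2_eq_square)
        finally show "norm b * (2 + norm b) \<le> inverse r * ((2 + 1/\<kappa>) * (1 + norm z)\<^sup>2)"
          using r0 by (subst nb) (simp add: mult.assoc mult_left_mono)
      qed auto
      finally show ?thesis by (simp add: power_mult_distrib power_mult)
    qed
    have err\<Psi>: "norm (of_real (B z - P z) * \<Psi> z) \<le> (inverse r ^ N * (?c * C2)) * decay M z" for z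
    proof -
      have "norm (of_real (B z - P z) * \<Psi> z)
          \<le> (inverse r ^ N * (?c * (1 + norm z) ^ (2 * N))) * (C2 * decay (2 * N + M) z)"
        unfolding norm_mult norm_of_real by (intro mult_mono err C2) (use r0 \<kappa> in auto)
      also have "(1 + norm z) ^ (2 * N) * decay (2 * N + M) z = decay M z"
      proof -
        have "1 + norm z \<noteq> 0" using norm_ge_zero[of z] by linarith
        then show ?thesis by (simp add: decay_def power_add flip: power_mult_distrib)
      qed
      then have "(inverse r ^ N * (?c * (1 + norm z) ^ (2 * N))) * (C2 * decay (2 * N + M) z)
          = (inverse r ^ N * (?c * C2)) * decay M z"
        by (metis (no_types, opaque_lifting) mult.assoc mult.left_commute)
      finally show ?thesis .
    qed
    have int\<Psi>: "integrable lborel \<Psi>" using dec by (intro decaying_integrable)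
    have intB: "integrable lborel (\<lambda>z. of_real (B z) * \<Psi> z)"
      using int\<Psi>
    proof (rule Bochner_Integration.integrable_bound)
      show "AE z in lborel. norm (of_real (B z) * \<Psi> z) \<le> norm (\<Psi> z)"
        by (intro always_eventually allI)
          (simp add: norm_mult B_def bump_profile_nonneg bump_profile_le_1 mult_left_le_one_le)
    qed measurable
    have "(\<integral>z. of_real (B z) * \<Psi> z \<partial>lborel)
        = (\<integral>z. of_real (B z) * \<Psi> z \<partial>lborel) - (\<integral>z. of_real (P z) * \<Psi> z \<partial>lborel)"
      by (simp add: zero)
    also have "\<dots> = (\<integral>z. of_real (B z) * \<Psi> z - of_real (P z) * \<Psi> z \<partial>lborel)"
      by (intro Bochner_Integration.integral_diff[symmetric] intB zero)
    also have "\<dots> = (\<integral>z. of_real (B z - P z) * \<Psi> z \<partial>lborel)" by (simp add: left_diff_distrib)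
    also have "norm \<dots> \<le> (\<integral>z. norm (of_real (B z - P z) * \<Psi> z) \<partial>lborel)"
        by (rule integral_norm_bound)
    also have "\<dots> \<le> (\<integral>z. (inverse r ^ N * (?c * C2)) * decay M (z::real^'n) \<partial>lborel)"
    proof (rule Bochner_Integration.integral_mono)
      show "integrable lborel (\<lambda>z. norm (of_real (B z - P z) * \<Psi> z))"
        using Bochner_Integration.integrable_diff[OF intB zero(2)]
        by (intro integrable_norm) (simp add: left_diff_distrib)
    qed (intro integrable_mult_right Iint, rule err\<Psi>)
    also have "\<dots> = A * inverse r ^ N" by (simp add: A_def I_def)
    finally have J: "norm (\<integral>z. of_real (B z) * \<Psi> z \<partial>lborel) \<le> A * inverse r ^ N" .
    have "(\<integral>z. of_real (B z) * \<Psi> z \<partial>lborel)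
        = r ^ ?d *\<^sub>R (\<integral>h. of_real (B (y - r *\<^sub>R h)) * \<Psi> (y - r *\<^sub>R h) \<partial>lborel)"
      using integral_affine[of "\<lambda>z. of_real (B z) * \<Psi> z" r y] r0 by simp
    also have "(\<integral>h. of_real (B (y - r *\<^sub>R h)) * \<Psi> (y - r *\<^sub>R h) \<partial>lborel) = c *\<^sub>R avg N r \<Psi> y"
    proof -
      have "of_real (B (y - r *\<^sub>R h)) * \<Psi> (y - r *\<^sub>R h) = c *\<^sub>R (bump N h *\<^sub>R \<Psi> (y - r *\<^sub>R h))" for h
      proof -
        have "B (y - r *\<^sub>R h) = c * bump N h"
          using c r0 by (simp add: B_def bump_def c_def[symmetric])
        then show ?thesis by (simp add: scaleR_conv_of_real[where 'a = complex] mult.assoc)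
      qed
      then show ?thesis by (simp only: avg_def integral_scaleR_right)
    qed
    finally have "norm (\<integral>z. of_real (B z) * \<Psi> z \<partial>lborel) = r ^ ?d * (c * norm (avg N r \<Psi> y))"
      using r0 c by simp
    with J have "r ^ ?d * (c * norm (avg N r \<Psi> y)) \<le> A * inverse r ^ N" by simp
    then have "norm (avg N r \<Psi> y) \<le> inverse r ^ ?d * inverse c * (A * inverse r ^ N)"
      using r0 c by (simp add: field_simps)
    also have "\<dots> \<le> inverse \<kappa> ^ ?d * inverse c * (A * inverse r ^ N)"
      using r \<kappa> c A r0 by (intro mult_right_mono power_mono le_imp_inverse_le) auto
    finally show ?thesis by (simp add: mult.assoc)
  qed
  define D where "D = inverse \<kappa> ^ ?d * inverse c * A"
  have D: "0 \<le> D" using \<kappa> c A by (simp add: D_def)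
  let ?E = "\<lambda>r y. (3 * inverse (r + norm y)) ^ N"
  have "norm (avg N r \<Psi> y) \<le> (3 ^ N * (C1 + D)) * inverse (r + norm y) ^ N" if r: "\<kappa> \<le> r" for r y
  proof (cases "2 * r \<le> norm y")
    case False
    have r0: "0 < r" using r \<kappa> by simp
    have "inverse r \<le> 3 * inverse (r + norm y)"
      using False r0 by (simp add: field_simps add_pos_nonneg)
    then have "inverse r ^ N \<le> ?E r y" using r0 by (intro power_mono) auto
    then have "D * inverse r ^ N \<le> (C1 + D) * ?E r y"
      using D C1 r0 by (intro mult_mono) auto
    with sup_bound[OF r, of y] have "norm (avg N r \<Psi> y) \<le> (C1 + D) * ?E r y"
      unfolding D_def[symmetric] by (rule order_trans)
    then show ?thesis by (simp add: power_mult_distrib mult.assoc mult.left_commute)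
  next
    case True
    have r0: "0 < r" using r \<kappa> by simp
    have pw: "norm (bump N h *\<^sub>R \<Psi> (y - r *\<^sub>R h)) \<le> bump N h * (C1 * ?E r y)" for h
    proof (cases "norm h < 1")
      case True
      have "norm y \<le> norm (y - r *\<^sub>R h) + norm (r *\<^sub>R h)" using norm_triangle_ineq[of "y - r *\<^sub>R h"
          "r *\<^sub>R h"] by simp
      also have "\<dots> \<le> norm (y - r *\<^sub>R h) + r" using True r0 by (simp add: mult_left_le)
      finally have y: "norm y \<le> norm (y - r *\<^sub>R h) + r" .
      have "s + t \<le> 3 * (1 + a)" if "t \<le> a + s" "2 * s \<le> t" for s t a :: real
        using that by argo
      from this[OF y \<open>2 * r \<le> norm y\<close>]
      have "r + norm y \<le> 3 * (1 + norm (y - r *\<^sub>R h))" .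
      then have "inverse (1 + norm (y - r *\<^sub>R h)) \<le> 3 * inverse (r + norm y)"
        using r0 by (simp add: field_simps add_pos_nonneg)
      then have "decay N (y - r *\<^sub>R h) \<le> ?E r y"
        unfolding decay_def by (intro power_mono) auto
      then have "norm (\<Psi> (y - r *\<^sub>R h)) \<le> C1 * ?E r y"
        using C1(2)[of "y - r *\<^sub>R h"] mult_left_mono[OF _ C1(1)] order_trans by blast
      then show ?thesis by (simp add: mult_left_mono)
    qed (simp add: bump_outside[OF N])
    have "norm (avg N r \<Psi> y) \<le> (\<integral>h. norm (bump N h *\<^sub>R \<Psi> (y - r *\<^sub>R h)) \<partial>lborel)"
      unfolding avg_def by (rule integral_norm_bound)
    also have "\<dots> \<le> (\<integral>h. bump N (h::real^'n) * (C1 * ?E r y) \<partial>lborel)"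
      using pw by (intro Bochner_Integration.integral_mono integrable_norm
          integrable_bump_translate[OF N dec]
          integrable_mult_left bump_integrable N)
    also have "\<dots> = C1 * ?E r y" by (simp add: bump_integral[OF N])
    also have "\<dots> \<le> (C1 + D) * ?E r y"
      using D r0 by (intro mult_right_mono zero_le_power) auto
    finally show ?thesis by (simp add: power_mult_distrib mult.assoc mult.left_commute)
  qed
  then show ?thesis using C1 D by (intro exI[of _ "3 ^ N * (C1 + D)"]) auto
qed

lemma smooth_decay:
  fixes \<Psi> :: "real^'n \<Rightarrow> complex"
  assumes N: "0 < N" and \<kappa>: "0 < \<kappa>"
    and \<Psi>: "rapidly_decaying \<Psi>" "vanishing_moments \<Psi>"
  shows "\<exists>C\<ge>0. \<forall>S\<ge>\<kappa>. \<forall>y. norm (smooth N m S \<Psi> y) \<le> C * inverse (S + norm y) ^ N"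
proof -
  obtain C where C: "0 \<le> C" "\<And>r y. \<kappa> \<le> r \<Longrightarrow> norm (avg N r \<Psi> y) \<le> C * inverse (r + norm y) ^ N"
    using avg_decay[OF N \<kappa> \<Psi>] by auto
  have "norm (smooth N m S \<Psi> y) \<le> (\<Sum>i=1..m. real (m choose i) * C) * inverse (S + norm y) ^ N"
    if S: "\<kappa> \<le> S" for S y
  proof -
    have S0: "0 < S" using S \<kappa> by simp
    have "norm (smooth N m S \<Psi> y) \<le> (\<Sum>i=1..m. norm (((-1) ^ Suc i * of_nat (m choose i))
        * avg N (real i * S) \<Psi> y))"
      unfolding smooth_def by (rule norm_sum)
    also have "\<dots> \<le> (\<Sum>i=1..m. real (m choose i) * (C * inverse (S + norm y) ^ N))"
    proof (intro sum_mono)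
      fix i assume "i \<in> {1..m}"
      then have i: "S \<le> real i * S" using S0 by simp
      have "norm (avg N (real i * S) \<Psi> y) \<le> C * inverse (real i * S + norm y) ^ N"
        using i S by (intro C) simp
      also have "\<dots> \<le> C * inverse (S + norm y) ^ N"
        using i S0 C by (intro mult_left_mono power_mono le_imp_inverse_le add_right_mono)
            (auto intro: add_pos_nonneg)
      finally show "norm (((-1) ^ Suc i * of_nat (m choose i)) * avg N (real i * S) \<Psi> y)
          \<le> real (m choose i) * (C * inverse (S + norm y) ^ N)"
        by (simp add: norm_mult norm_power mult_left_mono)
    qed
    also have "\<dots> = (\<Sum>i=1..m. real (m choose i) * C) * inverse (S + norm y) ^ N"
      by (simp add: sum_distrib_right mult.assoc)
    finally show ?thesis .
  qed
  then show ?thesis using C by (intro exI[of _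
      "\<Sum>i=1..m. real (m choose i) * C"]) (auto intro: sum_nonneg)
qed

text \<open>Smoothing a dilated wavelet at scale \<open>S\<close> is dilating the wavelet smoothed at scale \<open>c * S\<close>.
Hence constants for the finitely many mother wavelets serve for the whole family.\<close>

lemma smooth_dilate:
  "smooth N m S (\<lambda>x. \<Psi> (c *\<^sub>R x - v)) x = smooth N m (c * S) \<Psi> (c *\<^sub>R x - v)"
proof -
  have "\<Psi> (c *\<^sub>R (x - r *\<^sub>R h) - v) = \<Psi> ((c *\<^sub>R x - v) - (c * r) *\<^sub>R h)" for r h
    by (rule arg_cong[where f = \<Psi>]) (simp add: algebra_simps)
  then have "avg N r (\<lambda>x. \<Psi> (c *\<^sub>R x - v)) x = avg N (c * r) \<Psi> (c *\<^sub>R x - v)" for r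
    by (simp only: avg_def)
  then show ?thesis by (simp add: smooth_def mult.left_commute)
qed

section \<open>Pairings localised to dyadic shells\<close>

lemma Lp_norm_mono_set:
  fixes G :: "'a::euclidean_space \<Rightarrow> complex"
  assumes p: "1 \<le> p" and E [measurable]: "E \<in> sets lebesgue" "E' \<in> sets lebesgue" and sub: "E \<subseteq> E'"
    and G: "G \<in> borel_measurable lebesgue"
  shows "Lp_norm p (lebesgue_on E) G \<le> Lp_norm p (lebesgue_on E') G"
proof (cases "p = \<infinity>")
  case True
  have "AE x in lebesgue_on E'. ennreal (norm (G x))
      \<le> esssup (lebesgue_on E') (\<lambda>x. ennreal (norm (G x)))"
    by (rule esssup_AE)
  then have "AE x in lebesgue. x \<in> E' \<longrightarrow> ennreal (norm (G x))
      \<le> esssup (lebesgue_on E') (\<lambda>x. ennreal (norm (G x)))"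
    by (subst (asm) AE_restrict_space_iff) auto
  then have "AE x in lebesgue_on E. ennreal (norm (G x))
      \<le> esssup (lebesgue_on E') (\<lambda>x. ennreal (norm (G x)))"
    using sub by (subst AE_restrict_space_iff) (auto elim!: eventually_mono)
  then show ?thesis
    using True G by (auto simp: Lp_norm_def intro!: esssup_I measurable_restrict_space1)
next
  case False
  note r = enn2real_exponent[OF p False]
  have "(\<integral>\<^sup>+ x. ennreal (norm (G x) powr enn2real p) \<partial>lebesgue_on E)
      \<le> (\<integral>\<^sup>+ x. ennreal (norm (G x) powr enn2real p) \<partial>lebesgue_on E')"
    using sub by (auto simp: nn_integral_restrict_space indicator_def intro!: nn_integral_mono)
  then show ?thesis using False r by (simp add: Lp_norm_def epowr_mono)
qed

text \<open>Balls are convex, so it suffices that the endpoints of the segment belong to the ball.\<close>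

lemma diff_ball_eq:
  "diff_ball m h x0 r = ball x0 r \<inter> ball (x0 - real m *\<^sub>R h) r"
proof -
  have "closed_segment x (x + real m *\<^sub>R h) \<subseteq> ball x0 r
      \<longleftrightarrow> x \<in> ball x0 r \<and> x + real m *\<^sub>R h \<in> ball x0 r" for x
    using closed_segment_subset[of x "ball x0 r" "x + real m *\<^sub>R h"] by (auto simp: convex_ball)
  moreover have "x + real m *\<^sub>R h \<in> ball x0 r \<longleftrightarrow> x \<in> ball (x0 - real m *\<^sub>R h) r" for x
    by (simp add: dist_norm algebra_simps)
  ultimately show ?thesis by (auto simp: diff_ball_def)
qed

lemma diff_ball_lebesgue [measurable]: "diff_ball m h x0 r \<in> sets lebesgue"
  unfolding diff_ball_eq by (intro sets_completionI_sets) auto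

lemma half_ball_subset_diff_ball:
  assumes "real m * norm h \<le> r / 2"
  shows "ball x0 (r / 2) \<subseteq> diff_ball m h x0 r"
proof
  fix x assume x: "x \<in> ball x0 (r / 2)"
  have "dist (x0 - real m *\<^sub>R h) x \<le> dist x0 x + norm (real m *\<^sub>R h)"
    using norm_triangle_ineq4[of "x0 - x" "real m *\<^sub>R h"] by (simp add: dist_norm algebra_simps)
  also have "norm (real m *\<^sub>R h) \<le> r / 2" using assms by simp
  finally have "dist (x0 - real m *\<^sub>R h) x < r" using x by simp
  moreover have "dist x0 x < r" using x zero_le_dist[of x0 x] unfolding mem_ball by linarith
  ultimately show "x \<in> diff_ball m h x0 r" by (simp add: diff_ball_eq)
qed

text \<open>On the shell where \<open>norm (x - x0)\<close> is of order \<open>2\<^bsup>i-j\<^esup>\<close> the weight is of order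
\<open>2\<^sup>-\<^sup>i\<^sup>n\<close>; the indicators of balls instead of shells make the right-hand side larger and are what
the estimates of differences refer to. The last term covers the complement of the ball of radius
\<open>1/2\<close>.\<close>

lemma inverse_weight_le_shells:
  fixes x x0 :: "'a::euclidean_space"
  assumes l: "l \<le> j"
  shows "inverse (2 ^ l + 2 ^ j * norm (x - x0)) ^ n \<le>
    4 ^ n * ((\<Sum>i=l..j. (1/2) ^ (i * n) * indicator (ball x0 (2 ^ i / 2 ^ j / 2)) x)
        + (1/2) ^ (j * n))"
proof -
  define D where "D = 2 ^ j * norm (x - x0)"
  have D0: "0 \<le> D" by (simp add: D_def)
  define T where "T i = (1/2::real) ^ (i * n) * indicator (ball x0 (2 ^ i / 2 ^ j / 2)) x"
      for i :: nat
  have T0: "0 \<le> T i" for i by (simp add: T_def)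
  have T: "T i = (1/2::real) ^ (i * n)" if "2 * D < 2 ^ i" for i
    using that by (simp add: T_def D_def dist_norm norm_minus_commute field_simps)
  have key: "inverse (2 ^ l + D) ^ n \<le> 4 ^ n * (1/2) ^ (i * n)" if "2 ^ i \<le> 4 * (2 ^ l + D)" for i
  proof -
    have "inverse (2 ^ l + D) \<le> 4 * (1/2) ^ i"
    proof -
      have "inverse (2 ^ l + D) \<le> inverse (2 ^ i / 4)"
        using that by (intro le_imp_inverse_le) auto
      then show ?thesis by (simp add: power_one_over)
    qed
    then have "inverse (2 ^ l + D) ^ n \<le> (4 * (1/2) ^ i) ^ n"
      using D0 by (intro power_mono) auto
    then show ?thesis by (simp add: power_mult_distrib power_mult)
  qed
  have "inverse (2 ^ l + D) ^ n \<le> 4 ^ n * ((\<Sum>i=l..j. T i) + (1/2) ^ (j * n))"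
  proof (cases "2 * D < 2 ^ j")
    case False
    then have "inverse (2 ^ l + D) ^ n \<le> 4 ^ n * (1/2) ^ (j * n)"
      using D0 by (intro key) (simp add: algebra_simps add_nonneg_nonneg, smt (verit) zero_le_power)
    also have "\<dots> \<le> 4 ^ n * ((\<Sum>i=l..j. T i) + (1/2) ^ (j * n))"
      by (intro mult_left_mono) (auto intro!: sum_nonneg T0)
    finally show ?thesis .
  next
    case True
    \<comment> \<open>The innermost ball that contains \<open>x\<close>.\<close>
    define i where "i = (LEAST i. l \<le> i \<and> 2 * D < 2 ^ i)"
    have i: "l \<le> i \<and> 2 * D < 2 ^ i" unfolding i_def by (rule LeastI[of _ j]) (use True l in auto)
    have ij: "i \<le> j" unfolding i_def by (rule Least_le) (use True l in auto)
    have "2 ^ i \<le> 4 * (2 ^ l + D)"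
    proof (cases "i = l")
      case False
      then obtain i' where i': "i = Suc i'" "l \<le> i'" using i by (cases i) auto
      have "\<not> (l \<le> i' \<and> 2 * D < 2 ^ i')"
        using not_less_Least[of i' "\<lambda>i. l \<le> i \<and> 2 * D < 2 ^ i"] i' by (simp add: i_def[symmetric])
      then have "2 ^ i' \<le> 2 * D" using i' by simp
      then show ?thesis by (simp add: i' add_increasing)
    qed (use D0 in simp)
    then have "inverse (2 ^ l + D) ^ n \<le> 4 ^ n * T i" using key T i by simp
    also have "T i \<le> (\<Sum>i=l..j. T i) + (1/2) ^ (j * n)"
      using i ij T0 by (intro add_increasing2 member_le_sum) auto
    finally show ?thesis by (simp add: mult_left_mono)
  qed
  then show ?thesis by (simp add: D_def T_def)
qed

text \<open>The supremum in the definition of \<open>T_space\<close>, with the order of the difference as a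
parameter.\<close>

definition diff_modulus :: "nat \<Rightarrow> ennreal \<Rightarrow> real^'n \<Rightarrow> (real^'n \<Rightarrow> complex) \<Rightarrow> nat \<Rightarrow> ennreal" where
  "diff_modulus m p x0 f n = (SUP h\<in>cball 0 (1 / 2 ^ n).
     Lp_norm p (lebesgue_on (diff_ball m h x0 (1 / 2 ^ n))) (fin_diff m h f))"

lemma borel_imp_lebesgue_measurable: "f \<in> borel_measurable borel \<Longrightarrow> f \<in> borel_measurable lebesgue"
  by (simp add: measurable_completion)

lemma Lp_norm_half_ball_le_diff_modulus:
  fixes f :: "real^'n \<Rightarrow> complex"
  assumes p: "1 \<le> p" and f: "f \<in> borel_measurable borel" and i: "i \<le> j"
    and h: "norm h \<le> 2 ^ i / 2 ^ j" "real m * norm h \<le> 2 ^ i / 2 ^ j / 2"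
  shows "Lp_norm p (lebesgue_on (ball x0 (2 ^ i / 2 ^ j / 2))) (fin_diff m h f)
      \<le> diff_modulus m p x0 f (j - i)"
proof -
  note [measurable] = f
  have eq: "1 / 2 ^ (j - i) = (2 ^ i / 2 ^ j :: real)"
    using i by (simp add: power_diff field_simps)
  have "Lp_norm p (lebesgue_on (ball x0 (2 ^ i / 2 ^ j / 2))) (fin_diff m h f)
      \<le> Lp_norm p (lebesgue_on (diff_ball m h x0 (2 ^ i / 2 ^ j))) (fin_diff m h f)"
    by (intro Lp_norm_mono_set p half_ball_subset_diff_ball h diff_ball_lebesgue
        borel_imp_lebesgue_measurable) auto
  also have "\<dots> \<le> diff_modulus m p x0 f (j - i)"
    unfolding diff_modulus_def eq using h by (intro SUP_upper) auto
  finally show ?thesis .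
qed

text \<open>Far from \<open>x0\<close> a difference is as good as the sum of the translates of \<open>f\<close> that occur in it;
their translations are passed to the kernels, where the Schur test is indifferent to them.\<close>

lemma lp_norm_fin_diff_far_le:
  fixes f :: "real^'n \<Rightarrow> complex"
  assumes C: "schur_bound TYPE('n) C" and p: "1 \<le> p" and c: "1 \<le> c"
      and f: "f \<in> borel_measurable borel"
    and I: "I \<subseteq> (wavelet_types :: (int^'n) set) \<times> UNIV"
  shows "lp_norm p I (\<lambda>(i, k). \<integral>\<^sup>+ x. ennreal (norm (fin_diff m h f x)) *
        ennreal (c ^ CARD('n) * decay (CARD('n) + 2) (c *\<^sub>R x - real_vec k)) \<partial>lborel)
     \<le> ennreal (2 ^ m * C * c powr (real CARD('n) * recip p)) * Lp_norm p lebesgue f"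
proof -
  note [measurable] = f
  let ?b = "\<lambda>q. ennreal (real (m choose q))"
  let ?f = "\<lambda>q x. ennreal (norm (f (x + real q *\<^sub>R h)))"
  define \<kappa> where "\<kappa> k x = ennreal (c ^ CARD('n) * decay (CARD('n) + 2) (c *\<^sub>R x - real_vec k))"
      for k and x :: "real^'n"
  have [measurable]: "\<kappa> k \<in> borel_measurable borel" for k unfolding \<kappa>_def[abs_def] by measurable
  define R where "R = ennreal (C * c powr (real CARD('n) * recip p)) * Lp_norm p lebesgue f"
  have C0: "0 < C" using C by (simp add: schur_bound_def)
  have one: "lp_norm p I (\<lambda>(i, k). \<integral>\<^sup>+ x. ennreal (norm (f x)) * \<kappa> k (x - v) \<partial>lborel) \<le> R" for v
    using schur_boundD[OF C p c _ _ I, of UNIV f v] f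
    by (simp add: \<kappa>_def R_def lebesgue_on_UNIV_eq measurable_completion)
  have "lp_norm p I (\<lambda>(i, k). \<integral>\<^sup>+ x. ennreal (norm (fin_diff m h f x)) * \<kappa> k x \<partial>lborel)
     \<le> lp_norm p I (\<lambda>ik. \<Sum>q\<le>m. ?b q * (\<lambda>(i, k). \<integral>\<^sup>+ x. ennreal (norm (f x))
         * \<kappa> k (x - real q *\<^sub>R h) \<partial>lborel) ik)"
  proof (intro lp_norm_mono p order_refl, unfold split_paired_all prod.case)
    fix i k
    have tr: "(\<integral>\<^sup>+ x. ennreal (norm (f (x + v))) * \<kappa> k x \<partial>lborel)
        = (\<integral>\<^sup>+ x. ennreal (norm (f x)) * \<kappa> k (x - v) \<partial>lborel)" for v
      using nn_integral_translate[of "\<lambda>x. ennreal (norm (f x)) * \<kappa> k (x - v)" v] by simp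
    have "(\<integral>\<^sup>+ x. ennreal (norm (fin_diff m h f x)) * \<kappa> k x \<partial>lborel)
        \<le> (\<integral>\<^sup>+ x. (\<Sum>q\<le>m. ?b q * (?f q x * \<kappa> k x)) \<partial>lborel)"
    proof (intro nn_integral_mono)
      fix x
      have "norm (fin_diff m h f x) \<le> (\<Sum>q\<le>m. norm ((-1) ^ q * of_nat (m choose q)
          * f (x + real q *\<^sub>R h)))"
        unfolding fin_diff_eq_sum norm_mult[of "(-1) ^ m"] norm_power
        using norm_sum by simp
      also have "\<dots> = (\<Sum>q\<le>m. real (m choose q) * norm (f (x + real q *\<^sub>R h)))"
        by (simp add: norm_mult norm_power)
      finally have "ennreal (norm (fin_diff m h f x)) \<le> (\<Sum>q\<le>m. ?b q * ?f q x)"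
        by (simp add: ennreal_leI sum_ennreal flip: ennreal_mult)
      then have "ennreal (norm (fin_diff m h f x)) * \<kappa> k x \<le> (\<Sum>q\<le>m. ?b q * ?f q x) * \<kappa> k x"
        by (rule mult_right_mono) simp
      then show "ennreal (norm (fin_diff m h f x)) * \<kappa> k x \<le> (\<Sum>q\<le>m. ?b q * (?f q x * \<kappa> k x))"
        by (simp add: sum_distrib_right mult.assoc)
    qed
    also have "\<dots> = (\<Sum>q\<le>m. ?b q * (\<integral>\<^sup>+ x. ?f q x * \<kappa> k x \<partial>lborel))"
      by (subst nn_integral_sum) (auto simp: nn_integral_cmult)
    finally show "(\<integral>\<^sup>+ x. ennreal (norm (fin_diff m h f x)) * \<kappa> k x \<partial>lborel)
       \<le> (\<Sum>q\<le>m. ?b q * (\<integral>\<^sup>+ x. ennreal (norm (f x)) * \<kappa> k (x - real q *\<^sub>R h) \<partial>lborel))"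
      by (simp add: tr)
  qed
  also have "\<dots> \<le> (\<Sum>q\<le>m. lp_norm p I (\<lambda>ik. ?b q * (\<lambda>(i, k). \<integral>\<^sup>+ x. ennreal (norm (f x))
      * \<kappa> k (x - real q *\<^sub>R h) \<partial>lborel) ik))"
    by (intro lp_norm_sum_le p) simp
  also have "\<dots> \<le> (\<Sum>q\<le>m. ?b q * R)"
    by (intro sum_mono order_trans[OF lp_norm_cmult] mult_left_mono one p) auto
  also have "\<dots> = ennreal (\<Sum>q\<le>m. real (m choose q)) * R"
    by (simp add: sum_distrib_right[symmetric] sum_ennreal)
  also have "(\<Sum>q\<le>m. real (m choose q)) = 2 ^ m"
    using choose_row_sum[of m] by (metis of_nat_numeral of_nat_power of_nat_sum)
  also have "ennreal (2 ^ m) * R = ennreal (2 ^ m * C * c powr (real CARD('n) * recip p))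
      * Lp_norm p lebesgue f"
    using C0 by (simp add: R_def ennreal_mult mult.assoc)
  finally show ?thesis by (simp add: \<kappa>_def)
qed

lemma diff_modulus_0_le:
  fixes f :: "real^'n \<Rightarrow> complex"
  assumes p: "1 \<le> p" and f: "f \<in> borel_measurable borel"
  shows "diff_modulus 0 p x0 f n \<le> Lp_norm p lebesgue f"
  unfolding diff_modulus_def
  using Lp_norm_mono_set[OF p diff_ball_lebesgue _ subset_UNIV borel_imp_lebesgue_measurable[OF f]]
  by (intro SUP_least) (simp add: lebesgue_on_UNIV_eq)

lemma mean_diff_0:
  fixes f :: "real^'n \<Rightarrow> complex"
  assumes "0 < N"
  shows "mean_diff N 0 S f K = (\<integral>\<^sup>+x. ennreal (norm (f x)) * ennreal (norm (K x)) \<partial>lborel)"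
  using assms by (simp add: mean_diff_def nn_integral_multc bump_nn_integral)

text \<open>The contribution of the shells \<open>l, \<dots>, j\<close> and of the exterior region, without the constants.\<close>

definition shell_bound :: "nat \<Rightarrow> nat \<Rightarrow> ennreal \<Rightarrow> real^'n \<Rightarrow> (real^'n \<Rightarrow> complex) \<Rightarrow> nat \<Rightarrow> nat \<Rightarrow>
    ennreal" where
  "shell_bound n m p x0 f l j =
     (\<Sum>i=l..j. ennreal ((1/2) ^ (i * n)) * diff_modulus m p x0 f (j - i))
     + ennreal ((1/2) ^ (j * n)) * Lp_norm p lebesgue f"

text \<open>The basic local estimate. For a fixed step \<open>h\<close> the weight is decomposed into shells and the
Schur test is applied on each of them; the restriction on \<open>S\<close> keeps the differences with step
\<open>S *\<^sub>R h\<close> at points of the half ball inside of the ball. The average over \<open>h\<close> is dealt with by the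
Minkowski inequality.\<close>

lemma lp_norm_mean_diff_le:
  fixes f :: "real^'n \<Rightarrow> complex" and K :: "(int^'n) \<times> (int^'n) \<Rightarrow> real^'n \<Rightarrow> complex"
  assumes C: "schur_bound TYPE('n) C" and p: "1 \<le> p" and f: "f \<in> borel_measurable borel"
    and N: "0 < N" and I: "I \<subseteq> wavelet_types \<times> UNIV" and l: "l \<le> j"
    and S: "0 \<le> S" "S * (2 * (real m + 1)) \<le> 2 ^ l / 2 ^ j" and A: "0 \<le> A"
    and Km: "\<And>ik. ik \<in> I \<Longrightarrow> K ik \<in> borel_measurable borel"
    and K: "\<And>i k x. (i, k) \<in> I \<Longrightarrow> norm (K (i, k) x)
      \<le> A * (decay (CARD('n) + 2) (2 ^ j' *\<^sub>R x - real_vec k)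
          * inverse (2 ^ l + 2 ^ j * norm (x - x0)) ^ n)"
  shows "lp_norm p I (\<lambda>ik. ennreal (2 ^ (CARD('n) * j')) * mean_diff N m S f (K ik))
    \<le> ennreal (2 ^ m * C * A * 4 ^ n * 2 powr (real j' * real CARD('n) * recip p))
        * shell_bound n m p x0 f l j"
proof -
  note [measurable] = f
  let ?d = "CARD('n)"
  let ?J = "\<lambda>h ik. \<integral>\<^sup>+x. ennreal (norm (fin_diff m (S *\<^sub>R h) f x)) * ennreal (norm (K ik x)) \<partial>lborel"
  let ?e = "\<lambda>i. ennreal ((1/2) ^ (i * n))"
  let ?\<omega> = "\<lambda>i. diff_modulus m p x0 f (j - i)"
  let ?W = "\<lambda>x. inverse (2 ^ l + 2 ^ j * norm (x - x0)) ^ n"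
  define c where "c = (2::real) ^ j'"
  have c: "1 \<le> c" by (simp add: c_def)
  have C0: "0 < C" using C by (simp add: schur_bound_def)
  define \<kappa> where "\<kappa> = (\<lambda>(i::int^'n, k::int^'n) x. ennreal (c ^ ?d
      * decay (?d + 2) (c *\<^sub>R x - real_vec k)))"
  have \<kappa>m [measurable]: "\<kappa> ik \<in> borel_measurable borel" for ik
    unfolding \<kappa>_def by (cases ik) (simp, measurable)
  define P where "P = c powr (real ?d * recip p)"
  have P0: "0 \<le> P" by (simp add: P_def)
  define R where "R = ennreal (2 ^ m * C * A * 4 ^ n * P) * shell_bound n m p x0 f l j"
  define E where "E i = ball x0 (2 ^ i / 2 ^ j / 2)" for i :: nat
  have Em [measurable]: "E i \<in> sets borel" for i by (simp add: E_def)
  have S': "S * (2 * (real m + 1)) \<le> 2 ^ i / 2 ^ j" if "l \<le> i" for i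
  proof -
    have "(2::real) ^ l / 2 ^ j \<le> 2 ^ i / 2 ^ j" using that
        by (intro divide_right_mono power_increasing) auto
    with S show ?thesis by linarith
  qed
  have main: "lp_norm p I (\<lambda>ik. ennreal (c ^ ?d) * ?J h ik) \<le> R"
    if h: "norm h < 1" for h
  proof -
    define G where "G = fin_diff m (S *\<^sub>R h) f"
    have [measurable]: "G \<in> borel_measurable borel" unfolding G_def by measurable
    let ?g = "\<lambda>x. ennreal (norm (G x))"
    let ?c = "ennreal (2 ^ m * C * P)" and ?f = "Lp_norm p lebesgue f"
    define T where "T E ik = (\<integral>\<^sup>+ x. ?g x * \<kappa> ik x * indicator E x \<partial>lborel)" for E
        and ik :: "(int^'n) \<times> (int^'n)"
    have pw: "ennreal (c ^ ?d) * (\<integral>\<^sup>+x. ?g x * ennreal (norm (K ik x)) \<partial>lborel)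
        \<le> ennreal (A * 4 ^ n) * ((\<Sum>i=l..j. ?e i * T (E i) ik) + ?e j * T UNIV ik)"
      if ik: "ik \<in> I" for ik
    proof -
      obtain i0 k where ik': "ik = (i0, k)" by (cases ik)
      have [measurable]: "K ik \<in> borel_measurable borel" by (rule Km[OF ik])
      have "ennreal (c ^ ?d) * (\<integral>\<^sup>+x. ?g x * ennreal (norm (K ik x)) \<partial>lborel)
          = (\<integral>\<^sup>+x. ennreal (c ^ ?d) * (?g x * ennreal (norm (K ik x))) \<partial>lborel)"
        by (intro nn_integral_cmult[symmetric]) measurable
      also have "\<dots> \<le> (\<integral>\<^sup>+x. ennreal (A * 4 ^ n)
          * ((\<Sum>i=l..j. ?e i * (?g x * \<kappa> ik x * indicator (E i) x)) + ?e j
          * (?g x * \<kappa> ik x * indicator UNIV x)) \<partial>lborel)"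
      proof (intro nn_integral_mono)
        fix x
        define y where "y = c ^ ?d * decay (?d + 2) (c *\<^sub>R x - real_vec k)"
        have y: "0 \<le> y" using c by (simp add: y_def)
        define W where "W = (\<Sum>i=l..j. (1/2::real) ^ (i * n) * indicator (E i) x)"
        have W: "0 \<le> W" by (simp add: W_def sum_nonneg)
        have "c ^ ?d * norm (K ik x) \<le> c ^ ?d * (A * (decay (?d + 2) (c *\<^sub>R x - real_vec k) * ?W x))"
          using K[of i0 k x] ik ik' c by (intro mult_left_mono) (auto simp: c_def)
        also have "\<dots> = A * y * ?W x"
          by (simp add: y_def)
        also have "\<dots> \<le> A * y * (4 ^ n * (W + (1/2) ^ (j * n)))"
          unfolding W_def E_def using A y by (intro mult_left_mono inverse_weight_le_shells l) auto
        finally have "c ^ ?d * norm (K ik x) \<le> (A * 4 ^ n) * ((W + (1/2) ^ (j * n)) * y)"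
          by (simp add: mult_ac)
        then have "ennreal (c ^ ?d * norm (K ik x))
            \<le> ennreal ((A * 4 ^ n) * ((W + (1/2) ^ (j * n)) * y))"
          by (rule ennreal_leI)
        also have "\<dots> = ennreal (A * 4 ^ n) * ((ennreal W + ?e j) * ennreal y)"
          using A y W by (simp add: ennreal_mult)
        also have "ennreal W = (\<Sum>i=l..j. ?e i * indicator (E i) x)"
          unfolding W_def by (subst sum_ennreal[symmetric])
              (auto simp: ennreal_mult ennreal_indicator)
        finally have le: "ennreal (c ^ ?d * norm (K ik x))
            \<le> ennreal (A * 4 ^ n) * (((\<Sum>i=l..j. ?e i * indicator (E i) x) + ?e j) * ennreal y)" .
        have "ennreal (c ^ ?d) * (?g x * ennreal (norm (K ik x)))
            = ?g x * ennreal (c ^ ?d * norm (K ik x))"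
          using c by (simp add: ennreal_mult mult.left_commute)
        also have "\<dots> \<le> ?g x * (ennreal (A * 4 ^ n)
            * (((\<Sum>i=l..j. ?e i * indicator (E i) x) + ?e j) * ennreal y))"
          by (intro mult_left_mono le) auto
        also have "\<dots> = ennreal (A * 4 ^ n)
            * ((\<Sum>i=l..j. ?e i * (?g x * \<kappa> ik x * indicator (E i) x)) + ?e j
            * (?g x * \<kappa> ik x * indicator UNIV x))"
          by (simp only: \<kappa>_def ik' prod.case y_def[symmetric] indicator_UNIV mult_1_right
              mult_1_left
              distrib_left distrib_right sum_distrib_left sum_distrib_right mult_ac)
        finally show "ennreal (c ^ ?d) * (?g x * ennreal (norm (K ik x))) \<le> \<dots>" .
      qed
      also have "\<dots> = ennreal (A * 4 ^ n) * ((\<Sum>i=l..j. ?e i * T (E i) ik) + ?e j * T UNIV ik)"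
        unfolding T_def by (simp add: nn_integral_cmult nn_integral_add nn_integral_sum)
      finally show ?thesis .
    qed
    have near: "lp_norm p I (T (E i)) \<le> ennreal (C * P) * ?\<omega> i" if i: "i \<in> {l..j}" for i
    proof -
      have "lp_norm p I (T (E i)) \<le> ennreal (C * P) * Lp_norm p (lebesgue_on (E i)) G"
        using schur_boundD[OF C p c _ _ I, of "E i" G 0]
        by (simp add: T_def[abs_def] \<kappa>_def P_def case_prod_unfold measurable_restrict_space1
            measurable_completion)
      also have "Lp_norm p (lebesgue_on (E i)) G \<le> ?\<omega> i"
        unfolding E_def G_def
      proof (intro Lp_norm_half_ball_le_diff_modulus p f)
        have Sh: "norm (S *\<^sub>R h) \<le> S" using S h by (simp add: mult_left_le)
        have eq: "S * (2 * (real m + 1)) = 2 * (real m * S) + 2 * S" by (simp add: algebra_simps)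
        have sum: "2 * (real m * S) + 2 * S \<le> 2 ^ i / 2 ^ j" using S'[of i] i unfolding eq by simp
        have mS: "0 \<le> real m * S" using S by simp
        show "norm (S *\<^sub>R h) \<le> 2 ^ i / 2 ^ j" using Sh S(1) mS sum by linarith
        have "real m * norm (S *\<^sub>R h) \<le> real m * S" using Sh by (intro mult_left_mono) auto
        also have "\<dots> \<le> 2 ^ i / 2 ^ j / 2"
        proof -
          have "a \<le> X / 2" if "2 * a + 2 * b \<le> X" "0 \<le> b" for a b X :: real using that by argo
          from this[OF sum S(1)] show ?thesis .
        qed
        finally show "real m * norm (S *\<^sub>R h) \<le> 2 ^ i / 2 ^ j / 2" .
      qed (use i in simp)
      finally show ?thesis by (simp add: mult_left_mono)
    qed
    have far: "lp_norm p I (T UNIV) \<le> ?c * ?f"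
      using lp_norm_fin_diff_far_le[OF C p c f I, of m "S *\<^sub>R h"]
      by (simp add: T_def[abs_def] \<kappa>_def P_def G_def case_prod_unfold)
    have "lp_norm p I (\<lambda>ik. ennreal (c ^ ?d) * (\<integral>\<^sup>+x. ?g x * ennreal (norm (K ik x)) \<partial>lborel))
        \<le> lp_norm p I (\<lambda>ik. ennreal (A * 4 ^ n) * ((\<Sum>i=l..j. ?e i * T (E i) ik) + ?e j
            * T UNIV ik))"
      by (intro lp_norm_mono p pw) auto
    also have "\<dots> \<le> ennreal (A * 4 ^ n) * lp_norm p I (\<lambda>ik. (\<Sum>i=l..j. ?e i * T (E i) ik) + ?e j
        * T UNIV ik)"
      using A by (intro lp_norm_cmult p) auto
    also have "\<dots> \<le> ennreal (A * 4 ^ n) * ((\<Sum>i=l..j. ?e i * (?c * ?\<omega> i))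
        + ?e j * (?c * ?f))"
    proof (rule mult_left_mono)
      have "lp_norm p I (\<lambda>ik. (\<Sum>i=l..j. ?e i * T (E i) ik) + ?e j * T UNIV ik)
          \<le> lp_norm p I (\<lambda>ik. \<Sum>i=l..j. ?e i * T (E i) ik) + lp_norm p I (\<lambda>ik. ?e j * T UNIV ik)"
        by (rule lp_norm_add_le[OF p])
      also have "\<dots> \<le> (\<Sum>i=l..j. lp_norm p I (\<lambda>ik. ?e i * T (E i) ik))
          + lp_norm p I (\<lambda>ik. ?e j * T UNIV ik)"
        by (intro add_right_mono lp_norm_sum_le p) simp
      also have "\<dots> \<le> (\<Sum>i=l..j. ?e i * (?c * ?\<omega> i))
        + ?e j * (?c * ?f)"
      proof (rule add_mono, rule sum_mono)
      fix i assume i: "i \<in> {l..j}"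
      have "lp_norm p I (\<lambda>ik. ?e i * T (E i) ik) \<le> ?e i * lp_norm p I (T (E i))"
        by (intro lp_norm_cmult p) simp
      also have "\<dots> \<le> ?e i * (ennreal (C * P) * ?\<omega> i)"
        by (intro mult_left_mono near i) simp
      also have "\<dots> \<le> ?e i * (?c * ?\<omega> i)"
      proof -
        have "1 * (C * P) \<le> 2 ^ m * (C * P)" using C0 P0 by (intro mult_right_mono) auto
        then have "ennreal (C * P) \<le> ?c" by (intro ennreal_leI) (simp add: mult.assoc)
        then show ?thesis by (intro mult_left_mono mult_right_mono) auto
      qed
      finally show "lp_norm p I (\<lambda>ik. ?e i * T (E i) ik) \<le> ?e i * (?c * ?\<omega> i)" .
    next
      have "lp_norm p I (\<lambda>ik. ?e j * T UNIV ik) \<le> ?e j * lp_norm p I (T UNIV)"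
        by (intro lp_norm_cmult p) simp
      also have "\<dots> \<le> ?e j * (?c * ?f)"
        by (intro mult_left_mono far) simp
      finally show "lp_norm p I (\<lambda>ik. ?e j * T UNIV ik) \<le> ?e j * (?c * ?f)" .
      qed
      finally show "lp_norm p I (\<lambda>ik. (\<Sum>i=l..j. ?e i * T (E i) ik) + ?e j * T UNIV ik)
        \<le> (\<Sum>i=l..j. ?e i * (?c * ?\<omega> i))
        + ?e j * (?c * ?f)" .
    qed simp
    also have "\<dots> = ennreal (A * 4 ^ n) * (?c * shell_bound n m p x0 f l j)"
      unfolding shell_bound_def by (simp only: distrib_left sum_distrib_left mult.left_commute)
    also have "\<dots> = R"
    proof -
      have "ennreal (A * 4 ^ n) * ?c = ennreal ((A * 4 ^ n) * (2 ^ m * C * P))"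
        using A C0 P0 by (intro ennreal_mult[symmetric]) auto
      also have "(A * 4 ^ n) * (2 ^ m * C * P) = 2 ^ m * C * A * 4 ^ n * P" by (simp only: mult_ac)
      finally show ?thesis by (simp only: R_def mult.assoc[symmetric])
    qed
    finally show ?thesis by (simp add: G_def)
  qed
  have "lp_norm p I (\<lambda>ik. ennreal (2 ^ (?d * j')) * mean_diff N m S f (K ik))
      \<le> lp_norm p I (\<lambda>ik. \<integral>\<^sup>+h. ennreal (bump N h) * (ennreal (c ^ ?d) * ?J h ik) \<partial>lborel)"
  proof (intro lp_norm_mono p order_refl eq_refl)
    fix ik assume ik: "ik \<in> I"
    have [measurable]: "K ik \<in> borel_measurable borel" by (rule Km[OF ik])
    have "2 ^ (?d * j') = c ^ ?d" by (simp add: c_def mult.commute flip: power_mult)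
    then show "ennreal (2 ^ (?d * j')) * mean_diff N m S f (K ik)
        = (\<integral>\<^sup>+h. ennreal (bump N h) * (ennreal (c ^ ?d) * ?J h ik) \<partial>lborel)"
      unfolding mean_diff_def by (subst nn_integral_cmult[symmetric])
          (measurable, simp add: mult.left_commute)
  qed
  also have "\<dots> \<le> (\<integral>\<^sup>+h. ennreal (bump N (h::real^'n)) * R \<partial>lborel)"
  proof (rule lp_norm_nn_integral_le[OF p])
    fix ik assume ik: "ik \<in> I"
    have [measurable]: "K ik \<in> borel_measurable borel" by (rule Km[OF ik])
    show "(\<lambda>h. ennreal (bump N h) * (ennreal (c ^ ?d) * ?J h ik)) \<in> borel_measurable lborel"
      by measurable
  next
    fix h :: "real^'n"
    have "lp_norm p I (\<lambda>k. ennreal (bump N h) * (ennreal (c ^ ?d) * ?J h k))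
        \<le> ennreal (bump N h) * lp_norm p I (\<lambda>k. ennreal (c ^ ?d) * ?J h k)"
      by (intro lp_norm_cmult p) simp
    also have "\<dots> \<le> ennreal (bump N h) * R"
      by (cases "norm h < 1") (auto intro!: mult_left_mono main simp: bump_outside[OF N])
    finally show "lp_norm p I (\<lambda>k. ennreal (bump N h) * (ennreal (c ^ ?d) * ?J h k))
        \<le> ennreal (bump N h) * R" .
  qed measurable
  also have "\<dots> = R" by (simp add: nn_integral_multc bump_nn_integral[OF N])
  also have "P = 2 powr (real j' * real ?d * recip p)"
    by (simp add: P_def c_def powr_powr mult.assoc flip: powr_realpow)
  then have "R = ennreal (2 ^ m * C * A * 4 ^ n * 2 powr (real j' * real ?d * recip p))
      * shell_bound n m p x0 f l j"
    by (simp add: R_def)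
  finally show ?thesis .
qed

section \<open>The leaders are controlled by the moduli of smoothness\<close>

lemma tempered_of_Lp:
  fixes f :: "real^'n \<Rightarrow> complex"
  assumes p: "1 \<le> p" and f: "f \<in> borel_measurable borel" and fin: "Lp_norm p lebesgue f < \<infinity>"
  shows "tempered (CARD('n) + 2) f"
proof -
  note [measurable] = f
  obtain C where C: "schur_bound TYPE('n) C" using schur_bound_exists by blast
  \<comment> \<open>Any type serves as the index of a single kernel.\<close>
  define e where "e = (1 :: int^'n)"
  have e: "e \<in> wavelet_types" by (auto simp: e_def wavelet_types_def)
  let ?T = "\<lambda>(i::int^'n, k::int^'n). \<integral>\<^sup>+ x. ennreal (norm (f x)) *
        ennreal (1 ^ CARD('n) * decay (CARD('n) + 2) (1 *\<^sub>R (x - 0) - real_vec k))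
            * indicator UNIV x \<partial>lborel"
  have "?T (e, 0) \<le> lp_norm p {(e, 0)} ?T"
    by (rule lp_norm_ge[OF p]) simp
  also have "\<dots> \<le> ennreal (C * 1 powr (real CARD('n) * recip p)) * Lp_norm p (lebesgue_on UNIV) f"
    using e f by (intro schur_boundD[OF C p]) (auto simp: lebesgue_on_UNIV_eq measurable_completion)
  also have "\<dots> < \<infinity>" using fin by (simp add: lebesgue_on_UNIV_eq ennreal_mult_less_top)
  finally have "(\<integral>\<^sup>+ x. ennreal (norm (f x) * decay (CARD('n) + 2) x) \<partial>lborel) < \<infinity>"
    by (simp add: real_vec_def ennreal_mult zero_vec_def[symmetric])
  then have "integrable lborel (\<lambda>x. norm (f x) * decay (CARD('n) + 2) x)"
    by (intro integrableI_nonneg) auto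
  then show ?thesis by (simp add: tempered_def f)
qed

text \<open>One power of the decay is given away to make the bounds for successive \<open>l\<close> summable.\<close>

lemma shell_bound_Suc_le:
  assumes "l \<le> j"
  shows "shell_bound (Suc n) m p x0 f l j \<le> ennreal ((1/2) ^ l) * shell_bound n m p x0 f 0 j"
proof -
  have le: "ennreal ((1/2) ^ (i * Suc n)) \<le> ennreal ((1/2) ^ l) * ennreal ((1/2) ^ (i * n))"
      if "l \<le> i" for i
  proof -
    have "(1/2::real) ^ (i * Suc n) = (1/2) ^ i * (1/2) ^ (i * n)" by (simp add: power_add)
    also have "\<dots> \<le> (1/2) ^ l * (1/2) ^ (i * n)" using that
        by (intro mult_right_mono power_decreasing) auto
    finally have "ennreal ((1/2) ^ (i * Suc n)) \<le> ennreal ((1/2) ^ l * (1/2) ^ (i * n))"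
        by (rule ennreal_leI)
    then show ?thesis by (simp add: ennreal_mult)
  qed
  have "(\<Sum>i=l..j. ennreal ((1/2) ^ (i * Suc n)) * diff_modulus m p x0 f (j - i))
      \<le> (\<Sum>i=l..j. ennreal ((1/2) ^ l) * ennreal ((1/2) ^ (i * n)) * diff_modulus m p x0 f (j - i))"
    using le by (intro sum_mono mult_right_mono) auto
  also have "\<dots> \<le> (\<Sum>i=0..j. ennreal ((1/2) ^ l) * ennreal ((1/2) ^ (i * n))
      * diff_modulus m p x0 f (j - i))"
    by (intro sum_mono2) auto
  also have "\<dots> = ennreal ((1/2) ^ l) * (\<Sum>i=0..j. ennreal ((1/2) ^ (i * n))
      * diff_modulus m p x0 f (j - i))"
    by (simp add: sum_distrib_left mult.assoc)
  finally have 1: "(\<Sum>i=l..j. ennreal ((1/2) ^ (i * Suc n)) * diff_modulus m p x0 f (j - i)) \<le> \<dots>" .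
  have 2: "ennreal ((1/2) ^ (j * Suc n)) * Lp_norm p lebesgue f
      \<le> ennreal ((1/2) ^ l) * (ennreal ((1/2) ^ (j * n)) * Lp_norm p lebesgue f)"
    using mult_right_mono[OF le[OF assms], of "Lp_norm p lebesgue f"] by (simp add: mult.assoc)
  show ?thesis
    unfolding shell_bound_def distrib_left by (rule add_mono[OF 1 2])
qed

text \<open>In units of \<open>2\<^sup>-\<^sup>j\<^sup>'\<close> the distance to the position of the wavelet dominates, up to an additive
constant, the distance to \<open>x0\<close> in the coarser units of \<open>2\<^sup>-\<^sup>j\<close>.\<close>

lemma dilated_center_le:
  fixes x x0 v :: "'a::real_normed_vector"
  assumes j: "j \<le> j'" and v: "norm ((1 / 2 ^ j') *\<^sub>R v - x0) \<le> \<rho> / 2 ^ j"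
  shows "2 ^ j * norm (x - x0) \<le> norm (2 ^ j' *\<^sub>R x - v) + \<rho>"
proof -
  have "x - x0 = (x - (1 / 2 ^ j') *\<^sub>R v) + ((1 / 2 ^ j') *\<^sub>R v - x0)" by simp
  then have "norm (x - x0) \<le> norm (x - (1 / 2 ^ j') *\<^sub>R v) + \<rho> / 2 ^ j"
    by (metis add_mono_thms_linordered_semiring(1) norm_triangle_le order_refl v)
  then have "2 ^ j * norm (x - x0) \<le> 2 ^ j * (norm (x - (1 / 2 ^ j') *\<^sub>R v) + \<rho> / 2 ^ j)"
    by (intro mult_left_mono) auto
  also have "\<dots> = 2 ^ j * norm (x - (1 / 2 ^ j') *\<^sub>R v) + \<rho>" by (simp add: distrib_left)
  also have "2 ^ j * norm (x - (1 / 2 ^ j') *\<^sub>R v) \<le> 2 ^ j' * norm (x - (1 / 2 ^ j') *\<^sub>R v)"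
    using j by (intro mult_right_mono power_increasing) auto
  also have "2 ^ j' * norm (x - (1 / 2 ^ j') *\<^sub>R v) = norm (2 ^ j' *\<^sub>R (x - (1 / 2 ^ j') *\<^sub>R v))"
      by simp
  also have "2 ^ j' *\<^sub>R (x - (1 / 2 ^ j') *\<^sub>R v) = 2 ^ j' *\<^sub>R x - v" by (simp add: scaleR_diff_right)
  finally show ?thesis by simp
qed

text \<open>This lemma and the next one distribute the decay of a wavelet and of a smoothed wavelet
between a kernel for the Schur test, centred at the wavelet, and a weight centred at \<open>x0\<close>.\<close>

lemma decay_split_le:
  fixes x x0 v :: "'a::real_normed_vector"
  assumes j: "j \<le> j'" and v: "norm ((1 / 2 ^ j') *\<^sub>R v - x0) \<le> \<rho> / 2 ^ j" and \<rho>: "0 \<le> \<rho>"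
  shows "decay (M + n) (2 ^ j' *\<^sub>R x - v) \<le>
    (1 + \<rho>) ^ n * (decay M (2 ^ j' *\<^sub>R x - v) * inverse (2 ^ 0 + 2 ^ j * norm (x - x0)) ^ n)"
proof -
  define y where "y = norm (2 ^ j' *\<^sub>R x - v)"
  define D where "D = 2 ^ j * norm (x - x0)"
  have y0: "0 \<le> y" and D0: "0 \<le> D" by (simp_all add: y_def D_def)
  have "D \<le> y + \<rho>" unfolding D_def y_def by (rule dilated_center_le[OF j v])
  moreover have "0 \<le> \<rho> * y" using \<rho> y0 by simp
  ultimately have "1 + D \<le> (1 + \<rho>) * (1 + y)" by (simp add: algebra_simps)
  then have "inverse (1 + y) \<le> (1 + \<rho>) * inverse (1 + D)"
    using y0 D0 \<rho> by (simp add: field_simps)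
  then have "inverse (1 + y) ^ n \<le> ((1 + \<rho>) * inverse (1 + D)) ^ n"
    using y0 by (intro power_mono) auto
  then have "decay M (2 ^ j' *\<^sub>R x - v) * inverse (1 + y) ^ n
      \<le> decay M (2 ^ j' *\<^sub>R x - v) * ((1 + \<rho>) * inverse (1 + D)) ^ n"
    by (intro mult_left_mono) auto
  then show ?thesis
    unfolding decay_add by (simp add: decay_def[of n] y_def[symmetric] D_def[symmetric]
        power_mult_distrib mult.left_commute)
qed

lemma inverse_smooth_split_le:
  fixes x x0 v :: "'a::real_normed_vector"
  assumes j: "j \<le> j'" and v: "norm ((1 / 2 ^ j') *\<^sub>R v - x0) \<le> \<rho> / 2 ^ j" and \<rho>: "0 \<le> \<rho>"
    and \<kappa>: "0 < \<kappa>" "\<kappa> \<le> 1"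
  shows "inverse (2 ^ j' * (\<kappa> * 2 ^ l / 2 ^ j) + norm (2 ^ j' *\<^sub>R x - v)) ^ (M + n) \<le>
    (inverse \<kappa> ^ M * ((1 + \<rho>) / \<kappa>) ^ n) * (decay M (2 ^ j' *\<^sub>R x - v)
        * inverse (2 ^ l + 2 ^ j * norm (x - x0)) ^ n)"
proof -
  define y where "y = norm (2 ^ j' *\<^sub>R x - v)"
  define D where "D = 2 ^ j * norm (x - x0)"
  define X where "X = 2 ^ j' * (\<kappa> * 2 ^ l / 2 ^ j) + y"
  have y0: "0 \<le> y" and D0: "0 \<le> D" by (simp_all add: y_def D_def)
  have D: "D \<le> y + \<rho>" unfolding D_def y_def by (rule dilated_center_le[OF j v])
  have "1 * (\<kappa> * 2 ^ l) \<le> (2 ^ j' / 2 ^ j) * (\<kappa> * 2 ^ l)"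
    using j \<kappa> by (intro mult_right_mono) (auto simp: power_increasing)
  then have X: "\<kappa> * 2 ^ l + y \<le> X" by (simp add: X_def)
  have l1: "\<kappa> \<le> \<kappa> * 2 ^ l" using \<kappa> by simp
  have \<kappa>y: "\<kappa> * y \<le> y" using \<kappa> y0 by (simp add: mult_left_le_one_le)
  have Xpos: "0 < X" using X y0 l1 \<kappa> by linarith
  have "\<kappa> * (1 + y) \<le> X" using X l1 \<kappa>y by (simp add: distrib_left)
  then have "inverse X \<le> inverse (\<kappa> * (1 + y))" using \<kappa> y0 by (intro le_imp_inverse_le) auto
  then have "inverse X \<le> inverse \<kappa> * inverse (1 + y)" by simp
  then have 1: "inverse X ^ M \<le> (inverse \<kappa> * inverse (1 + y)) ^ M" using Xpos
      by (intro power_mono) auto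
  have "\<kappa> * (2 ^ l + D) \<le> (1 + \<rho>) * X"
  proof -
    have "\<kappa> * D \<le> \<kappa> * (y + \<rho>)" using D \<kappa> by (intro mult_left_mono) auto
    also have "\<dots> = \<kappa> * y + \<kappa> * \<rho>" by (simp add: distrib_left)
    finally have a: "\<kappa> * D \<le> \<kappa> * y + \<kappa> * \<rho>" .
    have "\<rho> * \<kappa> \<le> \<rho> * X" using X l1 y0 \<rho> by (intro mult_left_mono) auto
    then have b: "\<kappa> * \<rho> \<le> \<rho> * X" by (simp add: mult.commute)
    have "\<kappa> * (2 ^ l + D) = \<kappa> * 2 ^ l + \<kappa> * D" "(1 + \<rho>) * X = X + \<rho> * X"
        by (simp_all add: algebra_simps)
    with a b X \<kappa>y show ?thesis by linarith
  qed
  then have "(2 ^ l + D) \<le> (1 + \<rho>) / \<kappa> * X" using \<kappa> by (simp add: field_simps)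
  moreover have pos: "0 < 2 ^ l + D" using D0 by (simp add: add_pos_nonneg)
  moreover have "inverse Z \<le> c * inverse Y" if "Y \<le> c * Z" "0 < Y" "0 < Z" for Y Z c :: real
    using that by (simp add: field_simps)
  ultimately have "inverse X \<le> (1 + \<rho>) / \<kappa> * inverse (2 ^ l + D)"
    using Xpos by blast
  then have 2: "inverse X ^ n \<le> ((1 + \<rho>) / \<kappa> * inverse (2 ^ l + D)) ^ n" using Xpos
      by (intro power_mono) auto
  have "inverse X ^ M * inverse X ^ n \<le> (inverse \<kappa> * inverse (1 + y)) ^ M
      * ((1 + \<rho>) / \<kappa> * inverse (2 ^ l + D)) ^ n"
    using 1 2 Xpos \<kappa> y0 by (intro mult_mono) auto
  also have "\<dots> = (inverse \<kappa> ^ M * ((1 + \<rho>) / \<kappa>) ^ n)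
      * (inverse (1 + y) ^ M * inverse (2 ^ l + D) ^ n)"
    by (simp only: power_mult_distrib mult_ac)
  finally show ?thesis
    by (simp only: power_add decay_def X_def y_def D_def)
qed

text \<open>The scales are \<open>S l = \<kappa> * 2\<^sup>l / 2\<^sup>j\<close>, from about \<open>2\<^sup>-\<^sup>j\<close> up to about \<open>1\<close>. The term number \<open>l\<close>
of the telescoping sum is at most \<open>2\<^sup>-\<^sup>l\<close> times the bound \<open>U\<close>, so that the sum is at most
\<open>4 U\<close>; the initial term adds \<open>U\<close>, and the remainder, a difference of order \<open>0\<close>, adds \<open>2 U\<close>.\<close>

lemma lp_norm_coeff_le:
  fixes f :: "real^'n \<Rightarrow> complex" and \<psi> :: "int^'n \<Rightarrow> real^'n \<Rightarrow> complex"
  defines "M \<equiv> CARD('n) + 2"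
  assumes C: "schur_bound TYPE('n) C" and p: "1 \<le> p" and f: "f \<in> borel_measurable borel"
    and fin: "Lp_norm p lebesgue f < \<infinity>" and N: "N = M + Suc n"
    and \<kappa>: "\<kappa> = 1 / (4 * (real m + 1))"
    and A1: "0 \<le> A1" "\<And>i y. i \<in> wavelet_types \<Longrightarrow> norm (\<psi> i y) \<le> A1 * decay N y"
    and A2: "0 \<le> A2" "\<And>i S y. i \<in> wavelet_types \<Longrightarrow> \<kappa> \<le> S \<Longrightarrow>
        norm (smooth N m S (\<psi> i) y) \<le> A2 * inverse (S + norm y) ^ N"
    and \<psi>m: "\<And>i. i \<in> wavelet_types \<Longrightarrow> \<psi> i \<in> borel_measurable borel"
    and I: "I \<subseteq> wavelet_types \<times> UNIV" and j: "j \<le> j'" and \<rho>: "0 \<le> \<rho>"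
    and near: "\<And>i k. (i, k) \<in> I \<Longrightarrow> norm ((1 / 2 ^ j') *\<^sub>R real_vec k - x0) \<le> \<rho> / 2 ^ j"
    and A: "A1 * (1 + \<rho>) ^ Suc n \<le> A" "A2 * (inverse \<kappa> ^ M * ((1 + \<rho>) / \<kappa>) ^ Suc n) \<le> A"
  shows "lp_norm p I (\<lambda>(i, k). ennreal (2 ^ (CARD('n) * j')) *
      ennreal (norm (\<integral>x. f x * \<psi> i (2 ^ j' *\<^sub>R x - real_vec k) \<partial>lborel)))
    \<le> ennreal (7 * (2 ^ m * C * A * 4 ^ Suc n * 2 powr (real j' * real CARD('n) * recip p)))
        * shell_bound n m p x0 f 0 j"
proof -
  note [measurable] = f
  let ?D = "\<lambda>l k x. decay M (2 ^ j' *\<^sub>R x - real_vec k)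
      * inverse (2 ^ l + 2 ^ j * norm (x - x0)) ^ Suc n"
  let ?I = "\<lambda>i k. \<integral>x. f x * \<psi> i (2 ^ j' *\<^sub>R x - real_vec k) \<partial>lborel"
  have C0: "0 < C" using C by (simp add: schur_bound_def)
  have A0: "0 \<le> A" using A(1) A1(1) \<rho> by (meson add_nonneg_nonneg mult_nonneg_nonneg order_trans
      zero_le_one zero_le_power)
  have \<kappa>': "0 < \<kappa>" "\<kappa> \<le> 1" unfolding \<kappa> by (auto simp: field_simps)
  have N0: "0 < N" by (simp add: N M_def)
  have temp: "tempered M f" unfolding M_def by (rule tempered_of_Lp[OF p f fin])
  define K where "K = (\<lambda>(i, k) x. \<psi> i (2 ^ j' *\<^sub>R x - real_vec k))"
  define S where "S l = \<kappa> * 2 ^ l / 2 ^ j" for l :: nat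
  define u where "u l ik = smooth N m (S l) (K ik)" for l ik
  define P where "P = 2 powr (real j' * real CARD('n) * recip p)"
  have P0: "0 \<le> P" by (simp add: P_def)
  let ?c = "2 ^ m * C * A * 4 ^ Suc n * P"
  define U where "U = ennreal (?c) * shell_bound n m p x0 f 0 j"
  define e where "e = ennreal (2 ^ (CARD('n) * j'))"
  let ?a = "\<lambda>l ik. mean_diff N m (S (Suc l)) f (u l ik)"
      and ?b = "\<lambda>l ik. mean_diff N m (S l) f (u (Suc l) ik)"
  let ?U = "\<lambda>l. ennreal ((1/2) ^ l) * U"
  have Km: "K ik \<in> borel_measurable borel" if "ik \<in> I" for ik
  proof -
    obtain i k where ik: "ik = (i, k)" by (cases ik)
    have [measurable]: "\<psi> i \<in> borel_measurable borel" using that I ik by (intro \<psi>m) auto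
    show ?thesis unfolding K_def ik prod.case by measurable
  qed
  have Kdec: "decaying M (K ik)" if ik: "ik \<in> I" for ik
  proof -
    obtain i k where ik': "ik = (i, k)" by (cases ik)
    have i: "i \<in> wavelet_types" using ik I ik' by auto
    have "norm (K ik x) \<le> (A1 * (1 + norm (real_vec k)) ^ M) * decay M x" for x
    proof -
      define y where "y = 2 ^ j' *\<^sub>R x - real_vec k"
      have "norm (K ik x) \<le> A1 * decay N y" using A1(2)[OF i] by (simp add: K_def ik' y_def)
      also have "\<dots> \<le> A1 * decay M y" using A1(1)
          by (intro mult_left_mono decay_antimono) (auto simp: N)
      also have "decay M y \<le> (1 + norm (real_vec k)) ^ M * decay M (2 ^ j' *\<^sub>R x)"
        using decay_shift[of M y "2 ^ j' *\<^sub>R x"] by (simp add: y_def)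
      also have "decay M (2 ^ j' *\<^sub>R x) \<le> decay M x"
        unfolding decay_def
      proof (intro power_mono le_imp_inverse_le add_left_mono)
        show "norm x \<le> norm (2 ^ j' *\<^sub>R x)" using mult_right_mono[of 1 "2 ^ j'" "norm x"] by simp
      qed (auto intro: add_pos_nonneg)
      finally show ?thesis using A1(1) by (simp add: mult_left_mono mult.assoc)
    qed
    then show ?thesis using Km[OF ik] unfolding decaying_def by blast
  qed
  have um: "u l ik \<in> borel_measurable borel" if "ik \<in> I" for l ik
    unfolding u_def by (intro decaying_measurable[OF decaying_smooth[OF N0 Kdec[OF that]]])
  have Kb: "norm (K (i, k) x) \<le> A * ?D 0 k x"
    if ik: "(i, k) \<in> I" for i k x
  proof -
    have i: "i \<in> wavelet_types" using ik I by auto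
    have "norm (K (i, k) x) \<le> A1 * decay N (2 ^ j' *\<^sub>R x - real_vec k)" using A1(2)[OF i]
        by (simp add: K_def)
    also have "\<dots> \<le> A1 * ((1 + \<rho>) ^ Suc n * ?D 0 k x)"
      unfolding N using A1(1) by (intro mult_left_mono decay_split_le[OF j near[OF ik] \<rho>])
    also have "\<dots> = (A1 * (1 + \<rho>) ^ Suc n) * ?D 0 k x"
      by (simp only: mult.assoc)
    also have "\<dots> \<le> A * ?D 0 k x"
      by (intro mult_right_mono A(1)) auto
    finally show ?thesis .
  qed
  have ub: "norm (u l (i, k) x) \<le> A * ?D l k x"
    if ik: "(i, k) \<in> I" for l i k x
  proof -
    have i: "i \<in> wavelet_types" using ik I by auto
    have "1 * (\<kappa> * 1) \<le> (2 ^ j' / 2 ^ j) * (\<kappa> * 2 ^ l)"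
      using j \<kappa>' by (intro mult_mono) (auto simp: power_increasing)
    then have S\<kappa>: "\<kappa> \<le> 2 ^ j' * S l" by (simp add: S_def)
    have "u l (i, k) x = smooth N m (2 ^ j' * S l) (\<psi> i) (2 ^ j' *\<^sub>R x - real_vec k)"
      unfolding u_def K_def prod.case by (rule smooth_dilate)
    then have "norm (u l (i, k) x) \<le> A2 * inverse (2 ^ j' * S l
        + norm (2 ^ j' *\<^sub>R x - real_vec k)) ^ N"
      using A2(2)[OF i S\<kappa>] by simp
    also have "\<dots> \<le> A2 * ((inverse \<kappa> ^ M * ((1 + \<rho>) / \<kappa>) ^ Suc n) * ?D l k x)"
      unfolding N S_def using A2(1) by (intro mult_left_mono
          inverse_smooth_split_le[OF j near[OF ik] \<rho> \<kappa>'])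
    also have "\<dots> = (A2 * (inverse \<kappa> ^ M * ((1 + \<rho>) / \<kappa>) ^ Suc n)) * ?D l k x"
      by (simp only: mult.assoc)
    also have "\<dots> \<le> A * ?D l k x"
      by (intro mult_right_mono A(2)) auto
    finally show ?thesis .
  qed
  have S0: "0 \<le> S l" for l using \<kappa>' by (simp add: S_def)
  have SS: "S (Suc l) * (2 * (real m + 1)) \<le> 2 ^ l / 2 ^ j" for l
  proof -
    have "\<kappa> * (4 * (real m + 1)) = 1" unfolding \<kappa> by simp
    moreover have "S (Suc l) * (2 * (real m + 1)) = (\<kappa> * (4 * (real m + 1))) * (2 ^ l / 2 ^ j)"
      by (simp add: S_def)
    ultimately show ?thesis by simp
  qed
  have SS': "S l * (2 * (real m + 1)) \<le> 2 ^ l / 2 ^ j" for l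
  proof -
    have "S l * (2 * (real m + 1)) \<le> S (Suc l) * (2 * (real m + 1))"
      using \<kappa>' by (intro mult_right_mono) (auto simp: S_def divide_right_mono)
    then show ?thesis using SS[of l] by linarith
  qed
  have md: "lp_norm p I (\<lambda>ik. e * mean_diff N m s f (L ik)) \<le> ?U l"
    if l: "l \<le> j" and s: "0 \<le> s" "s * (2 * (real m + 1)) \<le> 2 ^ l / 2 ^ j"
      and L: "\<And>ik. ik \<in> I \<Longrightarrow> L ik \<in> borel_measurable borel"
        "\<And>i k x. (i, k) \<in> I \<Longrightarrow> norm (L (i, k) x) \<le> A * ?D l k x"
    for l s L
  proof -
    have "lp_norm p I (\<lambda>ik. e * mean_diff N m s f (L ik))
        \<le> ennreal (?c) * shell_bound (Suc n) m p x0 f l j"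
      unfolding e_def P_def
      by (rule lp_norm_mean_diff_le[OF C p f N0 I l s A0 L[unfolded M_def]])
    also have "\<dots> \<le> ennreal (?c) * (ennreal ((1/2) ^ l) * shell_bound n m p x0 f 0 j)"
      by (intro mult_left_mono shell_bound_Suc_le l) simp
    finally show ?thesis by (simp only: U_def mult.left_commute)
  qed
  have first: "lp_norm p I (\<lambda>ik. e * mean_diff N m (S 0) f (K ik)) \<le> U"
    using md[of 0 "S 0" K] S0[of 0] SS'[of 0] Km Kb by simp
  have stepA: "lp_norm p I (\<lambda>ik. e * ?a l ik) \<le> ?U l" if "l < j" for l
    using that by (intro md S0 SS um ub) auto
  \<comment> \<open>The index of the shells is that of the smoothed wavelet; the steps \<open>S l\<close> are smaller.\<close>
  have stepB: "lp_norm p I (\<lambda>ik. e * ?b l ik) \<le> ?U l" if l: "l < j" for l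
  proof -
    have "S l * (2 * (real m + 1)) \<le> 2 ^ Suc l / 2 ^ j"
    proof -
      have "(2::real) ^ l / 2 ^ j \<le> 2 ^ Suc l / 2 ^ j" by (intro divide_right_mono) auto
      with SS'[of l] show ?thesis by linarith
    qed
    then have "lp_norm p I (\<lambda>ik. e * ?b l ik) \<le> ennreal ((1/2) ^ Suc l) * U"
      using l by (intro md S0 um ub) auto
    also have "\<dots> \<le> ?U l" by (intro mult_right_mono ennreal_leI) auto
    finally show ?thesis .
  qed
  define F where "F ik = (\<integral>\<^sup>+x. ennreal (norm (f x)) * ennreal (norm (u j ik x)) \<partial>lborel)" for ik
  have last: "lp_norm p I (\<lambda>ik. e * F ik) \<le> ennreal 2 * U"
  proof -
    let ?f = "Lp_norm p lebesgue f" and ?e = "\<lambda>n. ennreal ((1/2) ^ (j * n))"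
    let ?c' = "2 ^ 0 * C * A * 4 ^ Suc n * P"
    have "shell_bound (Suc n) 0 p x0 f j j \<le> ?e (Suc n) * ?f + ?e (Suc n) * ?f"
      by (simp add: shell_bound_def mult_left_mono diff_modulus_0_le[OF p f] del: power_Suc
          mult_Suc_right)
    also have "\<dots> \<le> ?e n * ?f + ?e n * ?f"
      by (intro add_mono mult_right_mono ennreal_leI power_decreasing) auto
    also have "\<dots> \<le> ennreal 2 * shell_bound n m p x0 f 0 j"
      by (simp add: shell_bound_def distrib_left mult_2)
    finally have sb: "shell_bound (Suc n) 0 p x0 f j j \<le> ennreal 2 * shell_bound n m p x0 f 0 j" .
    have cc: "?c' \<le> ?c"
      using C0 A0 P0 by (intro mult_right_mono power_increasing) auto
    have "lp_norm p I (\<lambda>ik. e * mean_diff N 0 0 f (u j ik))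
        \<le> ennreal ?c' * shell_bound (Suc n) 0 p x0 f j j"
      unfolding e_def P_def
      by (rule lp_norm_mean_diff_le[OF C p f N0 I order_refl _ _ A0 um ub[unfolded M_def]]) auto
    also have "\<dots> \<le> ennreal ?c * (ennreal 2 * shell_bound n m p x0 f 0 j)"
      by (intro mult_mono ennreal_leI cc sb) auto
    also have "\<dots> = ennreal 2 * U"
      by (simp only: U_def mult.left_commute)
    finally show ?thesis by (simp only: F_def mean_diff_0[OF N0])
  qed
  have "lp_norm p I (\<lambda>(i, k). e * ennreal (norm (?I i k)))
     \<le> lp_norm p I (\<lambda>ik. e * mean_diff N m (S 0) f (K ik) + (\<Sum>l<j. e * ?a l ik + e * ?b l ik) + e
         * F ik)"
  proof (intro lp_norm_mono p order_refl)
    fix ik assume ik: "ik \<in> I"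
    obtain i k where ik': "ik = (i, k)" by (cases ik)
    have "e * ennreal (norm (\<integral>x. f x * K ik x \<partial>lborel)) \<le> e * (mean_diff N m (S 0) f (K ik)
      + (\<Sum>l<j. ?a l ik + ?b l ik) + F ik)"
      unfolding u_def F_def by (intro mult_left_mono norm_pairing_le_telescope[OF N0 temp
          Kdec[OF ik]]) simp
    then show "(case ik of (i, k) \<Rightarrow> e * ennreal (norm (?I i k)))
      \<le> e * mean_diff N m (S 0) f (K ik) + (\<Sum>l<j. e * ?a l ik + e * ?b l ik) + e * F ik"
      by (simp add: ik' K_def distrib_left sum_distrib_left)
  qed
  also have "\<dots> \<le> lp_norm p I (\<lambda>ik. e * mean_diff N m (S 0) f (K ik))
      + lp_norm p I (\<lambda>ik. \<Sum>l<j. e * ?a l ik + e * ?b l ik) + lp_norm p I (\<lambda>ik. e * F ik)"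
    by (intro order_trans[OF lp_norm_add_le[OF p]] add_right_mono lp_norm_add_le p)
  also have "\<dots> \<le> U + (\<Sum>l<j. ?U l + ?U l) + ennreal 2 * U"
  proof (intro add_mono first last)
    have "lp_norm p I (\<lambda>ik. \<Sum>l<j. e * ?a l ik + e * ?b l ik)
        \<le> (\<Sum>l<j. lp_norm p I (\<lambda>ik. e * ?a l ik + e * ?b l ik))"
      by (intro lp_norm_sum_le p) simp
    also have "\<dots> \<le> (\<Sum>l<j. ?U l + ?U l)"
    proof (rule sum_mono)
      fix l assume "l \<in> {..<j}"
      then have l: "l < j" by simp
      show "lp_norm p I (\<lambda>ik. e * ?a l ik + e * ?b l ik)
        \<le> ?U l + ?U l"
        by (rule order_trans[OF lp_norm_add_le[OF p] add_mono[OF stepA[OF l] stepB[OF l]]])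
    qed
    finally show "lp_norm p I (\<lambda>ik. \<Sum>l<j. e * ?a l ik + e * ?b l ik)
        \<le> (\<Sum>l<j. ?U l + ?U l)" .
  qed
  also have "(\<Sum>l<j. ?U l + ?U l) = ennreal (\<Sum>l<j. 2 * (1/2) ^ l) * U"
  proof -
    have "?U l + ?U l = ennreal (2 * (1/2) ^ l) * U" for l
    proof -
      have "ennreal ((1/2) ^ l) + ennreal ((1/2) ^ l) = ennreal (2 * (1/2) ^ l)"
        by (subst ennreal_plus[symmetric]) auto
      then show ?thesis by (simp only: distrib_right[symmetric])
    qed
    then have "(\<Sum>l<j. ?U l + ?U l) = (\<Sum>l<j. ennreal (2 * (1/2) ^ l)) * U"
      by (simp only: sum_distrib_right)
    also have "(\<Sum>l<j. ennreal (2 * (1/2) ^ l)) = ennreal (\<Sum>l<j. 2 * (1/2) ^ l)"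
      by (intro sum_ennreal) auto
    finally show ?thesis .
  qed
  also have "U + ennreal (\<Sum>l<j. 2 * (1/2) ^ l) * U + ennreal 2 * U
      \<le> U + ennreal 4 * U + ennreal 2 * U"
  proof (intro add_left_mono add_right_mono mult_right_mono ennreal_leI)
    have "(\<Sum>l<j. 2 * (1/2::real) ^ l) = 4 * (1 - (1/2) ^ j)"
      by (simp add: sum_distrib_left[symmetric] sum_gp_strict)
    then show "(\<Sum>l<j. 2 * (1/2::real) ^ l) \<le> 4" by simp
  qed simp
  also have "U + ennreal 4 * U + ennreal 2 * U = ennreal 7 * U"
  proof -
    have "U + ennreal 4 * U + ennreal 2 * U = (1 + ennreal 4 + ennreal 2) * U"
        by (simp only: distrib_right mult_1_left)
    also have "1 + ennreal 4 + ennreal 2 = ennreal 7"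
    proof -
      have "ennreal 7 = ennreal (1 + 4 + 2)" by simp
      also have "\<dots> = 1 + ennreal 4 + ennreal 2" by (subst ennreal_plus; simp)+
      finally show ?thesis by simp
    qed
    finally show ?thesis .
  qed
  also have "\<dots> = ennreal (7 * (?c)) * shell_bound n m p x0 f 0 j"
  proof -
    have "ennreal 7 * ennreal (?c) = ennreal (7 * (?c))"
      using A0 C0 P0 by (intro ennreal_mult[symmetric]) auto
    then show ?thesis by (simp only: U_def mult.assoc[symmetric, of "ennreal 7"])
  qed
  finally show ?thesis by (simp only: e_def P_def)
qed

lemma half_open_cube_dist:
  fixes a :: "real^'n"
  assumes "x \<in> half_open_cube a r" "y \<in> half_open_cube a r"
  shows "dist x y \<le> real CARD('n) * r"
  unfolding dist_norm using assms
  by (intro norm_le_card_vec) (auto simp: half_open_cube_def abs_le_iff algebra_simps; smt (verit))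

text \<open>Existence and uniqueness of the dyadic cube containing \<open>x0\<close>: its index is the integer part of
\<open>2\<^sup>j x0\<close> in each coordinate.\<close>

lemma dyadic_cube_at:
  fixes x0 :: "real^'n"
  shows "dyadic_cube_at j x0 \<in> dyadic_cubes j \<and> x0 \<in> dyadic_cube_at j x0"
  unfolding dyadic_cube_at_def
proof (rule theI')
  define cube where "cube k = half_open_cube ((1 / 2 ^ j) *\<^sub>R real_vec k) (1 / 2 ^ j)"
      for k :: "int^'n"
  have mem: "x0 \<in> cube k \<longleftrightarrow> (\<forall>l. k $ l = \<lfloor>2 ^ j * x0 $ l\<rfloor>)" for k
  proof -
    have "real_of_int (k $ l) / 2 ^ j \<le> x0 $ l \<and> x0 $ l < real_of_int (k $ l) / 2 ^ j + 1 / 2 ^ j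
        \<longleftrightarrow> k $ l = \<lfloor>2 ^ j * x0 $ l\<rfloor>" for l
      by (subst eq_commute, subst floor_eq_iff) (auto simp: field_simps)
    then show ?thesis by (simp add: cube_def half_open_cube_def real_vec_def)
  qed
  show "\<exists>!L. L \<in> dyadic_cubes j \<and> x0 \<in> L"
  proof (rule ex1I[of _ "cube (\<chi> l. \<lfloor>2 ^ j * x0 $ l\<rfloor>)"])
    show "cube (\<chi> l. \<lfloor>2 ^ j * x0 $ l\<rfloor>) \<in> dyadic_cubes j \<and> x0 \<in> cube (\<chi> l. \<lfloor>2 ^ j * x0 $ l\<rfloor>)"
      unfolding mem by (auto simp: dyadic_cubes_def cube_def)
  next
    fix L assume L: "L \<in> dyadic_cubes j \<and> x0 \<in> L"
    then obtain k where k: "L = cube k" by (auto simp: dyadic_cubes_def cube_def)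
    with L have "k = (\<chi> l. \<lfloor>2 ^ j * x0 $ l\<rfloor>)" by (simp add: mem vec_eq_iff)
    with k show "L = cube (\<chi> l. \<lfloor>2 ^ j * x0 $ l\<rfloor>)" by simp
  qed
qed

lemma wavelet_cube_near:
  fixes x0 :: "real^'n"
  assumes L: "L \<in> neighbour_cubes j x0" and j: "j \<le> j'" and i: "i \<in> wavelet_types"
    and sub: "wavelet_cube i j' k \<subseteq> L"
  shows "norm ((1 / 2 ^ j') *\<^sub>R real_vec k - x0) \<le> (3 * real CARD('n) + 1) / 2 ^ j"
proof -
  let ?d = "real CARD('n)"
  define z where "z = (1 / 2 ^ (j' + 1)) *\<^sub>R real_vec i + (1 / 2 ^ j') *\<^sub>R real_vec k"
  have "z \<in> wavelet_cube i j' k" by (simp add: wavelet_cube_def half_open_cube_def z_def)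
  then have z: "z \<in> L" using sub by auto
  obtain a where a: "L = half_open_cube a (1 / 2 ^ j)" using L
      by (auto simp: neighbour_cubes_def dyadic_cubes_def)
  define L0 where "L0 = dyadic_cube_at j x0"
  have L0: "L0 \<in> dyadic_cubes j" "x0 \<in> L0" using dyadic_cube_at[of j x0] by (auto simp: L0_def)
  obtain b where b: "L0 = half_open_cube b (1 / 2 ^ j)" using L0 by (auto simp: dyadic_cubes_def)
  have "setdist L L0 < 1 / 2 ^ j" using L by (simp add: neighbour_cubes_def L0_def)
  then obtain x y where xy: "x \<in> L" "y \<in> L0" "dist x y < 1 / 2 ^ j"
    using z L0(2) by (auto elim!: setdist_ltE)
  have "dist ((1 / 2 ^ j') *\<^sub>R real_vec k) z \<le> ?d * (1 / 2 ^ j')"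
    unfolding dist_norm
  proof (rule norm_le_card_vec)
    fix l
    have "i $ l \<in> {0, 1}" using i by (simp add: wavelet_types_def)
    then show "\<bar>((1 / 2 ^ j') *\<^sub>R real_vec k - z) $ l\<bar> \<le> 1 / 2 ^ j'"
      by (auto simp: z_def real_vec_def field_simps)
  qed
  also have "\<dots> \<le> ?d * (1 / 2 ^ j)" using j
      by (intro mult_left_mono divide_left_mono power_increasing) auto
  finally have 1: "dist ((1 / 2 ^ j') *\<^sub>R real_vec k) z \<le> ?d * (1 / 2 ^ j)" .
  have 2: "dist z x \<le> ?d * (1 / 2 ^ j)" using z xy unfolding a by (intro half_open_cube_dist)
  have 3: "dist y x0 \<le> ?d * (1 / 2 ^ j)" using L0 xy unfolding b by (intro half_open_cube_dist)
  have "dist ((1 / 2 ^ j') *\<^sub>R real_vec k) x0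
      \<le> dist ((1 / 2 ^ j') *\<^sub>R real_vec k) z + (dist z x + (dist x y + dist y x0))"
    by (meson add_left_mono dist_triangle order_trans)
  also have "\<dots> \<le> ?d * (1 / 2 ^ j) + (?d * (1 / 2 ^ j) + (1 / 2 ^ j + ?d * (1 / 2 ^ j)))"
    using 1 2 3 xy by (intro add_mono) auto
  also have "\<dots> = (3 * ?d + 1) / 2 ^ j" by (simp add: field_simps)
  finally show ?thesis by (simp add: dist_norm)
qed

text \<open>The constants for the mother wavelets are added up over the finitely many types. The factor
\<open>2 powr ((j - j') * d / p)\<close> in the definition of the leaders cancels the dependence on \<open>j'\<close> in
\<open>lp_norm_coeff_le\<close>, so the supremum over \<open>j'\<close> is harmless.\<close>

lemma p_leader_at_le:
  fixes f :: "real^'n \<Rightarrow> complex" and \<psi> :: "int^'n \<Rightarrow> real^'n \<Rightarrow> complex"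
  assumes p: "1 \<le> p" and f: "f \<in> borel_measurable borel" and fin: "Lp_norm p lebesgue f < \<infinity>"
    and \<psi>: "\<And>i. i \<in> wavelet_types \<Longrightarrow> rapidly_decaying (\<psi> i) \<and> vanishing_moments (\<psi> i)"
  shows "\<exists>B\<ge>0. \<forall>j. p_leader_at p \<psi> f x0 j
    \<le> ennreal (B * 2 powr (real j * real CARD('n) * recip p)) * shell_bound n m p x0 f 0 j"
proof -
  let ?d = "CARD('n)"
  obtain C where C: "schur_bound TYPE('n) C" using schur_bound_exists by blast
  have C0: "0 < C" using C by (simp add: schur_bound_def)
  define M where "M = ?d + 2"
  define N where "N = M + Suc n"
  have N0: "0 < N" by (simp add: N_def)
  \<comment> \<open>With this factor even the steps of the scale following \<open>2 ^ l / 2 ^ j\<close> satisfy the restriction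
    in \<open>lp_norm_mean_diff_le\<close>.\<close>
  define \<kappa> where "\<kappa> = 1 / (4 * (real m + 1))"
  have \<kappa>0: "0 < \<kappa>" by (simp add: \<kappa>_def)
  note finT = finite_wavelet_types[where 'n = 'n]
  have "\<forall>i\<in>wavelet_types. \<exists>a\<ge>0. \<forall>y. norm (\<psi> i y) \<le> a * decay N y"
    using \<psi> by (auto simp: rapidly_decaying_def elim!: decayingE)
        (meson \<psi> decayingE rapidly_decaying_def)
  then obtain a1 where a1: "\<And>i. i \<in> wavelet_types \<Longrightarrow> 0 \<le> a1 i"
      "\<And>i y. i \<in> wavelet_types \<Longrightarrow> norm (\<psi> i y) \<le> a1 i * decay N y"
    by metis
  have "\<forall>i\<in>wavelet_types. \<exists>a\<ge>0. \<forall>S\<ge>\<kappa>. \<forall>y. norm (smooth N m S (\<psi> i) y)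
      \<le> a * inverse (S + norm y) ^ N"
    using \<psi> by (intro ballI smooth_decay N0 \<kappa>0) auto
  then obtain a2 where a2: "\<And>i. i \<in> wavelet_types \<Longrightarrow> 0 \<le> a2 i"
    "\<And>i S y. i \<in> wavelet_types \<Longrightarrow> \<kappa> \<le> S \<Longrightarrow> norm (smooth N m S (\<psi> i) y)
        \<le> a2 i * inverse (S + norm y) ^ N"
    by metis
  define A1 where "A1 = (\<Sum>i\<in>wavelet_types. a1 i)"
  define A2 where "A2 = (\<Sum>i\<in>wavelet_types. a2 i)"
  have A1: "0 \<le> A1" "\<And>i y. i \<in> wavelet_types \<Longrightarrow> norm (\<psi> i y) \<le> A1 * decay N y"
  proof -
    show "0 \<le> A1" unfolding A1_def by (intro sum_nonneg a1)
    fix i y assume i: "i \<in> (wavelet_types :: (int^'n) set)"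
    have "a1 i \<le> A1" unfolding A1_def using finT i a1 by (intro member_le_sum) auto
    then show "norm (\<psi> i y) \<le> A1 * decay N y"
      using a1(2)[OF i, of y] mult_right_mono[of "a1 i" A1 "decay N y"] by simp
  qed
  have A2: "0 \<le> A2" "\<And>i S y. i \<in> wavelet_types \<Longrightarrow> \<kappa> \<le> S \<Longrightarrow> norm (smooth N m S (\<psi> i) y)
      \<le> A2 * inverse (S + norm y) ^ N"
  proof -
    show "0 \<le> A2" unfolding A2_def by (intro sum_nonneg a2)
    fix i S and y :: "real^'n" assume i: "i \<in> (wavelet_types :: (int^'n) set)" and S: "\<kappa> \<le> S"
    have "a2 i \<le> A2" unfolding A2_def using finT i a2 by (intro member_le_sum) auto
    then have "a2 i * inverse (S + norm y) ^ N \<le> A2 * inverse (S + norm y) ^ N"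
      using S \<kappa>0 by (intro mult_right_mono zero_le_power) auto
    then show "norm (smooth N m S (\<psi> i) y) \<le> A2 * inverse (S + norm y) ^ N"
      using a2(2)[OF i S, of y] by simp
  qed
  define \<rho> where "\<rho> = 3 * real ?d + 1"
  have \<rho>: "0 \<le> \<rho>" by (simp add: \<rho>_def)
  define A where "A = max (A1 * (1 + \<rho>) ^ Suc n) (A2 * (inverse \<kappa> ^ M * ((1 + \<rho>) / \<kappa>) ^ Suc n))"
  have A0: "0 \<le> A" unfolding A_def using A1(1) \<rho> by (intro max.coboundedI1) simp
  define B where "B = 7 * (2 ^ m * C * A * 4 ^ Suc n)"
  have B0: "0 \<le> B" using C0 A0 by (simp add: B_def)
  have \<psi>m: "\<psi> i \<in> borel_measurable borel" if "i \<in> wavelet_types" for i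
    using \<psi>[OF that] by (auto simp: rapidly_decaying_def decaying_def)
  have "p_leader_at p \<psi> f x0 j \<le> ennreal (B * 2 powr (real j * real ?d * recip p))
      * shell_bound n m p x0 f 0 j" for j
    unfolding p_leader_at_def p_leader_def
  proof (intro SUP_least)
    fix L j' assume L: "L \<in> neighbour_cubes j x0" and "j' \<in> {j..}"
    then have j: "j \<le> j'" by simp
    define I where "I = {(i, k'). i \<in> wavelet_types \<and> wavelet_cube i j' k' \<subseteq> L}"
    define s where "s = 2 powr ((real j - real j') * real ?d * recip p)"
    have s0: "0 \<le> s" by (simp add: s_def)
    define Y where "Y = (\<lambda>(i, k). ennreal (2 ^ (?d * j')) *
      ennreal (norm (\<integral>x. f x * \<psi> i (2 ^ j' *\<^sub>R x - real_vec k) \<partial>lborel)))"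
    have "lp_norm p I (\<lambda>(i, k'). ennreal (s * norm (wavelet_coeff \<psi> f i j' k')))
        \<le> lp_norm p I (\<lambda>ik. ennreal s * Y ik)"
    proof (intro lp_norm_mono p order_refl eq_refl)
      fix ik assume "ik \<in> I"
      then obtain i k where ik: "ik = (i, k)" and i: "i \<in> wavelet_types" by (auto simp: I_def)
      note [measurable] = f \<psi>m[OF i]
      have "(\<integral>x. f x * \<psi> i (2 ^ j' *\<^sub>R x - real_vec k) \<partial>lebesgue)
          = (\<integral>x. f x * \<psi> i (2 ^ j' *\<^sub>R x - real_vec k) \<partial>lborel)"
        by (rule integral_completion) measurable
      then have "norm (wavelet_coeff \<psi> f i j' k)
          = 2 ^ (?d * j') * norm (\<integral>x. f x * \<psi> i (2 ^ j' *\<^sub>R x - real_vec k) \<partial>lborel)"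
        by (simp add: wavelet_coeff_def norm_mult norm_power)
      then show "(case ik of (i, k') \<Rightarrow> ennreal (s * norm (wavelet_coeff \<psi> f i j' k')))
          = ennreal s * Y ik"
        using s0 by (simp add: ik Y_def ennreal_mult)
    qed
    also have "\<dots> \<le> ennreal s * lp_norm p I Y" by (rule lp_norm_cmult[OF p s0])
    also have "\<dots> \<le> ennreal s * (ennreal (7
        * (2 ^ m * C * A * 4 ^ Suc n * 2 powr (real j' * real ?d * recip p)))
        * shell_bound n m p x0 f 0 j)"
      unfolding Y_def
    proof (intro mult_left_mono lp_norm_coeff_le[OF C p f fin N_def[unfolded M_def] \<kappa>_def A1 A2
        \<psi>m _ j \<rho>])
      show "I \<subseteq> wavelet_types \<times> UNIV" by (auto simp: I_def)
      show "A1 * (1 + \<rho>) ^ Suc n \<le> A" "A2 * (inverse \<kappa> ^ (?d + 2) * ((1 + \<rho>) / \<kappa>) ^ Suc n) \<le> A"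
        by (simp_all only: A_def M_def max.cobounded1 max.cobounded2)
      show "norm ((1 / 2 ^ j') *\<^sub>R real_vec k - x0) \<le> \<rho> / 2 ^ j" if "(i, k) \<in> I" for i k
        using that unfolding \<rho>_def I_def by (intro wavelet_cube_near[OF L j, of i]) auto
    qed auto
    also have "\<dots> = ennreal (B * 2 powr (real j * real ?d * recip p)) * shell_bound n m p x0 f 0 j"
    proof -
      have "s * 2 powr (real j' * real ?d * recip p) = 2 powr (real j * real ?d * recip p)"
        unfolding s_def powr_add[symmetric] by (simp add: algebra_simps)
      then have "s * (7 * (2 ^ m * C * A * 4 ^ Suc n * 2 powr (real j' * real ?d * recip p)))
          = B * 2 powr (real j * real ?d * recip p)"
        by (simp only: B_def mult_ac) (simp add: mult_ac)
      moreover have "ennreal s * ennreal (7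
          * (2 ^ m * C * A * 4 ^ Suc n * 2 powr (real j' * real ?d * recip p)))
          = ennreal (s * (7 * (2 ^ m * C * A * 4 ^ Suc n * 2 powr (real j' * real ?d * recip p))))"
        using s0 C0 A0 by (intro ennreal_mult[symmetric]) auto
      ultimately show ?thesis by (simp only: mult.assoc[symmetric])
    qed
    finally show "lp_norm p {(i, k'). i \<in> wavelet_types \<and> wavelet_cube i j' k' \<subseteq> L}
        (\<lambda>(i, k'). ennreal (2 powr ((real j - real j') * real ?d * recip p)
            * norm (wavelet_coeff \<psi> f i j' k')))
      \<le> ennreal (B * 2 powr (real j * real ?d * recip p)) * shell_bound n m p x0 f 0 j"
      by (simp only: I_def s_def)
  qed
  then show ?thesis using B0 by blast
qed

section \<open>Summation over the scales\<close>

lemma lp_norm_shift_le: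
  fixes \<theta> :: "nat \<Rightarrow> ennreal"
  assumes q: "1 \<le> q"
  shows "lp_norm q UNIV (\<lambda>j. if i \<le> j then \<theta> (j - i) else 0) \<le> lp_norm q UNIV \<theta>"
proof (rule lp_norm_leI[OF q])
  fix F :: "nat set" assume F: "finite F"
  let ?s = "\<lambda>j. if i \<le> j then \<theta> (j - i) else 0"
  define G where "G = {j \<in> F. i \<le> j}"
  show "lp_norm q F (?s) \<le> lp_norm q UNIV \<theta>"
  proof (cases "q = \<infinity>")
    case True
    have "(SUP j\<in>F. if i \<le> j then \<theta> (j - i) else 0) \<le> (SUP j. \<theta> j)"
      by (rule SUP_least) (auto intro: SUP_upper)
    then show ?thesis using True by (simp add: lp_norm_def)
  next
    case False
    have "(\<Sum>j\<in>F. epowr (if i \<le> j then \<theta> (j - i) else 0) (enn2real q))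
        = (\<Sum>j\<in>G. epowr (\<theta> (j - i)) (enn2real q))"
      unfolding G_def using F by (intro sum.mono_neutral_cong_right) (auto simp: epowr_0)
    also have "\<dots> = (\<Sum>j\<in>(\<lambda>j. j - i) ` G. epowr (\<theta> j) (enn2real q))"
      by (subst sum.reindex) (auto simp: inj_on_def G_def)
    finally have "lp_norm q F (?s) = lp_norm q ((\<lambda>j. j - i) ` G) \<theta>"
      using F by (simp add: lp_norm_finite[OF q False] G_def)
    also have "\<dots> \<le> lp_norm q UNIV \<theta>" by (intro lp_norm_mono q) auto
    finally show ?thesis .
  qed
qed

text \<open>The Young inequality for convolution with a summable sequence: the convolution is a sum
of shifts of \<open>\<theta>\<close> with weights \<open>2\<^sup>-\<^sup>i\<close>, to which the Minkowski inequality applies.\<close>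

lemma lp_norm_geometric_convolution_le:
  assumes q: "1 \<le> q"
  shows "lp_norm q UNIV (\<lambda>j. \<Sum>i=0..j. ennreal ((1/2) ^ i) * \<theta> (j - i)) \<le> 2 * lp_norm q UNIV \<theta>"
proof -
  let ?c = "\<lambda>i. ennreal ((1/2) ^ i)"
  define sh where "sh i j = (if i \<le> j then \<theta> (j - i) else 0)" for i j :: nat
  have "(\<Sum>i=0..j. ?c i * \<theta> (j - i)) = (\<Sum>i. ?c i * sh i j)" for j
  proof -
    have "(\<Sum>i. ?c i * sh i j) = (\<Sum>i=0..j. ?c i * sh i j)"
      by (intro suminf_finite) (auto simp: sh_def)
    also have "\<dots> = (\<Sum>i=0..j. ?c i * \<theta> (j - i))"
      by (intro sum.cong) (auto simp: sh_def)
    finally show ?thesis by simp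
  qed
  then have "lp_norm q UNIV (\<lambda>j. \<Sum>i=0..j. ?c i * \<theta> (j - i))
      = lp_norm q UNIV (\<lambda>j. \<Sum>i. ?c i * sh i j)" by simp
  also have "\<dots> \<le> (\<Sum>i. lp_norm q UNIV (\<lambda>j. ?c i * sh i j))"
    by (rule lp_norm_suminf_le[OF q])
  also have "\<dots> \<le> (\<Sum>i. ?c i * lp_norm q UNIV \<theta>)"
  proof (intro suminf_le)
    fix i
    have "lp_norm q UNIV (\<lambda>j. ?c i * sh i j) \<le> ?c i * lp_norm q UNIV (sh i)"
      by (rule lp_norm_cmult[OF q]) simp
    also have "\<dots> \<le> ?c i * lp_norm q UNIV \<theta>"
      unfolding sh_def[abs_def] by (intro mult_left_mono lp_norm_shift_le q) simp
    finally show "lp_norm q UNIV (\<lambda>j. ?c i * sh i j) \<le> ?c i * lp_norm q UNIV \<theta>" .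
  qed auto
  also have "\<dots> = (\<Sum>i. ?c i) * lp_norm q UNIV \<theta>" by simp
  also have "(\<Sum>i. ?c i) = ennreal (\<Sum>i. (1/2) ^ i)"
    by (intro suminf_ennreal2) auto
  also have "(\<Sum>i. (1/2::real) ^ i) = 2" by (simp add: suminf_geometric)
  finally show ?thesis by simp
qed

lemma lp_norm_single_le:
  assumes q: "1 \<le> q"
  shows "lp_norm q UNIV (\<lambda>k::nat. if k = 0 then c else 0) \<le> c"
proof (rule lp_norm_leI[OF q])
  fix F :: "nat set" assume F: "finite F"
  show "lp_norm q F (\<lambda>k. if k = 0 then c else 0) \<le> c"
  proof (cases "q = \<infinity>")
    case True
    have "(SUP k\<in>F. if k = 0 then c else 0) \<le> c" by (rule SUP_least) simp
    then show ?thesis using True by (simp add: lp_norm_def)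
  next
    case False
    note r = enn2real_exponent[OF q False]
    have "(\<Sum>k\<in>F. epowr (if k = 0 then c else 0) (enn2real q))
        = (\<Sum>k\<in>F. if k = 0 then epowr c (enn2real q) else 0)"
      by (intro sum.cong) (auto simp: epowr_0)
    also have "\<dots> \<le> epowr c (enn2real q)" using F by simp
    finally show ?thesis
      using r by (simp add: lp_norm_finite[OF q False F] epowr_inverse_le_iff)
  qed
qed

text \<open>The case of a function \<open>f\<close> that is not measurable is included since its essential supremum
is infinite by convention; this is why an inequality is stated and not an equality.\<close>

lemma Lp_norm_le_AE:
  assumes p: "1 \<le> p" and g: "g \<in> borel_measurable M" and eq: "AE x in M. f x = g x"
  shows "Lp_norm p M g \<le> Lp_norm p M f"
proof (cases "p = \<infinity>")
  case True
  have "AE x in M. ennreal (norm (g x)) \<le> esssup M (\<lambda>x. ennreal (norm (f x)))"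
    using eq esssup_AE[of "\<lambda>x. ennreal (norm (f x))" M] by eventually_elim simp
  then show ?thesis using True g by (auto simp: Lp_norm_def intro!: esssup_I)
next
  case False
  have "(\<integral>\<^sup>+ x. ennreal (norm (g x) powr enn2real p) \<partial>M)
      = (\<integral>\<^sup>+ x. ennreal (norm (f x) powr enn2real p) \<partial>M)"
    using eq by (intro nn_integral_cong_AE) (auto elim!: eventually_mono)
  then show ?thesis using False by (simp add: Lp_norm_def)
qed

text \<open>Fubini arguments on products of the Borel-Lebesgue measure need Borel functions. The
lemmas on functions that agree almost everywhere, from this one to the one on leaders, allow \<open>f\<close> to
be replaced by a Borel function.\<close>

lemma borel_version:
  fixes f :: "'a::euclidean_space \<Rightarrow> complex"
  assumes "f \<in> borel_measurable lebesgue"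
  obtains g where "g \<in> borel_measurable borel" "AE x in lborel. f x = g x"
proof -
  have "(\<lambda>x. Re (f x)) \<in> borel_measurable lebesgue" "(\<lambda>x. Im (f x)) \<in> borel_measurable lebesgue"
    using assms by measurable
  then obtain u v where uv: "u \<in> borel_measurable lborel" "AE x in lborel. Re (f x) = u x"
    "v \<in> borel_measurable lborel" "AE x in lborel. Im (f x) = v x"
    using completion_ex_borel_measurable_real by metis
  show thesis
  proof
    show "(\<lambda>x. Complex (u x) (v x)) \<in> borel_measurable borel"
      using uv unfolding Complex_eq by (auto intro!: borel_measurable_add borel_measurable_times
          borel_measurable_of_real)
    show "AE x in lborel. f x = Complex (u x) (v x)"
      using uv(2,4) by eventually_elim (auto simp: complex_eq_iff)
  qed
qed

lemma AE_lborel_translate: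
  fixes v :: "'a::euclidean_space"
  assumes "AE x in lborel. P x"
  shows "AE x in lborel. P (x + v)"
proof -
  obtain N where N: "N \<in> null_sets lborel" "{x \<in> space lborel. \<not> P x} \<subseteq> N"
    using assms by (auto simp: eventually_ae_filter)
  have "AE x in distr lborel borel (\<lambda>x. x + v). x \<notin> N"
    using N(1) by (subst lborel_translate[symmetric]) (rule AE_not_in)
  then have "AE x in lborel. x + v \<notin> N"
    using N(1) by (subst (asm) AE_distr_iff) (auto simp: null_sets_def)
  then show ?thesis by eventually_elim (use N(2) in auto)
qed

lemma fin_diff_AE:
  fixes f g :: "real^'n \<Rightarrow> complex"
  assumes "AE x in lborel. f x = g x"
  shows "AE x in lborel. fin_diff m h f x = fin_diff m h g x"
proof -
  have "AE x in lborel. \<forall>i\<in>{..m}. f (x + real i *\<^sub>R h) = g (x + real i *\<^sub>R h)"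
    by (intro AE_finite_allI AE_lborel_translate assms) simp
  then show ?thesis by eventually_elim (simp add: fin_diff_eq_sum)
qed

lemma diff_modulus_le_AE:
  fixes f g :: "real^'n \<Rightarrow> complex"
  assumes p: "1 \<le> p" and g: "g \<in> borel_measurable borel" and eq: "AE x in lborel. f x = g x"
  shows "diff_modulus m p x0 g n \<le> diff_modulus m p x0 f n"
  unfolding diff_modulus_def
proof (intro SUP_mono' Lp_norm_le_AE p)
  fix h :: "real^'n"
  note [measurable] = g
  have "fin_diff m h g \<in> borel_measurable borel" by measurable
  then show "fin_diff m h g \<in> borel_measurable (lebesgue_on (diff_ball m h x0 (1 / 2 ^ n)))"
    by (intro measurable_restrict_space1 measurable_completion) simp
  have "AE x in lebesgue. fin_diff m h f x = fin_diff m h g x"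
    by (intro AE_completion fin_diff_AE eq)
  then show "AE x in lebesgue_on (diff_ball m h x0 (1 / 2 ^ n)). fin_diff m h f x
      = fin_diff m h g x"
    by (subst AE_restrict_space_iff) (auto elim!: eventually_mono)
qed

lemma p_leader_at_le_AE:
  fixes f g :: "real^'n \<Rightarrow> complex"
  assumes p: "1 \<le> p" and f: "f \<in> borel_measurable lebesgue" and g: "g \<in> borel_measurable borel"
    and eq: "AE x in lborel. f x = g x"
    and \<psi>: "\<And>i. i \<in> wavelet_types \<Longrightarrow> \<psi> i \<in> borel_measurable borel"
  shows "p_leader_at p \<psi> f x0 j \<le> p_leader_at p \<psi> g x0 j"
proof -
  have coeff: "wavelet_coeff \<psi> f i j' k = wavelet_coeff \<psi> g i j' k" if i: "i \<in> wavelet_types"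
      for i j' k
  proof -
    note [measurable] = \<psi>[OF i]
    have "(\<lambda>x. \<psi> i (2 ^ j' *\<^sub>R x - real_vec k)) \<in> borel_measurable lborel" by measurable
    then have [measurable]: "(\<lambda>x. \<psi> i (2 ^ j' *\<^sub>R x - real_vec k)) \<in> borel_measurable lebesgue"
      by (rule measurable_completion)
    have [measurable]: "g \<in> borel_measurable lebesgue" using g by (intro measurable_completion) simp
    note [measurable] = f
    have "AE x in lebesgue. f x = g x" using eq by (rule AE_completion)
    then have "(\<integral>x. f x * \<psi> i (2 ^ j' *\<^sub>R x - real_vec k) \<partial>lebesgue)
        = (\<integral>x. g x * \<psi> i (2 ^ j' *\<^sub>R x - real_vec k) \<partial>lebesgue)"
      by (intro integral_cong_AE) (auto elim!: eventually_mono)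
    then show ?thesis by (simp add: wavelet_coeff_def)
  qed
  show ?thesis
    unfolding p_leader_at_def p_leader_def
    by (intro SUP_mono' lp_norm_mono p order_refl) (auto simp: coeff)
qed

lemma schwartz_rapidly_decaying:
  assumes "schwartz g"
  shows "rapidly_decaying g"
  unfolding rapidly_decaying_def decaying_def
proof (intro allI conjI)
  fix M
  have g: "\<forall>x. g differentiable (at x)" "\<forall>N::nat. \<exists>C. \<forall>x. (1 + norm x) ^ N * norm (g x) \<le> C"
    using assms[unfolded schwartz_def, rule_format, of "[]"] by (simp_all add: Let_def)
  then have "continuous_on UNIV g"
    by (auto intro!: continuous_at_imp_continuous_on differentiable_imp_continuous_within)
  then show "g \<in> borel_measurable borel" by (rule borel_measurable_continuous_onI)
  obtain C where C: "\<And>x. (1 + norm x) ^ M * norm (g x) \<le> C" using g(2) by blast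
  have "norm (g x) \<le> C * decay M x" for x
  proof -
    have "0 < 1 + norm x" by (simp add: add_pos_nonneg)
    then have "norm (g x) = ((1 + norm x) ^ M * norm (g x)) * decay M x"
      by (simp add: decay_def field_simps)
    also have "\<dots> \<le> C * decay M x" by (intro mult_right_mono C) simp
    finally show ?thesis .
  qed
  then show "\<exists>C. \<forall>x. norm (g x) \<le> C * decay M x" by blast
qed

lemma admissible_growth:
  assumes "admissible \<sigma>"
  obtains D where "1 \<le> D" "\<And>i j. i \<le> j \<Longrightarrow> \<sigma> j \<le> D ^ i * \<sigma> (j - i)"
proof -
  from assms obtain C where C: "0 < C" "\<And>j. \<sigma> (Suc j) \<le> C * \<sigma> j" and pos: "\<And>j. 0 < \<sigma> j"
    by (auto simp: admissible_def)
  define D where "D = max 1 C"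
  have D: "1 \<le> D" "C \<le> D" by (auto simp: D_def)
  have "\<sigma> (k + i) \<le> D ^ i * \<sigma> k" for i k
  proof (induction i)
    case (Suc i)
    have "\<sigma> (k + Suc i) \<le> C * \<sigma> (k + i)" using C(2)[of "k + i"] by simp
    also have "\<dots> \<le> D * \<sigma> (k + i)" using D pos[of "k + i"] by (intro mult_right_mono) auto
    also have "\<dots> \<le> D * (D ^ i * \<sigma> k)" using D Suc by (intro mult_left_mono) auto
    finally show ?case by simp
  qed simp
  from this[of "j - i" i for i j] have "\<sigma> j \<le> D ^ i * \<sigma> (j - i)" if "i \<le> j" for i j
    using that by (metis le_add_diff_inverse2)
  with D show thesis by (intro that[of D]) auto
qed

text \<open>Passing from scale \<open>j - i\<close> to scale \<open>j\<close> multiplies the weight \<open>w\<close> by at most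
\<open>(D * 2\<^sup>d)\<^sup>i \<le> 2\<^sup>n\<^sup>i\<close>, which the decay of order \<open>Suc n\<close> absorbs with a factor \<open>2\<^sup>-\<^sup>i\<close> left over. The
exterior term is written as the term \<open>i = j\<close> of a convolution.\<close>

lemma weighted_shell_bound_le:
  fixes f :: "real^'n \<Rightarrow> complex"
  assumes \<sigma>: "\<And>j. 0 < \<sigma> j" and D: "1 \<le> D" "\<And>i j. i \<le> j \<Longrightarrow> \<sigma> j \<le> D ^ i * \<sigma> (j - i)"
    and n: "D * 2 ^ CARD('n) \<le> 2 ^ n" and p: "1 \<le> p"
  defines "w \<equiv> \<lambda>j. \<sigma> j * 2 powr (real j * real CARD('n) * recip p)"
  shows "ennreal (w j) * shell_bound (Suc n) m p x0 f 0 j \<le>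
    (\<Sum>i=0..j. ennreal ((1/2) ^ i) * (ennreal (w (j - i)) * diff_modulus m p x0 f (j - i)
      + (if j - i = 0 then ennreal (w 0) * Lp_norm p lebesgue f else 0)))"
proof -
  let ?d = "real CARD('n)"
  let ?e = "\<lambda>i::nat. ennreal ((1/2) ^ i)" and ?\<omega> = "\<lambda>i. diff_modulus m p x0 f (j - i)"
  have w0: "0 \<le> w k" for k using \<sigma>[of k] by (simp add: w_def)
  \<comment> \<open>The factor \<open>2\<^bsup>id/p\<^esup>\<close> is bounded by \<open>2\<^sup>i\<^sup>d\<close> uniformly in \<open>p\<close>.\<close>
  have step: "ennreal (w j) * ennreal ((1/2) ^ (i * Suc n)) \<le> ?e i * ennreal (w (j - i))"
      if i: "i \<le> j" for i
  proof -
    define P where "P = 2 powr (real (j - i) * ?d * recip p)"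
    have "real j * ?d * recip p = real i * ?d * recip p + real (j - i) * ?d * recip p"
      using i by (simp add: of_nat_diff algebra_simps)
    then have split: "2 powr (real j * ?d * recip p) = 2 powr (real i * ?d * recip p) * P"
      by (simp add: P_def powr_add)
    have "real i * ?d * recip p \<le> real (CARD('n) * i)"
      using mult_left_mono[OF recip_bounds(2)[OF p], of "real i * ?d"] by (simp add: mult.commute)
    then have "2 powr (real i * ?d * recip p) \<le> 2 powr real (CARD('n) * i)"
        by (intro powr_mono) auto
    also have "\<dots> = (2 ^ CARD('n)) ^ i" by (subst powr_realpow) (auto simp: power_mult)
    finally have "w j \<le> (D ^ i * \<sigma> (j - i)) * ((2 ^ CARD('n)) ^ i * P)"
      unfolding w_def split using D i \<sigma> by (intro mult_mono) (auto simp: P_def less_imp_le)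
    also have "\<dots> = (D * 2 ^ CARD('n)) ^ i * w (j - i)"
      by (simp only: w_def P_def power_mult_distrib mult_ac)
    also have "\<dots> \<le> (2 ^ n) ^ i * w (j - i)"
      using n D w0 by (intro mult_right_mono power_mono) auto
    finally have "w j * (1/2) ^ (i * Suc n) \<le> ((2 ^ n) ^ i * w (j - i)) * (1/2) ^ (i * Suc n)"
      by (intro mult_right_mono) auto
    also have "\<dots> = (1/2) ^ i * w (j - i)"
    proof -
      have "(2 ^ n) ^ i * (1/2::real) ^ (i * Suc n) = (1/2) ^ i"
        by (simp add: power_add power_one_over mult.commute flip: power_mult)
      then show ?thesis by (metis mult.assoc mult.commute)
    qed
    finally have "ennreal (w j * (1/2) ^ (i * Suc n)) \<le> ennreal ((1/2) ^ i * w (j - i))"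
        by (rule ennreal_leI)
    then show ?thesis using w0 by (simp add: ennreal_mult)
  qed
  define b where "b k = (if k = 0 then ennreal (w 0) * Lp_norm p lebesgue f else 0)" for k :: nat
  have "ennreal (w j) * shell_bound (Suc n) m p x0 f 0 j
      = (\<Sum>i=0..j. (ennreal (w j) * ennreal ((1/2) ^ (i * Suc n))) * ?\<omega> i)
        + (ennreal (w j) * ennreal ((1/2) ^ (j * Suc n))) * Lp_norm p lebesgue f"
    by (simp only: shell_bound_def distrib_left sum_distrib_left mult.assoc)
  also have "\<dots> \<le> (\<Sum>i=0..j. (?e i * ennreal (w (j - i))) * ?\<omega> i)
        + (?e j * ennreal (w (j - j))) * Lp_norm p lebesgue f"
    by (intro add_mono sum_mono mult_right_mono step) auto
  also have "(?e j * ennreal (w (j - j))) * Lp_norm p lebesgue f = ?e j * b (j - j)"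
    by (simp add: b_def mult.assoc)
  also have "\<dots> \<le> (\<Sum>i=0..j. ?e i * b (j - i))"
    by (rule member_le_sum) auto
  finally show ?thesis
    by (simp only: b_def[symmetric] distrib_left sum.distrib mult.assoc add_left_mono)
qed

theorem theorem3p9:
  fixes p q :: ennreal
    and x0 :: "real^'n"
    and \<sigma> :: "nat \<Rightarrow> real"
    and \<phi> :: "real^'n \<Rightarrow> complex"
    and \<psi> :: "int^'n \<Rightarrow> real^'n \<Rightarrow> complex"
    and f :: "real^'n \<Rightarrow> complex"
  assumes "1 \<le> p" and "1 \<le> q"
    and "admissible \<sigma>"
    and "(- (real CARD('n) * recip p) < upper_boyd \<sigma> \<and> upper_boyd \<sigma> < 0) \<or>
         (0 \<le> \<lfloor>upper_boyd \<sigma>\<rfloor> \<and> real_of_int \<lfloor>upper_boyd \<sigma>\<rfloor> < lower_boyd \<sigma>)"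
    and "schwartz_wavelet_basis \<phi> \<psi>"
    and "f \<in> Lp_space p"
    and "f \<in> T_space \<sigma> p q x0"
  shows "(\<lambda>j. ennreal (\<sigma> j) * p_leader_at p \<psi> f x0 j) \<in> lq_space q"
proof -
  note p = \<open>1 \<le> p\<close> and q = \<open>1 \<le> q\<close>
  define m where "m = diff_order \<sigma>"
  have f: "f \<in> borel_measurable lebesgue" and f_fin: "Lp_norm p lebesgue f < \<infinity>"
    using \<open>f \<in> Lp_space p\<close> by (auto simp: Lp_space_def)
  obtain g where g: "g \<in> borel_measurable borel" and fg: "AE x in lborel. f x = g x"
    using f by (rule borel_version)
  have g_fin: "Lp_norm p lebesgue g < \<infinity>"
    using Lp_norm_le_AE[OF p borel_imp_lebesgue_measurable[OF g] AE_completion[OF fg]] f_fin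
    by (rule le_less_trans)
  have \<psi>: "rapidly_decaying (\<psi> i) \<and> vanishing_moments (\<psi> i)" if "i \<in> wavelet_types" for i
    using \<open>schwartz_wavelet_basis \<phi> \<psi>\<close> that
        by (auto simp: schwartz_wavelet_basis_def schwartz_rapidly_decaying)
  then have \<psi>_meas: "\<psi> i \<in> borel_measurable borel" if "i \<in> wavelet_types" for i
    using that by (auto simp: rapidly_decaying_def decaying_def)
  have \<sigma>: "0 < \<sigma> j" for j using \<open>admissible \<sigma>\<close> by (simp add: admissible_def)
  obtain D where D: "1 \<le> D" "\<And>i j. i \<le> j \<Longrightarrow> \<sigma> j \<le> D ^ i * \<sigma> (j - i)"
    using \<open>admissible \<sigma>\<close> by (rule admissible_growth) blast
  obtain n where n: "D * 2 ^ CARD('n) \<le> 2 ^ n"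
    using real_arch_pow[of 2 "D * 2 ^ CARD('n)"] by (auto intro: less_imp_le)
  have "\<exists>B\<ge>0. \<forall>j. p_leader_at p \<psi> g x0 j
      \<le> ennreal (B * 2 powr (real j * real CARD('n) * recip p)) * shell_bound (Suc n) m p x0 g 0 j"
    by (rule p_leader_at_le[OF p g g_fin \<psi>])
  then obtain B where B: "0 \<le> B" and leader: "\<And>j. p_leader_at p \<psi> g x0 j
      \<le> ennreal (B * 2 powr (real j * real CARD('n) * recip p)) * shell_bound (Suc n) m p x0 g 0 j"
    by metis
  define w where "w j = \<sigma> j * 2 powr (real j * real CARD('n) * recip p)" for j
  define c where "c = ennreal (w 0) * Lp_norm p lebesgue g"
  define \<theta> where "\<theta> k = ennreal (w k) * diff_modulus m p x0 g k + (if k = 0 then c else 0)" for k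
  have le: "ennreal (\<sigma> j) * p_leader_at p \<psi> f x0 j
      \<le> ennreal B * (\<Sum>i=0..j. ennreal ((1/2) ^ i) * \<theta> (j - i))" for j
  proof -
    have "ennreal (\<sigma> j) * p_leader_at p \<psi> f x0 j \<le> ennreal (\<sigma> j) * p_leader_at p \<psi> g x0 j"
      by (intro mult_left_mono p_leader_at_le_AE p f g fg \<psi>_meas) auto
    also have "\<dots> \<le> ennreal (\<sigma> j) * (ennreal (B * 2 powr (real j * real CARD('n) * recip p))
        * shell_bound (Suc n) m p x0 g 0 j)"
      by (intro mult_left_mono leader) auto
    also have "\<dots> = ennreal B * (ennreal (w j) * shell_bound (Suc n) m p x0 g 0 j)"
      using B \<sigma>[of j] by (simp add: w_def ennreal_mult mult_ac)
    also have "\<dots> \<le> ennreal B * (\<Sum>i=0..j. ennreal ((1/2) ^ i) * \<theta> (j - i))"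
    proof (rule mult_left_mono)
      show "ennreal (w j) * shell_bound (Suc n) m p x0 g 0 j
          \<le> (\<Sum>i=0..j. ennreal ((1/2) ^ i) * \<theta> (j - i))"
        unfolding \<theta>_def c_def w_def by (rule weighted_shell_bound_le[OF \<sigma> D n p])
    qed simp
    finally show ?thesis .
  qed
  have "lp_norm q UNIV (\<lambda>k. ennreal (w k) * diff_modulus m p x0 g k)
      \<le> lp_norm q UNIV (\<lambda>k. ennreal (w k) * diff_modulus m p x0 f k)"
    by (intro lp_norm_mono q mult_left_mono diff_modulus_le_AE p g fg) auto
  also have "\<dots> < \<infinity>"
    using \<open>f \<in> T_space \<sigma> p q x0\<close> by (simp add: T_space_def lq_space_def w_def diff_modulus_def
        m_def)
  finally have \<theta>1: "lp_norm q UNIV (\<lambda>k. ennreal (w k) * diff_modulus m p x0 g k) < \<infinity>" .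
  have \<theta>2: "lp_norm q UNIV (\<lambda>k::nat. if k = 0 then c else 0) < \<infinity>"
    using lp_norm_single_le[OF q, of c] by (rule le_less_trans)
        (use g_fin in \<open>simp add: c_def ennreal_mult_less_top\<close>)
  have \<theta>_fin: "lp_norm q UNIV \<theta> < \<infinity>"
    using lp_norm_add_le[OF q, of UNIV "\<lambda>k. ennreal (w k) * diff_modulus m p x0 g k"
        "\<lambda>k. if k = 0 then c else 0"] \<theta>1 \<theta>2
    unfolding \<theta>_def[abs_def] by (auto intro: le_less_trans)
  have "lp_norm q UNIV (\<lambda>j. ennreal (\<sigma> j) * p_leader_at p \<psi> f x0 j)
      \<le> lp_norm q UNIV (\<lambda>j. ennreal B * (\<Sum>i=0..j. ennreal ((1/2) ^ i) * \<theta> (j - i)))"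
    by (intro lp_norm_mono q le) auto
  also have "\<dots> \<le> ennreal B * lp_norm q UNIV (\<lambda>j. \<Sum>i=0..j. ennreal ((1/2) ^ i) * \<theta> (j - i))"
    by (rule lp_norm_cmult[OF q B])
  also have "\<dots> \<le> ennreal B * (2 * lp_norm q UNIV \<theta>)"
    by (intro mult_left_mono lp_norm_geometric_convolution_le q) auto
  also have "\<dots> < \<infinity>"
    using \<theta>_fin by (simp add: ennreal_mult_less_top)
  finally show ?thesis by (simp add: lq_space_def)
qed

end
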